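(* Let $(\mathcal{M}_1,\mathfrak{g})$ and $(\mathcal{M}_2,\mathfrak{h})$ be smooth, oriented $d$-dimensional Riemannian manifolds and let $f:\mathcal{M}_1\to\mathcal{M}_2$ be a $C^2$ map. In local coordinates, the Riemannian Piola identity for $f$ reads, for every $\gamma=1,\dots,d$, $$-\frac{1}{|f^*\mathfrak{h}|^{1/2}}\,\partial_j\Big((\operatorname{cof}[df]^T)^j_\gamma\,|f^*\mathfrak{h}|^{1/2}\Big)+(f^*\Gamma^\beta_{\beta\gamma})\,\det[df]=0 ,$$ and this reduces to the metric-independent identity $$\partial_j\Big((\operatorname{cof}[df]^T)^j_\gamma\Big)=0 .$$ In particular the local coordinate representation of $f$ satisfies both identities.
   Context: The Riemannian Piola identity for $f$ is $\int_{\mathcal{M}_1}\langle\operatorname{Cof}df,\nabla^{f^*T\mathcal{M}_2}\xi\rangle\,d\mathrm{Vol}_1=0$ for every compactly-supported $\xi\in\Gamma(f^*T\mathcal{M}_2)$, where: $\nabla^{f^*T\mathcal{M}_2}$ is the pullback of the Levi-Civita connection of $\mathcal{M}_2$; the inner product is the one induced by $\mathfrak{g},\mathfrak{h}$ on $T^*\mathcal{M}_1\otimes f^*T\mathcal{M}_2$; $\operatorname{Cof}df\in\Gamma(T^*\mathcal{M}_1\otimes f^*T\mathcal{M}_2)$ is the fiberwise cofactor of $df:T\mathcal{M}_1\to f^*T\mathcal{M}_2$, where for a linear map $A:V\to W$ of oriented $d$-dimensional inner-product spaces $\operatorname{Cof}A=(-1)^{d-1}\star_W^{d-1}\circ\bigwedge^{d-1}A\circ\star_V^1$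 ($\star^k$ being the Hodge-dual operators on exterior powers), so that in positively-oriented orthonormal bases it is represented by the matrix-cofactor of the matrix of $A$. Coordinates: Roman indices refer to (positively-oriented) local coordinates on $\mathcal{M}_1$, Greek indices to (positively-oriented) local coordinates on $\mathcal{M}_2$; repeated indices are summed. $[df]$ is the matrix with entries $\partial_if^\alpha$; $\operatorname{cof}$ is the matrix-cofactor (transpose of the adjugate), and $(\operatorname{cof}[df]^T)^j_\gamma$ denotes the cofactor of the entry $\partial_jf^\gamma$, so that $(\operatorname{cof}[df]^T)^j_\gamma\,\partial_jf^\beta=\det[df]\,\delta^\beta_\gamma$. $|\mathfrak{h}|$ is the determinant of the matrix $(\mathfrak{h}_{\alpha\beta})$, $|f^*\mathfrak{h}|=|\mathfrak{h}|\circ f$, $\Gamma^\alpha_{\beta\gamma}$ are the Christoffel symbols of the Levi-Civita connection of $\mathcal{M}_2$, and $f^*\Gamma^\beta_{\beta\gamma}=\Gamma^\beta_{\beta\gamma}\circ f$. *)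

theory Defs
  imports "HOL-Analysis.Analysis"
begin

section \<open>Differentiation in coordinate space\<close>

definition partial :: "'n::finite \<Rightarrow> (real^'n \<Rightarrow> 'b::real_normed_vector) \<Rightarrow> real^'n \<Rightarrow> 'b"
  where "partial i F x = frechet_derivative F (at x) (axis i 1)"

text \<open>Meant for open \<open>S\<close>, where \<open>differentiable_on\<close> does not depend on the values outside \<open>S\<close>.\<close>

primrec Ck_on :: "nat \<Rightarrow> (real^'n::finite \<Rightarrow> 'b::real_normed_vector) \<Rightarrow> (real^'n) set \<Rightarrow> bool"
  where
    "Ck_on 0 F S \<longleftrightarrow> continuous_on S F"
  | "Ck_on (Suc k) F S \<longleftrightarrow> F differentiable_on S \<and> (\<forall>i. Ck_on k (partial i F) S)"

definition smooth_on :: "(real^'n::finite \<Rightarrow> 'b::real_normed_vector) \<Rightarrow> (real^'n) set \<Rightarrow> bool"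
  where "smooth_on F S \<longleftrightarrow> (\<forall>k. Ck_on k F S)"


section \<open>Oriented smooth manifolds\<close>

text \<open>
  A manifold is a whole type of class \<open>{t2_space, second_countable_topology}\<close> together with an
  atlas of coordinate charts \<open>(U, \<phi>)\<close>; its dimension is \<open>CARD('n)\<close>. The order on \<open>'n\<close> fixes the
  standard orientation of \<open>real^'n\<close>.
\<close>

type_synonym ('m, 'n) chart = "'m set \<times> ('m \<Rightarrow> (real, 'n) vec)"

abbreviation dom :: "('m, 'n) chart \<Rightarrow> 'm set"
  where "dom c \<equiv> fst c"

abbreviation chart_inv :: "('m, 'n) chart \<Rightarrow> (real, 'n) vec \<Rightarrow> 'm"
  where "chart_inv c \<equiv> inv_into (fst c) (snd c)"

definition coord_dom ::
  "('m1, 'n) chart \<Rightarrow> ('m2, 'k) chart \<Rightarrow> ('m1 \<Rightarrow> 'm2) \<Rightarrow> ((real, 'n) vec) set"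
  where "coord_dom c1 c2 f = snd c1 ` (dom c1 \<inter> f -` dom c2)"

definition coord_rep ::
  "('m1, 'n) chart \<Rightarrow> ('m2, 'k) chart \<Rightarrow> ('m1 \<Rightarrow> 'm2) \<Rightarrow> (real, 'n) vec \<Rightarrow> (real, 'k) vec"
  where "coord_rep c1 c2 f = snd c2 \<circ> f \<circ> chart_inv c1"

abbreviation transition :: "('m, 'n) chart \<Rightarrow> ('m, 'n) chart \<Rightarrow> (real, 'n) vec \<Rightarrow> (real, 'n) vec"
  where "transition c c' \<equiv> coord_rep c c' (\<lambda>p. p)"

abbreviation transition_dom :: "('m, 'n) chart \<Rightarrow> ('m, 'n) chart \<Rightarrow> ((real, 'n) vec) set"
  where "transition_dom c c' \<equiv> coord_dom c c' (\<lambda>p. p)"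

definition is_chart :: "('m::topological_space, 'n::finite) chart \<Rightarrow> bool"
  where "is_chart c \<longleftrightarrow> open (dom c) \<and> open (snd c ` dom c) \<and>
    homeomorphism (dom c) (snd c ` dom c) (snd c) (chart_inv c)"

text \<open>
  The atlas consists of the positively oriented charts; it is not required to be maximal, but may be.
\<close>

definition oriented_atlas :: "('m::topological_space, 'n::finite) chart set \<Rightarrow> bool"
  where "oriented_atlas A \<longleftrightarrow>
    (\<Union>c\<in>A. dom c) = UNIV \<and>
    (\<forall>c\<in>A. is_chart c) \<and>
    (\<forall>c\<in>A. \<forall>c'\<in>A. smooth_on (transition c c') (transition_dom c c') \<and>
      (\<forall>x\<in>transition_dom c c'. det (jacobian (transition c c') (at x)) > 0))"

text \<open>
  A metric is given by its component matrices: \<open>g c x\<close> is the matrix of \<open>g\<close> at the point with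
  coordinates \<open>x\<close> in the chart \<open>c\<close>. Accordingly, vectors tangent at a point are given by one
  component vector for each chart, related by the Jacobians of the transition maps.
\<close>

type_synonym ('m, 'n) metric = "('m, 'n) chart \<Rightarrow> (real, 'n) vec \<Rightarrow> ((real, 'n) vec, 'n) vec"

definition riemannian_metric ::
  "('m, 'n::finite) chart set \<Rightarrow> ('m, 'n) metric \<Rightarrow> bool"
  where "riemannian_metric A g \<longleftrightarrow>
    (\<forall>c\<in>A. smooth_on (g c) (snd c ` dom c) \<and>
      (\<forall>x\<in>snd c ` dom c. transpose (g c x) = g c x \<and> (\<forall>v. v \<noteq> 0 \<longrightarrow> v \<bullet> (g c x *v v) > 0))) \<and>
    (\<forall>c\<in>A. \<forall>c'\<in>A. \<forall>x\<in>transition_dom c c'.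
      (let J = jacobian (transition c c') (at x)
       in g c x = transpose J ** g c' (transition c c' x) ** J))"

definition oriented_riemannian_manifold ::
  "('m::{t2_space, second_countable_topology}, 'n::finite) chart set \<Rightarrow> ('m, 'n) metric \<Rightarrow> bool"
  where "oriented_riemannian_manifold A g \<longleftrightarrow> oriented_atlas A \<and> riemannian_metric A g"

definition Ck_map ::
  "nat \<Rightarrow> ('m1::topological_space, 'n::finite) chart set \<Rightarrow>
   ('m2::topological_space, 'k::finite) chart set \<Rightarrow> ('m1 \<Rightarrow> 'm2) \<Rightarrow> bool"
  where "Ck_map k A1 A2 f \<longleftrightarrow> continuous_on UNIV f \<and>
    (\<forall>c1\<in>A1. \<forall>c2\<in>A2. Ck_on k (coord_rep c1 c2 f) (coord_dom c1 c2 f))"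

definition riemannian_volume ::
  "('m::topological_space, 'n::finite) chart set \<Rightarrow> ('m, 'n) metric \<Rightarrow> 'm measure"
  where "riemannian_volume A g = (THE \<mu>. sets \<mu> = sets borel \<and>
    (\<forall>c\<in>A. \<forall>B\<in>sets borel. B \<subseteq> dom c \<longrightarrow>
      emeasure \<mu> B = (\<integral>\<^sup>+x\<in>snd c ` B. ennreal (sqrt (det (g c x))) \<partial>lborel)))"

definition christoffel ::
  "(real^'n::finite \<Rightarrow> real^'n^'n) \<Rightarrow> 'n \<Rightarrow> 'n \<Rightarrow> 'n \<Rightarrow> real^'n \<Rightarrow> real"
  where "christoffel h \<alpha> \<beta> \<gamma> y = (\<Sum>\<delta>\<in>UNIV. matrix_inv (h y) $ \<alpha> $ \<delta> *
    (partial \<beta> (\<lambda>z. h z $ \<delta> $ \<gamma>) y + partial \<gamma> (\<lambda>z. h z $ \<delta> $ \<beta>) y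
      - partial \<delta> (\<lambda>z. h z $ \<beta> $ \<gamma>) y)) / 2"


section \<open>Cofactors\<close>

text \<open>
  Replacing row \<open>i\<close> by the \<open>j\<close>-th unit vector makes the determinant the signed minor of the entry
  \<open>(i, j)\<close>.
\<close>

definition cof :: "real^'n::finite^'n \<Rightarrow> real^'n^'n"
  where "cof A = (\<chi> i j. det (\<chi> k. if k = i then axis j 1 else A $ k))"

text \<open>
  Elements of the \<open>k\<close>-th exterior power of \<open>real^'n\<close> are represented as antisymmetric
  contravariant tensors, by their components indexed by lists of length \<open>k\<close>. Thus
  \<open>v\<^sub>1 \<and> \<dots> \<and> v\<^sub>k\<close> has the components \<open>det (v\<^sub>a $ (is ! b))\<^sub>a\<^sub>b\<close>.
\<close>

type_synonym 'n multivec = "'n list \<Rightarrow> real"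

definition levi_civita :: "'n::linorder list \<Rightarrow> real"
  where "levi_civita is = (if distinct is
     then (-1) ^ card {(a, b). a < b \<and> b < length is \<and> is ! b < is ! a} else 0)"

definition vec1 :: "real^'n::finite \<Rightarrow> 'n multivec"
  where "vec1 v = (\<lambda>is. v $ hd is)"

definition unvec1 :: "'n::finite multivec \<Rightarrow> real^'n"
  where "unvec1 T = (\<chi> i. T [i])"

definition ext_power :: "nat \<Rightarrow> real^'n::finite^'n \<Rightarrow> 'n multivec \<Rightarrow> 'n multivec"
  where "ext_power k A T = (\<lambda>js. \<Sum>is | length is = k. (\<Prod>l<k. A $ (js ! l) $ (is ! l)) * T is)"

text \<open>
  The Hodge operator on \<open>k\<close>-vectors of \<open>real^'n\<close> with standard orientation and inner product
  with Gram matrix \<open>G\<close>, i.e. \<open>S \<and> hodge G k T = \<langle>S, T\<rangle> vol\<close>: the indices of \<open>T\<close> are lowered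
  and contracted with the unit volume multivector \<open>levi_civita / sqrt (det G)\<close>.
\<close>

definition hodge :: "real^'n::{finite,linorder}^'n::_ \<Rightarrow> nat \<Rightarrow> 'n multivec \<Rightarrow> 'n multivec"
  where "hodge G k T = (\<lambda>js. (\<Sum>ms | length ms = k. \<Sum>is | length is = k.
    (\<Prod>l<k. G $ (ms ! l) $ (is ! l)) * T is * levi_civita (ms @ js)) / (fact k * sqrt (det G)))"

text \<open>
  The cofactor of a linear map from \<open>real^'n\<close> with Gram matrix \<open>G\<close> to \<open>real^'n\<close> with Gram
  matrix \<open>H\<close>.
\<close>

definition Cof ::
  "real^'n::{finite,linorder}^'n::_ \<Rightarrow> real^'n::_^'n::_ \<Rightarrow> real^'n::_^'n::_ \<Rightarrow> real^'n::_ \<Rightarrow> real^'n::_"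
  where "Cof G H A v = (-1) ^ (CARD('n) - 1) *\<^sub>R
    unvec1 (hodge H (CARD('n) - 1) (ext_power (CARD('n) - 1) A (hodge G 1 (vec1 v))))"


section \<open>Sections of the pullback bundle and the Riemannian Piola identity\<close>

text \<open>\<open>\<xi> c p\<close> is the component vector, in the chart \<open>c\<close> around \<open>f p\<close>, of the section at \<open>p\<close>.\<close>

type_synonym ('m1, 'm2, 'n) pullback_field = "('m2, 'n) chart \<Rightarrow> 'm1 \<Rightarrow> (real, 'n) vec"

definition pullback_section ::
  "nat \<Rightarrow> ('m1, 'n::finite) chart set \<Rightarrow> ('m2, 'n) chart set \<Rightarrow> ('m1 \<Rightarrow> 'm2) \<Rightarrow>
   ('m1, 'm2, 'n) pullback_field \<Rightarrow> bool"
  where "pullback_section k A1 A2 f \<xi> \<longleftrightarrow>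
    (\<forall>c\<in>A2. \<forall>c'\<in>A2. \<forall>p\<in>f -` (dom c \<inter> dom c').
      \<xi> c' p = jacobian (transition c c') (at (snd c (f p))) *v \<xi> c p) \<and>
    (\<forall>c1\<in>A1. \<forall>c2\<in>A2. Ck_on k (\<lambda>x. \<xi> c2 (chart_inv c1 x)) (coord_dom c1 c2 f))"

definition section_support ::
  "('m2, 'n::finite) chart set \<Rightarrow> ('m1::topological_space \<Rightarrow> 'm2) \<Rightarrow>
   ('m1, 'm2, 'n) pullback_field \<Rightarrow> 'm1 set"
  where "section_support A2 f \<xi> = closure {p. \<exists>c\<in>A2. f p \<in> dom c \<and> \<xi> c p \<noteq> 0}"

text \<open>
  Pullback of the Levi-Civita connection of \<open>h\<close>: the matrix with entries \<open>(\<nabla>\<^sub>j \<xi>)\<^sup>\<alpha>\<close> in row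
  \<open>\<alpha>\<close> and column \<open>j\<close>.
\<close>

definition pullback_nabla ::
  "('m2, 'n::finite) metric \<Rightarrow> ('m1 \<Rightarrow> 'm2) \<Rightarrow> ('m1, 'n) chart \<Rightarrow> ('m2, 'n) chart \<Rightarrow>
   ('m1, 'm2, 'n) pullback_field \<Rightarrow> real^'n \<Rightarrow> real^'n^'n"
  where "pullback_nabla h f c1 c2 \<xi> x = (\<chi> \<alpha> j.
    partial j (\<lambda>z. \<xi> c2 (chart_inv c1 z) $ \<alpha>) x +
    (\<Sum>\<beta>\<in>UNIV. \<Sum>\<gamma>\<in>UNIV. christoffel (h c2) \<alpha> \<beta> \<gamma> (coord_rep c1 c2 f x) *
      partial j (\<lambda>z. coord_rep c1 c2 f z $ \<beta>) x * \<xi> c2 (chart_inv c1 x) $ \<gamma>))"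

text \<open>
  The inner product \<open>\<langle>Cof df, \<nabla>\<xi>\<rangle>\<close> at the point with coordinates \<open>x\<close>, computed in the charts
  \<open>c1\<close> and \<open>c2\<close>.
\<close>

definition cof_pairing_in ::
  "('m1, 'n::{finite,linorder}) metric \<Rightarrow> ('m2, 'n) metric \<Rightarrow> ('m1 \<Rightarrow> 'm2) \<Rightarrow>
   ('m1, 'n) chart \<Rightarrow> ('m2, 'n) chart \<Rightarrow> ('m1, 'm2, 'n) pullback_field \<Rightarrow> real^'n::_ \<Rightarrow> real"
  where "cof_pairing_in g h f c1 c2 \<xi> x =
    (let G = g c1 x; H = h c2 (coord_rep c1 c2 f x); J = jacobian (coord_rep c1 c2 f) (at x)
     in \<Sum>i\<in>UNIV. \<Sum>j\<in>UNIV. \<Sum>\<alpha>\<in>UNIV. \<Sum>\<beta>\<in>UNIV.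
          matrix_inv G $ i $ j * H $ \<alpha> $ \<beta> *
          Cof G H J (axis i 1) $ \<alpha> * pullback_nabla h f c1 c2 \<xi> x $ \<beta> $ j)"

text \<open>The value does not depend on the charts, so any charts around \<open>p\<close> and \<open>f p\<close> will do.\<close>

definition cof_pairing ::
  "('m1, 'n::{finite,linorder}) chart set \<Rightarrow> ('m1, 'n) metric \<Rightarrow>
   ('m2, 'n) chart set \<Rightarrow> ('m2, 'n) metric \<Rightarrow> ('m1 \<Rightarrow> 'm2) \<Rightarrow>
   ('m1, 'm2, 'n) pullback_field \<Rightarrow> 'm1 \<Rightarrow> real"
  where "cof_pairing A1 g A2 h f \<xi> p =
    (let c1 = (SOME c. c \<in> A1 \<and> p \<in> dom c); c2 = (SOME c. c \<in> A2 \<and> f p \<in> dom c)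
     in cof_pairing_in g h f c1 c2 \<xi> (snd c1 p))"

text \<open>
  For a map of class \<open>C\<^sup>2\<close> the pullback bundle is only of class \<open>C\<^sup>2\<close>. The test sections are those
  of class \<open>C\<^sup>1\<close>, the largest class for which the integrand is continuous.
\<close>

definition riemannian_piola ::
  "('m1::topological_space, 'n::{finite,linorder}) chart set \<Rightarrow> ('m1, 'n) metric \<Rightarrow>
   ('m2::topological_space, 'n) chart set \<Rightarrow> ('m2, 'n) metric \<Rightarrow> ('m1 \<Rightarrow> 'm2) \<Rightarrow> bool"
  where "riemannian_piola A1 g A2 h f \<longleftrightarrow>
    (\<forall>\<xi>. pullback_section 1 A1 A2 f \<xi> \<and> compact (section_support A2 f \<xi>) \<longrightarrow>
      (LINT p|riemannian_volume A1 g. cof_pairing A1 g A2 h f \<xi> p) = 0)"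


section \<open>The identities in local coordinates\<close>

text \<open>
  For \<open>F = coord_rep c1 c2 f\<close> and \<open>H = h c2\<close>; the entry \<open>\<partial>\<^sub>iF\<^sup>\<alpha>\<close> of the Jacobian matrix is
  in row \<open>\<alpha>\<close> and column \<open>i\<close>.
\<close>

definition piola_div :: "(real^'n::finite \<Rightarrow> real^'n) \<Rightarrow> 'n \<Rightarrow> real^'n \<Rightarrow> real"
  where "piola_div F \<gamma> x =
    (\<Sum>j\<in>UNIV. partial j (\<lambda>z. cof (transpose (jacobian F (at z))) $ j $ \<gamma>) x)"

definition piola_coord ::
  "(real^'n::finite \<Rightarrow> real^'n^'n) \<Rightarrow> (real^'n \<Rightarrow> real^'n) \<Rightarrow> 'n \<Rightarrow> real^'n \<Rightarrow> real"
  where "piola_coord H F \<gamma> x =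
    - (1 / sqrt (det (H (F x)))) *
      (\<Sum>j\<in>UNIV. partial j
        (\<lambda>z. cof (transpose (jacobian F (at z))) $ j $ \<gamma> * sqrt (det (H (F z)))) x)
    + (\<Sum>\<beta>\<in>UNIV. christoffel H \<beta> \<beta> \<gamma> (F x)) * det (jacobian F (at x))"

end

theory Submission
  imports Defs
begin

text \<open>
  The cofactor of a Jacobian has divergence-free rows, for any \<open>C\<^sup>2\<close> map \<open>F\<close> of coordinate space
  (\<open>piola_div_eq_0\<close>). The entry of the cofactor belonging to \<open>\<partial>\<^sub>jF\<^sup>\<gamma>\<close> is the determinant of the
  matrix with rows \<open>\<partial>\<^sub>kF\<close> for \<open>k \<noteq> j\<close> and the unit vector \<open>e\<^sub>\<gamma>\<close> in row \<open>j\<close>. Differentiating it in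
  direction \<open>j\<close> and summing over \<open>j\<close> gives a double sum over \<open>j \<noteq> k\<close> of determinants that have
  \<open>\<partial>\<^sub>j\<partial>\<^sub>kF\<close> in row \<open>k\<close> and \<open>e\<^sub>\<gamma>\<close> in row \<open>j\<close>. Since second derivatives commute, exchanging \<open>j\<close> and
  \<open>k\<close> exchanges two rows, so the terms cancel in pairs.

  The metric-dependent identity is the same statement. The trace of the Christoffel symbols is the
  logarithmic derivative of \<open>|h|\<^sup>1\<^sup>/\<^sup>2\<close> (\<open>sum_christoffel\<close>), and contracting its pullback with the
  cofactor gives \<open>det [df]\<close> times that trace, which is exactly the term added in the identity.

  For the integral form, the linear algebra of \<open>Cof_pairing\<close> turns the intrinsic pairing
  \<open>\<langle>Cof df, \<nabla>\<xi>\<rangle>\<close> into \<open>(|h|/|g|)\<^sup>1\<^sup>/\<^sup>2\<close> times the pairing with the matrix cofactor, and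
  \<open>divergence_flux\<close>, which rests on the two facts above, identifies \<open>|g|\<^sup>1\<^sup>/\<^sup>2 \<langle>Cof df, \<nabla>\<xi>\<rangle>\<close> with the
  coordinate divergence of the flux \<open>W\<^sup>j = |f\<^sup>*h|\<^sup>1\<^sup>/\<^sup>2 (cof [df]\<^sup>T)\<^sup>j\<^sub>\<alpha> \<xi>\<^sup>\<alpha>\<close>. The flux does not depend on
  the chart of the target (\<open>flux_in_target_chart\<close>), and under a change of chart of the source it is
  multiplied by the transposed cofactor of the Jacobian (\<open>flux_in_source_chart\<close>). In other words it
  is a vector field on \<open>M\<^sub>1\<close> multiplied by the volume density, and its divergence is intrinsic: this is the
  metric-independent identity once more, now for the transition maps
  (\<open>divergence_piola_transform\<close>). As \<open>\<xi>\<close> has compact support, the divergence theorem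
  (\<open>divergence_theorem\<close>) shows that the integral vanishes.

  All three identities therefore hold for every \<open>C\<^sup>2\<close> map \<open>f\<close>, and the equivalences between them
  follow.
\<close>

section \<open>Cofactor matrices\<close>

lemma det_replace_row:
  fixes A :: "real^'n^'n"
  shows "det (\<chi> k. if k = i then v else A $ k) = (\<Sum>j\<in>UNIV. v $ j * cof A $ i $ j)"
proof -
  have v: "v = (\<Sum>j\<in>UNIV. (v $ j) *s axis j 1)"
    by (simp add: basis_expansion)
  show ?thesis
    by (subst v, subst det_linear_row_sum) (simp_all add: det_row_mul cof_def)
qed

lemma det_add_to_row:
  fixes A :: "real^'n^'n"
  shows "det (\<chi> k. if k = i then A $ i + v else A $ k) = det A + (\<Sum>j\<in>UNIV. v $ j * cof A $ i $ j)"
proof -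
  have "(\<chi> k. if k = i then A $ i else A $ k) = A"
    by (simp add: vec_eq_iff)
  then show ?thesis
    using det_row_add[of i "\<lambda>_. A $ i" "\<lambda>_. v" "\<lambda>k. A $ k"] det_replace_row[of i v A] by simp
qed

text \<open>
  Raising one entry by \<open>1\<close> adds a unit vector to its row, but also to its column. This expression
  for the cofactor is therefore symmetric in rows and columns, and it reduces rules for cofactors to
  rules for determinants.
\<close>

lemma cof_eq_det_diff:
  fixes A :: "real^'n^'n"
  shows "cof A $ i $ j = det (\<chi> k l. A $ k $ l + (if k = i \<and> l = j then 1 else 0)) - det A"
proof -
  have "(\<chi> k l. A $ k $ l + (if k = i \<and> l = j then 1 else 0)) =
     (\<chi> k. if k = i then A $ i + axis j 1 else A $ k)"
    by (simp add: vec_eq_iff axis_def)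
  then show ?thesis
    using det_add_to_row[of i A "axis j 1"]
    by (simp add: axis_def if_distrib [of "\<lambda>x. x * _"] cong: if_cong)
qed

lemma cof_transpose: "cof (transpose A) = transpose (cof (A :: real^'n^'n))"
proof -
  have "cof (transpose A) $ i $ j = cof A $ j $ i" for i j
  proof -
    have *: "(\<chi> k l. transpose A $ k $ l + (if k = i \<and> l = j then 1 else 0)) =
      transpose (\<chi> k l. A $ k $ l + (if k = j \<and> l = i then 1 else 0))"
      by (auto simp add: vec_eq_iff transpose_def)
    show ?thesis
      unfolding cof_eq_det_diff * det_transpose ..
  qed
  then show ?thesis
    by (simp add: vec_eq_iff transpose_def)
qed

lemma det_add_to_column:
  fixes A :: "real^'n^'n"
  shows "det (\<chi> k l. A $ k $ l + (if l = j then v $ k else 0)) = det A + (\<Sum>i\<in>UNIV. v $ i * cof A $ i $ j)"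
proof -
  have *: "(\<chi> k l. A $ k $ l + (if l = j then v $ k else 0)) =
    transpose (\<chi> k. if k = j then transpose A $ j + v else transpose A $ k)"
    by (auto simp add: vec_eq_iff transpose_def)
  show ?thesis
    unfolding * det_transpose det_add_to_row cof_transpose by (simp add: transpose_def)
qed

text \<open>
  Adding row \<open>k\<close> to row \<open>i\<close> leaves the determinant unchanged if \<open>k \<noteq> i\<close> and doubles it if
  \<open>k = i\<close>.
\<close>

lemma laplace_row:
  fixes A :: "real^'n^'n"
  shows "(\<Sum>j\<in>UNIV. A $ k $ j * cof A $ i $ j) = (if k = i then det A else 0)"
proof -
  let ?B = "\<chi> l. if l = i then A $ i + A $ k else A $ l"
  have "det ?B = (if k = i then 2 * det A else det A)"
  proof (cases "k = i")
    case True
    have "?B = (\<chi> l. if l = i then 2 *s A $ i else A $ l)"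
      using True by (simp add: vec_eq_iff)
    moreover have "(\<chi> l. if l = i then A $ i else A $ l) = A"
      by (simp add: vec_eq_iff)
    ultimately show ?thesis
      using det_row_mul[of i 2 "\<lambda>_. A $ i" "\<lambda>l. A $ l"] True by simp
  next
    case False
    then have "det (\<chi> l. if l = i then row i A + 1 *s row k A else row l A) = det A"
      by (intro det_row_operation) auto
    then show ?thesis using False by (simp add: row_def vec_lambda_eta cong: if_cong)
  qed
  then show ?thesis
    using det_add_to_row[of i A "A $ k"] by (simp split: if_splits)
qed

lemma laplace_column:
  fixes A :: "real^'n^'n"
  shows "(\<Sum>i\<in>UNIV. A $ i $ k * cof A $ i $ j) = (if k = j then det A else 0)"
  using laplace_row[of "transpose A" k j] unfolding cof_transpose det_transpose
  by (simp add: transpose_def)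

lemma matrix_inv_eq_cof:
  fixes A :: "real^'n^'n"
  assumes "det A \<noteq> 0"
  shows "matrix_inv A $ i $ j = cof A $ j $ i / det A"
proof -
  let ?B = "\<chi> i j. cof A $ j $ i / det A"
  have "A ** ?B = mat 1"
    using assms laplace_row[of A]
    by (simp add: matrix_matrix_mult_def vec_eq_iff mat_def sum_divide_distrib[symmetric])
  moreover have "?B ** A = mat 1"
    using assms laplace_column[of A]
    by (simp add: matrix_matrix_mult_def vec_eq_iff mat_def sum_divide_distrib[symmetric] mult.commute)
  ultimately have "A ** matrix_inv A = mat 1" and "?B ** A = mat 1"
    unfolding matrix_inv_def by (metis (mono_tags, lifting) someI_ex)+
  then have "matrix_inv A = ?B"
    by (metis matrix_mul_assoc matrix_mul_rid matrix_mul_lid)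
  then show ?thesis by simp
qed

text \<open>
  With \<open>h\<close> the \<open>i\<close>-th column of the inverse of \<open>A\<close>, raising the entry \<open>(i, j)\<close> of \<open>A ** B\<close> by
  \<open>1\<close> amounts to adding \<open>h\<close> to column \<open>j\<close> of \<open>B\<close>. Such an \<open>h\<close> needs an invertible \<open>A\<close>; in
  the applications \<open>A\<close> is a metric or the Jacobian of a transition map.
\<close>

lemma cof_mult_left:
  fixes A B :: "real^'n^'n"
  assumes "det A \<noteq> 0"
  shows "cof (A ** B) = cof A ** cof B"
proof -
  have "cof (A ** B) $ i $ j = (cof A ** cof B) $ i $ j" for i j
  proof -
    define h where "h = (\<chi> k. cof A $ i $ k / det A)"
    have 1: "(\<Sum>k\<in>UNIV. A $ l $ k * h $ k) = (if l = i then 1 else 0)" for l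
      using laplace_row[of A l i] assms by (simp add: h_def sum_divide_distrib[symmetric])
    have "(\<chi> k l. (A ** B) $ k $ l + (if k = i \<and> l = j then 1 else 0)) =
      A ** (\<chi> k l. B $ k $ l + (if l = j then h $ k else 0))"
      unfolding vec_eq_iff
    proof (intro allI)
      fix k l
      show "(\<chi> k l. (A ** B) $ k $ l + (if k = i \<and> l = j then 1 else 0)) $ k $ l =
        (A ** (\<chi> k l. B $ k $ l + (if l = j then h $ k else 0))) $ k $ l"
        using 1[of k] by (cases "l = j") (simp_all add: matrix_matrix_mult_def distrib_left sum.distrib)
    qed
    then have "cof (A ** B) $ i $ j = det A * det (\<chi> k l. B $ k $ l + (if l = j then h $ k else 0)) - det (A ** B)"
      by (simp add: cof_eq_det_diff[of "A ** B"] det_mul)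
    then have "cof (A ** B) $ i $ j = det A * (\<Sum>k\<in>UNIV. h $ k * cof B $ k $ j)"
      by (simp add: det_mul det_add_to_column algebra_simps)
    then show ?thesis
      using assms by (simp add: h_def matrix_matrix_mult_def sum_distrib_left)
  qed
  then show ?thesis by (simp add: vec_eq_iff)
qed

lemma cof_mult_right:
  fixes A B :: "real^'n^'n"
  assumes "det B \<noteq> 0"
  shows "cof (A ** B) = cof A ** cof B"
proof -
  have "transpose (cof (A ** B)) = cof (transpose B ** transpose A)"
    by (simp add: cof_transpose[symmetric] matrix_transpose_mul)
  also have "\<dots> = transpose (cof A ** cof B)"
    using assms by (simp add: cof_mult_left cof_transpose matrix_transpose_mul)
  finally show ?thesis by (metis transpose_transpose)
qed

text \<open>
  The determinant has no zero on the segment from the identity to \<open>A\<close>, which consists of positive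
  definite matrices.
\<close>

lemma pos_def_det_pos:
  fixes A :: "real^'n^'n"
  assumes pos: "\<And>v. v \<noteq> 0 \<Longrightarrow> v \<bullet> (A *v v) > 0"
  shows "det A > 0"
proof -
  define M where "M t = (\<chi> i j. (1 - t) * (mat 1 :: real^'n^'n) $ i $ j + t * A $ i $ j)" for t
  have nz: "det (M t) \<noteq> 0" if "0 \<le> t" "t \<le> 1" for t
  proof -
    have "M t *v v \<noteq> 0" if "v \<noteq> 0" for v
    proof -
      have "M t *v v = (1 - t) *\<^sub>R v + t *\<^sub>R (A *v v)"
      proof -
        have "M t = (1 - t) *\<^sub>R mat 1 + t *\<^sub>R A" by (simp add: M_def vec_eq_iff)
        then show ?thesis
          by (simp add: matrix_vector_mult_add_rdistrib scaleR_matrix_vector_assoc[symmetric])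
      qed
      then have "v \<bullet> (M t *v v) = (1 - t) * (v \<bullet> v) + t * (v \<bullet> (A *v v))"
        by (simp add: inner_add_right)
      moreover have "(1 - t) * (v \<bullet> v) + t * (v \<bullet> (A *v v)) > 0"
      proof (cases "t = 0")
        case False
        then have "t * (v \<bullet> (A *v v)) > 0" using pos[OF \<open>v \<noteq> 0\<close>] \<open>0 \<le> t\<close> by simp
        moreover have "(1 - t) * (v \<bullet> v) \<ge> 0" using \<open>t \<le> 1\<close> by simp
        ultimately show ?thesis by linarith
      qed (use \<open>v \<noteq> 0\<close> in simp)
      ultimately show ?thesis by auto
    qed
    then show ?thesis
      by (metis invertible_det_nz invertible_left_inverse matrix_left_invertible_ker)
  qed
  have cont: "continuous_on {0..1} (\<lambda>t. det (M t))"
    unfolding det_def M_def by (intro continuous_intros)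
  have 0: "M 0 = mat 1" and 1: "M 1 = A"
    by (simp_all add: M_def vec_eq_iff)
  show ?thesis
  proof (rule ccontr)
    assume "\<not> ?thesis"
    then have "\<exists>x\<ge>0. x \<le> 1 \<and> det (M x) = 0"
      using IVT2'[of "\<lambda>t. det (M t)" 1 0 0] cont 0 1 by auto
    with nz show False by auto
  qed
qed

section \<open>Signs of index lists and the Hodge operator\<close>

text \<open>
  The recursion over the list makes exchanging two neighbours a matter of comparing two numbers of
  inversions.
\<close>

lemma levi_civita_Cons:
  "levi_civita (x # xs) = (if x \<in> set xs then 0 else (-1) ^ length (filter (\<lambda>y. y < x) xs) * levi_civita xs)"
proof (cases "distinct (x # xs)")
  case True
  let ?I = "\<lambda>xs. {(a, b). a < b \<and> b < length xs \<and> xs ! b < xs ! a}"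
  have fin: "finite (?I ys)" for ys :: "'a list"
    by (rule finite_subset[of _ "{..<length ys} \<times> {..<length ys}"]) auto
  have split: "?I (x # xs) = (\<lambda>b. (0, Suc b)) ` {b. b < length xs \<and> xs ! b < x} \<union> map_prod Suc Suc ` ?I xs"
  proof (intro equalityI subsetI)
    fix z assume "z \<in> ?I (x # xs)"
    then obtain a b where z: "z = (a, b)" "a < b" "b < Suc (length xs)" "(x # xs) ! b < (x # xs) ! a"
      by auto
    then obtain b' where "b = Suc b'" by (cases b) auto
    with z show "z \<in> (\<lambda>b. (0, Suc b)) ` {b. b < length xs \<and> xs ! b < x} \<union> map_prod Suc Suc ` ?I xs"
      by (cases a) (auto simp: image_iff)
  qed auto
  have "card (?I (x # xs)) = card {b. b < length xs \<and> xs ! b < x} + card (?I xs)"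
    unfolding split by (subst card_Un_disjoint) (auto simp: card_image inj_on_def fin)
  then have "card (?I (x # xs)) = length (filter (\<lambda>y. y < x) xs) + card (?I xs)"
    by (simp only: length_filter_conv_card)
  with True show ?thesis
    unfolding levi_civita_def by (simp only: power_add) simp
qed (auto simp: levi_civita_def)

lemma levi_civita_swap: "levi_civita (xs @ a # b # ys) = - levi_civita (xs @ b # a # ys)"
  by (induction xs) (auto simp: levi_civita_Cons)

lemma levi_civita_square: "distinct xs \<Longrightarrow> levi_civita xs * levi_civita xs = 1"
  by (simp add: levi_civita_def power_mult_distrib[symmetric])

lemma levi_civita_not_distinct: "\<not> distinct xs \<Longrightarrow> levi_civita xs = 0"
  by (simp add: levi_civita_def)

lemma levi_civita_move: "levi_civita (zs @ xs @ a # ys) = (-1) ^ length xs * levi_civita (zs @ a # xs @ ys)"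
proof (induction xs arbitrary: zs)
  case (Cons x xs)
  show ?case
    using Cons.IH[of "zs @ [x]"] levi_civita_swap[of zs x a "xs @ ys"] by simp
qed simp

text \<open>
  Exchanges of neighbours generate all rearrangements of a list.
\<close>

lemma swap_invariant_imp_mset_invariant:
  assumes "\<And>xs a b ys. f (xs @ a # b # ys) = f (xs @ b # a # ys)" "mset xs = mset ys"
  shows "f xs = f ys"
  using assms
proof (induction xs arbitrary: f ys)
  case (Cons x xs)
  have move: "f (zs @ us @ x # vs) = f (zs @ x # us @ vs)" for us vs zs
  proof (induction us arbitrary: zs)
    case (Cons u us)
    show ?case
      using Cons.IH[of "zs @ [u]"] Cons.prems Cons(1) \<open>\<And>xs a b ys. f (xs @ a # b # ys) = f (xs @ b # a # ys)\<close>[of zs u x "us @ vs"] by simp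
  qed simp
  have "x \<in> set ys"
    using Cons.prems(2) by (metis list.set_intros(1) mset_eq_setD)
  then obtain us vs where ys: "ys = us @ x # vs"
    by (meson split_list)
  have "(\<lambda>l. f (x # l)) xs = (\<lambda>l. f (x # l)) (us @ vs)"
  proof (rule Cons.IH)
    show "f (x # as @ a # b # bs) = f (x # as @ b # a # bs)" for as a b bs
      using Cons.prems(1)[of "x # as" a b bs] by simp
    show "mset xs = mset (us @ vs)"
      using Cons.prems(2) ys by simp
  qed
  with move[of "[]" us vs] ys show ?case by simp
qed simp

text \<open>
  For a fixed \<open>p\<close>, exchanging two neighbours in \<open>ms\<close> flips the sign both of \<open>ms\<close> and of its
  image, so the product \<open>q p ms\<close> of the two signs is the same for every enumeration \<open>ms\<close> of the
  index type. This freedom makes \<open>q\<close> multiplicative in \<open>p\<close>, and a transposition can be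
  evaluated on an enumeration that starts with the two indices it exchanges.
\<close>

lemma levi_civita_map_permutation:
  fixes ms :: "'n::{finite,linorder} list"
  assumes "p permutes UNIV" "distinct ms" "set ms = UNIV"
  shows "levi_civita (map p ms) = of_int (sign p) * levi_civita ms"
proof -
  define q where "q p ms = levi_civita (map p ms) * levi_civita ms" for p :: "'n \<Rightarrow> 'n" and ms
  have q_indep: "q p xs = q p ys"
    if "distinct xs" "set xs = UNIV" "distinct ys" "set ys = UNIV" for p :: "'n \<Rightarrow> 'n" and xs ys
  proof (rule swap_invariant_imp_mset_invariant)
    show "q p (xs @ a # b # ys) = q p (xs @ b # a # ys)" for xs a b ys
      using levi_civita_swap[of xs a b ys] levi_civita_swap[of "map p xs" "p a" "p b" "map p ys"]
      by (simp add: q_def)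
    show "mset xs = mset ys"
      using that set_eq_iff_mset_eq_distinct by blast
  qed
  have "q p ms = of_int (sign p)" if "distinct ms" "set ms = UNIV" for ms
    using assms(1) finite[of UNIV] that
  proof (induction arbitrary: ms rule: permutes_induct)
    case id
    then show ?case by (simp add: q_def levi_civita_square)
  next
    case (swap a b p)
    let ?t = "Transposition.transpose a b"
    let ?ns = "map p ms"
    have ns: "distinct ?ns" "set ?ns = UNIV"
      using swap.prems swap.hyps permutes_bij[OF swap.hyps(4)]
      by (auto simp: distinct_map bij_def intro: inj_on_subset)
    obtain rest where rest: "distinct rest" "set rest = UNIV - {a, b}"
      using finite_distinct_list[of "UNIV - {a, b}"] by auto
    have "q ?t ?ns = q ?t ([] @ a # b # rest)"
      using ns rest \<open>a \<noteq> b\<close> by (intro q_indep) auto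
    also have "\<dots> = - 1"
    proof -
      have "map ?t rest = rest"
        using rest by (intro map_idI) (auto simp: Transposition.transpose_def)
      moreover have "distinct ([] @ a # b # rest)"
        using rest \<open>a \<noteq> b\<close> by auto
      ultimately show ?thesis
        using levi_civita_swap[of "[]" b a rest] levi_civita_square[of "[] @ a # b # rest"]
        by (simp add: q_def)
    qed
    finally have "q ?t ?ns = -1" .
    moreover have "q (?t \<circ> p) ms = q ?t ?ns * q p ms"
      using levi_civita_square[OF ns(1)] by (simp add: q_def)
    moreover have "sign (?t \<circ> p) = - sign p"
      using swap.hyps
      by (subst sign_compose) (auto simp: permutation_swap_id sign_swap_id intro: permutes_imp_permutation[OF finite])
    ultimately have "q (?t \<circ> p) ms = of_int (sign (?t \<circ> p))"
      using swap.IH[OF swap.prems] by (simp del: o_apply)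
    then show ?case
      by (simp only: o_def)
  qed
  from this[OF assms(2,3)] have "q p ms * levi_civita ms = of_int (sign p) * levi_civita ms"
    by simp
  then show ?thesis
    using levi_civita_square[OF assms(2)] by (simp add: q_def mult.assoc)
qed

lemma finite_lists_length: "finite {xs :: 'n::finite list. length xs = k}"
  using finite_lists_length_eq[of "UNIV :: 'n set" k] by simp

lemma sum_lists_Suc:
  "(\<Sum>xs | length xs = Suc k. f xs) = (\<Sum>x\<in>UNIV. \<Sum>xs | length xs = k. f (x # xs :: 'n::finite list))"
proof -
  have "{xs :: 'n list. length xs = Suc k} = (\<lambda>(x, xs). x # xs) ` (UNIV \<times> {xs. length xs = k})"
    by (auto simp: length_Suc_conv image_iff)
  then have "(\<Sum>xs | length xs = Suc k. f xs) = (\<Sum>(x, xs)\<in>UNIV \<times> {xs. length xs = k}. f (x # xs))"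
    by (simp add: sum.reindex inj_on_def split_def)
  then show ?thesis
    by (simp add: sum.cartesian_product)
qed

text \<open>
  The terms that do not vanish come from the distinct lists, which are the images of \<open>ms\<close> under the
  permutations; this is then the Leibniz formula.
\<close>

lemma levi_civita_det:
  fixes B :: "real^'n::{finite,linorder}^'n::_"
  assumes ms: "distinct ms" "length ms = CARD('n)"
  shows "(\<Sum>is | length is = CARD('n). (\<Prod>l<CARD('n). B $ (ms ! l) $ (is ! l)) * levi_civita is) =
    levi_civita ms * det B"
proof -
  have set_ms: "set ms = UNIV"
    using ms by (intro card_subset_eq) (simp_all add: distinct_card)
  have inj: "inj_on (\<lambda>p. map p ms) {p. p permutes UNIV}"
    using set_ms by (auto simp: inj_on_def fun_eq_iff)
  have image: "(\<lambda>p. map p ms) ` {p. p permutes UNIV} = {is. length is = CARD('n) \<and> distinct is}"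
  proof (intro equalityI subsetI)
    fix js assume js: "js \<in> {is :: 'n list. length is = CARD('n) \<and> distinct is}"
    define p where "p x = the (map_of (zip ms js) x)" for x
    have map: "map p ms = js"
      using js ms by (intro nth_equalityI) (simp_all add: p_def map_of_zip_nth)
    have "inj_on p (set ms)"
      using map js by (metis (mono_tags, lifting) distinct_map mem_Collect_eq)
    then have "p permutes UNIV"
      using set_ms endo_inj_surj[of UNIV p] by (intro bij_imp_permutes) (auto simp: bij_betw_def)
    with map show "js \<in> (\<lambda>p. map p ms) ` {p. p permutes UNIV}"
      by auto
  next
    fix js assume "js \<in> (\<lambda>p. map p ms) ` {p. p permutes UNIV}"
    then obtain p where "p permutes UNIV" "js = map p ms" by auto
    then show "js \<in> {is. length is = CARD('n) \<and> distinct is}"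
      using ms by (auto simp: distinct_map permutes_inj_on)
  qed
  have "(\<Sum>is | length is = CARD('n). (\<Prod>l<CARD('n). B $ (ms ! l) $ (is ! l)) * levi_civita is) =
    (\<Sum>is | length is = CARD('n) \<and> distinct is. (\<Prod>l<CARD('n). B $ (ms ! l) $ (is ! l)) * levi_civita is)"
    by (intro sum.mono_neutral_right finite_lists_length) (auto simp: levi_civita_not_distinct)
  also have "\<dots> = (\<Sum>p | p permutes UNIV. (\<Prod>l<CARD('n). B $ (ms ! l) $ (map p ms ! l)) * levi_civita (map p ms))"
    unfolding image[symmetric] by (simp add: sum.reindex[OF inj])
  also have "\<dots> = (\<Sum>p | p permutes UNIV. levi_civita ms * (of_int (sign p) * (\<Prod>i\<in>UNIV. B $ i $ p i)))"
  proof (rule sum.cong[OF refl])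
    fix p :: "'n \<Rightarrow> 'n" assume p: "p \<in> {p. p permutes UNIV}"
    have bij: "bij_betw ((!) ms) {..<CARD('n)} UNIV"
      using bij_betw_nth[OF ms(1) refl refl] ms(2) set_ms by simp
    have "(\<Prod>l<CARD('n). B $ (ms ! l) $ (map p ms ! l)) = (\<Prod>l<CARD('n). B $ (ms ! l) $ p (ms ! l))"
      using ms(2) by (intro prod.cong) auto
    also have "\<dots> = (\<Prod>i\<in>UNIV. B $ i $ p i)"
      by (rule prod.reindex_bij_betw[OF bij, of "\<lambda>i. B $ i $ p i"])
    finally show "(\<Prod>l<CARD('n). B $ (ms ! l) $ (map p ms ! l)) * levi_civita (map p ms) =
      levi_civita ms * (of_int (sign p) * (\<Prod>i\<in>UNIV. B $ i $ p i))"
      using levi_civita_map_permutation[of p ms] p ms set_ms by simp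
  qed
  finally show ?thesis
    by (simp add: det_def sum_distrib_left)
qed

text \<open>
  Replacing row \<open>\<alpha>\<close> of \<open>B\<close> by the unit vector \<open>e\<^sub>m\<close> reduces the inner sum to
  \<open>levi_civita_det\<close>.
  The factorial counts the enumerations of the remaining indices, each of which contributes the same
  amount because its sign occurs twice.
\<close>

lemma levi_civita_cof:
  fixes B :: "real^'n::{finite,linorder}^'n::_"
  assumes k: "CARD('n) = Suc k"
  shows "(\<Sum>ms | length ms = k. \<Sum>is | length is = k.
      (\<Prod>l<k. B $ (ms ! l) $ (is ! l)) * levi_civita (m # is) * levi_civita (\<alpha> # ms)) =
    fact k * cof B $ \<alpha> $ m"
proof -
  define B' where "B' = (\<chi> i. if i = \<alpha> then axis m 1 else B $ i)"
  have inner: "(\<Sum>is | length is = k. (\<Prod>l<k. B $ (ms ! l) $ (is ! l)) * levi_civita (m # is)) =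
    levi_civita (\<alpha> # ms) * cof B $ \<alpha> $ m" if ms: "length ms = k" "distinct (\<alpha> # ms)" for ms
  proof -
    have "levi_civita (\<alpha> # ms) * det B' =
      (\<Sum>i\<in>UNIV. \<Sum>is | length is = k. (\<Prod>l<Suc k. B' $ ((\<alpha> # ms) ! l) $ ((i # is) ! l)) * levi_civita (i # is))"
      using levi_civita_det[of "\<alpha> # ms" B'] ms k by (simp add: sum_lists_Suc)
    also have "\<dots> = (\<Sum>i\<in>UNIV. if i = m then
      (\<Sum>is | length is = k. (\<Prod>l<k. B $ (ms ! l) $ (is ! l)) * levi_civita (m # is)) else 0)"
    proof (rule sum.cong[OF refl])
      fix i
      have "(\<Prod>l<Suc k. B' $ ((\<alpha> # ms) ! l) $ ((i # is) ! l)) =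
        (if i = m then (\<Prod>l<k. B $ (ms ! l) $ (is ! l)) else 0)" for "is"
      proof -
        have "ms ! l \<noteq> \<alpha>" if "l < k" for l
          using ms that by (auto simp: in_set_conv_nth)
        then have "(\<Prod>l<k. B' $ (ms ! l) $ (is ! l)) = (\<Prod>l<k. B $ (ms ! l) $ (is ! l))"
          by (intro prod.cong) (auto simp: B'_def)
        then show ?thesis
          by (simp add: prod.lessThan_Suc_shift del: prod.lessThan_Suc) (simp add: B'_def axis_def)
      qed
      then show "(\<Sum>is | length is = k. (\<Prod>l<Suc k. B' $ ((\<alpha> # ms) ! l) $ ((i # is) ! l)) * levi_civita (i # is)) =
        (if i = m then (\<Sum>is | length is = k. (\<Prod>l<k. B $ (ms ! l) $ (is ! l)) * levi_civita (m # is)) else 0)"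
        by simp
    qed
    finally show ?thesis by (simp add: cof_def B'_def)
  qed
  have "(\<Sum>ms | length ms = k. \<Sum>is | length is = k.
      (\<Prod>l<k. B $ (ms ! l) $ (is ! l)) * levi_civita (m # is) * levi_civita (\<alpha> # ms)) =
    (\<Sum>ms | length ms = k. if distinct (\<alpha> # ms) then cof B $ \<alpha> $ m else 0)"
  proof (rule sum.cong[OF refl])
    fix ms :: "'n list" assume "ms \<in> {ms. length ms = k}"
    then have ms: "length ms = k" by simp
    have "(\<Sum>is | length is = k.
        (\<Prod>l<k. B $ (ms ! l) $ (is ! l)) * levi_civita (m # is) * levi_civita (\<alpha> # ms)) =
      (\<Sum>is | length is = k. (\<Prod>l<k. B $ (ms ! l) $ (is ! l)) * levi_civita (m # is)) * levi_civita (\<alpha> # ms)"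
      by (simp only: sum_distrib_right)
    then show "(\<Sum>is | length is = k.
        (\<Prod>l<k. B $ (ms ! l) $ (is ! l)) * levi_civita (m # is) * levi_civita (\<alpha> # ms)) =
      (if distinct (\<alpha> # ms) then cof B $ \<alpha> $ m else 0)"
      using inner[OF ms] levi_civita_square[of "\<alpha> # ms"] levi_civita_not_distinct[of "\<alpha> # ms"]
      by (auto simp del: distinct.simps)
  qed
  also have "\<dots> = card {ms. length ms = k \<and> distinct (\<alpha> # ms)} * cof B $ \<alpha> $ m"
    by (simp add: sum.inter_filter[OF finite_lists_length, symmetric] del: distinct.simps)
  also have "{ms. length ms = k \<and> distinct (\<alpha> # ms)} = {ms. length ms = k \<and> distinct ms \<and> set ms \<subseteq> UNIV - {\<alpha>}}"
    by auto
  also have "card \<dots> = fact k"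
    using k by (subst card_lists_distinct_length_eq) (auto simp: fact_prod)
  finally show ?thesis by simp
qed

lemma prod_sum_lists:
  fixes F :: "nat \<Rightarrow> 'n::finite \<Rightarrow> real"
  shows "(\<Prod>l<k. \<Sum>j\<in>UNIV. F l j) = (\<Sum>js | length js = k. \<Prod>l<k. F l (js ! l))"
proof (induction k arbitrary: F)
  case (Suc k)
  show ?case
    using Suc.IH[of "\<lambda>l. F (Suc l)"]
    by (simp add: prod.lessThan_Suc_shift sum_lists_Suc sum_product del: prod.lessThan_Suc)
qed simp

text \<open>
  The sign \<open>(-1)\<^sup>d\<^sup>-\<^sup>1\<close> in the definition is used up in moving the free index of the second Hodge
  operator from the end of its list to the front.
\<close>

lemma Cof_eq:
  fixes A :: "real^'n::{finite,linorder}^'n::_"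
  assumes nz: "det H \<noteq> 0"
  shows "Cof G H A v $ \<alpha> = (\<Sum>m\<in>UNIV. (G *v v) $ m * cof (H ** A) $ \<alpha> $ m) / (sqrt (det G) * sqrt (det H))"
proof -
  obtain k where k: "CARD('n) = Suc k"
    using not0_implies_Suc[of "CARD('n)"] by auto
  have hodge1: "hodge G 1 (vec1 v) is = (\<Sum>m\<in>UNIV. (G *v v) $ m * levi_civita (m # is)) / sqrt (det G)" for "is"
    by (simp add: hodge_def vec1_def sum_lists_Suc matrix_vector_mult_def sum_distrib_right)
  have T: "ext_power k A (hodge G 1 (vec1 v)) js = (\<Sum>is | length is = k.
    (\<Prod>l<k. A $ (js ! l) $ (is ! l)) * hodge G 1 (vec1 v) is)" for js
    by (simp add: ext_power_def)
  have "hodge H k (ext_power k A (hodge G 1 (vec1 v))) [\<alpha>] * (fact k * sqrt (det H)) =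
    (\<Sum>ms | length ms = k. \<Sum>js | length js = k. (\<Prod>l<k. H $ (ms ! l) $ (js ! l)) *
      ext_power k A (hodge G 1 (vec1 v)) js * levi_civita (ms @ [\<alpha>]))"
    using nz by (simp add: hodge_def[of H])
  also have "\<dots> = (\<Sum>ms | length ms = k. \<Sum>js | length js = k. \<Sum>is | length is = k.
      (\<Prod>l<k. H $ (ms ! l) $ (js ! l)) * (\<Prod>l<k. A $ (js ! l) $ (is ! l)) *
      (hodge G 1 (vec1 v) is * levi_civita (ms @ [\<alpha>])))"
    unfolding T by (simp add: sum_distrib_left sum_distrib_right mult.assoc)
  also have "\<dots> = (\<Sum>ms | length ms = k. \<Sum>is | length is = k.
      (\<Prod>l<k. (H ** A) $ (ms ! l) $ (is ! l)) * (hodge G 1 (vec1 v) is * levi_civita (ms @ [\<alpha>])))"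
  proof (rule sum.cong[OF refl])
    fix ms :: "'n list"
    show "(\<Sum>js | length js = k. \<Sum>is | length is = k.
      (\<Prod>l<k. H $ (ms ! l) $ (js ! l)) * (\<Prod>l<k. A $ (js ! l) $ (is ! l)) *
      (hodge G 1 (vec1 v) is * levi_civita (ms @ [\<alpha>]))) =
      (\<Sum>is | length is = k.
      (\<Prod>l<k. (H ** A) $ (ms ! l) $ (is ! l)) * (hodge G 1 (vec1 v) is * levi_civita (ms @ [\<alpha>])))"
      by (subst sum.swap)
        (simp add: matrix_matrix_mult_def prod_sum_lists prod.distrib sum_distrib_right)
  qed
  also have "\<dots> = (\<Sum>ms | length ms = k. \<Sum>is | length is = k. \<Sum>m\<in>UNIV.
      (-1) ^ k * ((G *v v) $ m * ((\<Prod>l<k. (H ** A) $ (ms ! l) $ (is ! l)) * levi_civita (m # is) *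
        levi_civita (\<alpha> # ms)) / sqrt (det G)))"
  proof (intro sum.cong refl)
    fix ms "is" :: "'n list" assume "ms \<in> {ms. length ms = k}"
    then have "levi_civita (ms @ [\<alpha>]) = (-1) ^ k * levi_civita (\<alpha> # ms)"
      using levi_civita_move[of "[]" ms \<alpha> "[]"] by simp
    then show "(\<Prod>l<k. (H ** A) $ (ms ! l) $ (is ! l)) * (hodge G 1 (vec1 v) is * levi_civita (ms @ [\<alpha>])) =
      (\<Sum>m\<in>UNIV. (-1) ^ k * ((G *v v) $ m * ((\<Prod>l<k. (H ** A) $ (ms ! l) $ (is ! l)) *
        levi_civita (m # is) * levi_civita (\<alpha> # ms)) / sqrt (det G)))"
      unfolding hodge1 by (simp add: sum_distrib_left sum_distrib_right sum_divide_distrib mult_ac)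
  qed
  also have "\<dots> = (\<Sum>m\<in>UNIV. \<Sum>ms | length ms = k. \<Sum>is | length is = k.
      (-1) ^ k * ((G *v v) $ m * ((\<Prod>l<k. (H ** A) $ (ms ! l) $ (is ! l)) * levi_civita (m # is) *
        levi_civita (\<alpha> # ms)) / sqrt (det G)))"
    by (subst sum.swap[of _ _ UNIV], subst sum.swap[of _ _ UNIV]) (rule refl)
  also have "\<dots> = (\<Sum>m\<in>UNIV. (-1) ^ k * ((G *v v) $ m * (fact k * cof (H ** A) $ \<alpha> $ m) / sqrt (det G)))"
    by (simp only: sum_distrib_left[symmetric] sum_divide_distrib[symmetric] levi_civita_cof[OF k])
  finally have *: "hodge H k (ext_power k A (hodge G 1 (vec1 v))) [\<alpha>] * (fact k * sqrt (det H)) =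
    fact k * ((-1) ^ k * (\<Sum>m\<in>UNIV. (G *v v) $ m * cof (H ** A) $ \<alpha> $ m) / sqrt (det G))"
    by (simp add: sum_distrib_left sum_divide_distrib mult_ac)
  have cancel: "e * X = S / (g * h)" if "X * (f * h) = f * (e * S / g)" "f \<noteq> 0" "h \<noteq> 0" "e * e = 1"
    for e f g h S X :: real
  proof -
    have "f * (X * h) = f * (e * S / g)"
      using that(1) by (simp only: mult_ac)
    then have "X * h = e * S / g"
      by (simp only: mult_left_cancel[OF \<open>f \<noteq> 0\<close>])
    then have "e * X * h = e * (e * S / g)"
      by (simp only: mult.assoc)
    also have "\<dots> = (e * e) * S / g"
      by (simp only: mult.assoc times_divide_eq_right)
    also have "\<dots> = S / g"
      by (simp only: that(4) mult_1_left)
    finally show ?thesis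
      using that(3) by (metis divide_divide_eq_left nonzero_eq_divide_eq)
  qed
  have "Cof G H A v $ \<alpha> = (-1) ^ k * hodge H k (ext_power k A (hodge G 1 (vec1 v))) [\<alpha>]"
    unfolding Cof_def unvec1_def k diff_Suc_1 by (simp only: vector_scaleR_component vec_lambda_beta real_scaleR_def)
  also have "\<dots> = (\<Sum>m\<in>UNIV. (G *v v) $ m * cof (H ** A) $ \<alpha> $ m) / (sqrt (det G) * sqrt (det H))"
  proof (rule cancel[OF *])
    show "(-1) ^ k * (-1) ^ k = (1 :: real)"
      by (simp add: power_mult_distrib[symmetric])
  qed (use nz in auto)
  finally show ?thesis .
qed

text \<open>
  In coordinates \<open>Cof A = (det H / det G)\<^sup>1\<^sup>/\<^sup>2 H\<^sup>-\<^sup>1 (cof A) G\<close>. Raising the index of the source and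
  lowering that of the target cancels \<open>G\<close> and \<open>H\<^sup>-\<^sup>1\<close>, so the induced inner product becomes the
  plain contraction with the matrix cofactor.
\<close>

lemma Cof_pairing:
  fixes A :: "real^'n::{finite,linorder}^'n::_"
  assumes G: "det G > 0" and H: "det H > 0"
  shows "(\<Sum>i\<in>UNIV. \<Sum>j\<in>UNIV. \<Sum>\<alpha>\<in>UNIV. \<Sum>\<beta>\<in>UNIV.
    matrix_inv G $ i $ j * H $ \<alpha> $ \<beta> * Cof G H A (axis i 1) $ \<alpha> * N $ \<beta> $ j) =
    sqrt (det H) / sqrt (det G) * (\<Sum>\<beta>\<in>UNIV. \<Sum>j\<in>UNIV. cof A $ \<beta> $ j * N $ \<beta> $ j)"
proof -
  define c where "c = 1 / (sqrt (det G) * sqrt (det H))"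
  have Cof: "Cof G H A (axis i 1) $ \<alpha> = (\<Sum>m\<in>UNIV. c * (G $ m $ i * cof (H ** A) $ \<alpha> $ m))" for i \<alpha>
    using H by (simp add: Cof_eq c_def matrix_vector_mult_basis column_def sum_divide_distrib)
  have inv: "(\<Sum>i\<in>UNIV. matrix_inv G $ i $ j * G $ m $ i) = (if m = j then 1 else 0)" for m j
    using G laplace_row[of G m j]
    by (simp add: matrix_inv_eq_cof sum_divide_distrib[symmetric] mult.commute)
  \<comment> \<open>Summing over the index of the source cancels the metric of the source.\<close>
  have raise: "(\<Sum>i\<in>UNIV. matrix_inv G $ i $ j * Cof G H A (axis i 1) $ \<alpha>) = c * cof (H ** A) $ \<alpha> $ j" for j \<alpha>
  proof -
    have "(\<Sum>i\<in>UNIV. matrix_inv G $ i $ j * Cof G H A (axis i 1) $ \<alpha>) =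
      (\<Sum>i\<in>UNIV. \<Sum>m\<in>UNIV. c * cof (H ** A) $ \<alpha> $ m * (matrix_inv G $ i $ j * G $ m $ i))"
      unfolding Cof sum_distrib_left by (simp add: mult_ac)
    also have "\<dots> = (\<Sum>m\<in>UNIV. \<Sum>i\<in>UNIV. c * cof (H ** A) $ \<alpha> $ m * (matrix_inv G $ i $ j * G $ m $ i))"
      by (rule sum.swap)
    also have "\<dots> = c * cof (H ** A) $ \<alpha> $ j"
      by (simp add: sum_distrib_left[symmetric] inv if_distrib[of "\<lambda>x. _ * x"] cong: if_cong)
    finally show ?thesis .
  qed
  \<comment> \<open>Summing over the index of the target turns the cofactor of the product into that of \<open>A\<close>.\<close>
  have lower: "(\<Sum>\<alpha>\<in>UNIV. H $ \<alpha> $ \<beta> * cof (H ** A) $ \<alpha> $ j) = det H * cof A $ \<beta> $ j" for \<beta> j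
  proof -
    have "(\<Sum>\<alpha>\<in>UNIV. H $ \<alpha> $ \<beta> * cof (H ** A) $ \<alpha> $ j) =
      (\<Sum>\<alpha>\<in>UNIV. \<Sum>\<gamma>\<in>UNIV. cof A $ \<gamma> $ j * (H $ \<alpha> $ \<beta> * cof H $ \<alpha> $ \<gamma>))"
      unfolding cof_mult_left[OF less_imp_neq[OF H, symmetric]]
      by (simp add: matrix_matrix_mult_def[of "cof H"] sum_distrib_left mult_ac)
    also have "\<dots> = (\<Sum>\<gamma>\<in>UNIV. \<Sum>\<alpha>\<in>UNIV. cof A $ \<gamma> $ j * (H $ \<alpha> $ \<beta> * cof H $ \<alpha> $ \<gamma>))"
      by (rule sum.swap)
    also have "\<dots> = det H * cof A $ \<beta> $ j"
      by (simp add: sum_distrib_left[symmetric] laplace_column if_distrib[of "\<lambda>x. _ * x"] cong: if_cong)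
    finally show ?thesis .
  qed
  define t where "t i j \<alpha> \<beta> =
    matrix_inv G $ i $ j * H $ \<alpha> $ \<beta> * Cof G H A (axis i 1) $ \<alpha> * N $ \<beta> $ j" for i j \<alpha> \<beta>
  have "(\<Sum>i\<in>UNIV. \<Sum>j\<in>UNIV. \<Sum>\<alpha>\<in>UNIV. \<Sum>\<beta>\<in>UNIV. t i j \<alpha> \<beta>) =
    (\<Sum>j\<in>UNIV. \<Sum>i\<in>UNIV. \<Sum>\<alpha>\<in>UNIV. \<Sum>\<beta>\<in>UNIV. t i j \<alpha> \<beta>)"
    by (rule sum.swap)
  also have "\<dots> = (\<Sum>j\<in>UNIV. \<Sum>\<beta>\<in>UNIV. det H * c * (cof A $ \<beta> $ j * N $ \<beta> $ j))"
  proof (rule sum.cong[OF refl])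
    fix j
    have "(\<Sum>i\<in>UNIV. \<Sum>\<alpha>\<in>UNIV. \<Sum>\<beta>\<in>UNIV. t i j \<alpha> \<beta>) =
      (\<Sum>\<alpha>\<in>UNIV. \<Sum>i\<in>UNIV. \<Sum>\<beta>\<in>UNIV. t i j \<alpha> \<beta>)"
      by (rule sum.swap)
    also have "\<dots> = (\<Sum>\<alpha>\<in>UNIV. \<Sum>\<beta>\<in>UNIV. \<Sum>i\<in>UNIV. t i j \<alpha> \<beta>)"
      by (intro sum.cong refl sum.swap)
    also have "\<dots> = (\<Sum>\<beta>\<in>UNIV. \<Sum>\<alpha>\<in>UNIV. \<Sum>i\<in>UNIV. t i j \<alpha> \<beta>)"
      by (rule sum.swap)
    also have "\<dots> = (\<Sum>\<beta>\<in>UNIV. det H * c * (cof A $ \<beta> $ j * N $ \<beta> $ j))"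
    proof (rule sum.cong[OF refl])
      fix \<beta>
      have "(\<Sum>i\<in>UNIV. t i j \<alpha> \<beta>) = c * N $ \<beta> $ j * (H $ \<alpha> $ \<beta> * cof (H ** A) $ \<alpha> $ j)" for \<alpha>
      proof -
        have "(\<Sum>i\<in>UNIV. t i j \<alpha> \<beta>) =
          H $ \<alpha> $ \<beta> * N $ \<beta> $ j * (\<Sum>i\<in>UNIV. matrix_inv G $ i $ j * Cof G H A (axis i 1) $ \<alpha>)"
          unfolding t_def sum_distrib_left by (simp only: mult_ac)
        then show ?thesis unfolding raise by (simp only: mult_ac)
      qed
      then have "(\<Sum>\<alpha>\<in>UNIV. \<Sum>i\<in>UNIV. t i j \<alpha> \<beta>) =
        c * N $ \<beta> $ j * (\<Sum>\<alpha>\<in>UNIV. H $ \<alpha> $ \<beta> * cof (H ** A) $ \<alpha> $ j)"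
        by (simp only: sum_distrib_left)
      then show "(\<Sum>\<alpha>\<in>UNIV. \<Sum>i\<in>UNIV. t i j \<alpha> \<beta>) = det H * c * (cof A $ \<beta> $ j * N $ \<beta> $ j)"
        unfolding lower by (simp only: mult_ac)
    qed
    finally show "(\<Sum>i\<in>UNIV. \<Sum>\<alpha>\<in>UNIV. \<Sum>\<beta>\<in>UNIV. t i j \<alpha> \<beta>) =
      (\<Sum>\<beta>\<in>UNIV. det H * c * (cof A $ \<beta> $ j * N $ \<beta> $ j))" .
  qed
  also have "\<dots> = (\<Sum>\<beta>\<in>UNIV. \<Sum>j\<in>UNIV. det H * c * (cof A $ \<beta> $ j * N $ \<beta> $ j))"
    by (rule sum.swap)
  finally have pairing: "(\<Sum>i\<in>UNIV. \<Sum>j\<in>UNIV. \<Sum>\<alpha>\<in>UNIV. \<Sum>\<beta>\<in>UNIV. t i j \<alpha> \<beta>) =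
    det H * c * (\<Sum>\<beta>\<in>UNIV. \<Sum>j\<in>UNIV. cof A $ \<beta> $ j * N $ \<beta> $ j)"
    by (simp only: sum_distrib_left)
  have c: "det H * c = sqrt (det H) / sqrt (det G)"
    using G H real_sqrt_mult_self[of "det H"] by (simp add: c_def field_simps)
  show ?thesis
    using pairing unfolding c t_def .
qed

section \<open>Continuously differentiable maps\<close>

text \<open>
  On open sets of coordinate space this is \<open>Ck_on 1\<close> (see \<open>C1_on_iff_Ck_on\<close>). Continuity of the
  derivative as a bounded linear map, rather than of each partial derivative, is what passes through
  compositions. The derivative is the one in the full space, so differentiability at the points of the
  set depends on the values nearby.
\<close>

definition C1_on :: "('a::real_normed_vector \<Rightarrow> 'b::real_normed_vector) \<Rightarrow> 'a set \<Rightarrow> bool"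
  where "C1_on F S \<longleftrightarrow> (\<exists>F' :: 'a \<Rightarrow> 'a \<Rightarrow>\<^sub>L 'b.
    (\<forall>x\<in>S. (F has_derivative blinfun_apply (F' x)) (at x)) \<and> continuous_on S F')"

lemma C1_onI:
  assumes "\<And>x. x \<in> S \<Longrightarrow> (F has_derivative blinfun_apply (F' x)) (at x)" "continuous_on S F'"
  shows "C1_on F S"
  using assms unfolding C1_on_def by blast

lemma C1_onE:
  assumes "C1_on F S"
  obtains F' where "\<And>x. x \<in> S \<Longrightarrow> (F has_derivative blinfun_apply (F' x)) (at x)" "continuous_on S F'"
  using assms unfolding C1_on_def by blast

lemma C1_on_imp_differentiable: "C1_on F S \<Longrightarrow> x \<in> S \<Longrightarrow> F differentiable (at x)"
  unfolding C1_on_def differentiable_def by blast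

lemma C1_on_imp_continuous_on: "C1_on F S \<Longrightarrow> continuous_on S F"
  by (meson C1_on_imp_differentiable continuous_at_imp_continuous_on differentiable_imp_continuous_within)

text \<open>
  Derivatives found locally agree where they overlap, because the derivative at a point is unique.
\<close>

lemma C1_on_local:
  assumes "\<And>x. x \<in> S \<Longrightarrow> \<exists>U. open U \<and> x \<in> U \<and> C1_on F U"
  shows "C1_on F S"
proof (rule C1_onI)
  let ?F' = "\<lambda>x. Blinfun (frechet_derivative F (at x))"
  have unique: "?F' x = F' x"
    if "\<And>x. x \<in> U \<Longrightarrow> (F has_derivative blinfun_apply (F' x)) (at x)" "x \<in> U" for x U F'
    using frechet_derivative_at[OF that(1)[OF that(2)], symmetric] by (simp add: blinfun_apply_inverse)
  show "(F has_derivative blinfun_apply (?F' x)) (at x)" if "x \<in> S" for x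
  proof -
    from assms[OF that] obtain U F' where "open U" "x \<in> U"
      "\<And>x. x \<in> U \<Longrightarrow> (F has_derivative blinfun_apply (F' x)) (at x)" "continuous_on U F'"
      by (metis C1_onE)
    then show ?thesis
      using unique[of U F' x] by simp
  qed
  have "isCont ?F' x" if "x \<in> S" for x
  proof -
    from assms[OF that] obtain U F' where U: "open U" "x \<in> U"
      "\<And>x. x \<in> U \<Longrightarrow> (F has_derivative blinfun_apply (F' x)) (at x)" "continuous_on U F'"
      by (metis C1_onE)
    have "continuous_on U ?F'"
      by (rule continuous_on_eq[OF U(4)]) (rule unique[OF U(3), symmetric])
    with U show ?thesis
      by (simp add: continuous_on_eq_continuous_at)
  qed
  then show "continuous_on S ?F'"
    by (simp add: continuous_at_imp_continuous_on)
qed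

lemma C1_on_cong:
  assumes "open S" "\<And>x. x \<in> S \<Longrightarrow> F x = G x" "C1_on F S"
  shows "C1_on G S"
proof -
  from assms(3) obtain F' where F': "\<And>x. x \<in> S \<Longrightarrow> (F has_derivative blinfun_apply (F' x)) (at x)" "continuous_on S F'"
    by (metis C1_onE)
  then show ?thesis
    using assms by (intro C1_onI[of S G F']) (auto intro: has_derivative_transform_within_open)
qed

lemma C1_on_const: "C1_on (\<lambda>x. c) S"
  by (rule C1_onI[of _ _ "\<lambda>_. 0"]) (auto intro!: derivative_eq_intros continuous_intros)

lemma C1_on_bounded_linear:
  assumes "bounded_linear f" "C1_on F S"
  shows "C1_on (\<lambda>x. f (F x)) S"
proof -
  from assms(2) obtain F' where F': "\<And>x. x \<in> S \<Longrightarrow> (F has_derivative blinfun_apply (F' x)) (at x)" "continuous_on S F'"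
    by (metis C1_onE)
  show ?thesis
  proof (rule C1_onI)
    show "((\<lambda>x. f (F x)) has_derivative blinfun_apply (Blinfun f o\<^sub>L F' x)) (at x)" if "x \<in> S" for x
      using bounded_linear.has_derivative[OF assms(1) F'(1)[OF that]] assms(1)
      by (simp add: bounded_linear_Blinfun_apply blinfun_compose.rep_eq o_def)
    show "continuous_on S (\<lambda>x. Blinfun f o\<^sub>L F' x)"
      by (intro continuous_intros F')
  qed
qed

lemma C1_on_ident: "C1_on (\<lambda>x. x) S"
  by (rule C1_onI[of _ _ "\<lambda>_. id_blinfun"]) (auto intro!: derivative_eq_intros continuous_intros)

lemma C1_on_add:
  assumes "C1_on F S" "C1_on G S"
  shows "C1_on (\<lambda>x. F x + G x) S"
proof -
  from assms obtain F' G' where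
    "\<And>x. x \<in> S \<Longrightarrow> (F has_derivative blinfun_apply (F' x)) (at x)" "continuous_on S F'"
    "\<And>x. x \<in> S \<Longrightarrow> (G has_derivative blinfun_apply (G' x)) (at x)" "continuous_on S G'"
    by (metis C1_onE)
  then show ?thesis
    by (intro C1_onI[of _ _ "\<lambda>x. F' x + G' x"])
      (auto simp: plus_blinfun.rep_eq intro!: has_derivative_add continuous_intros)
qed

lemma C1_on_scaleR:
  assumes "C1_on r S" "C1_on F S"
  shows "C1_on (\<lambda>x. r x *\<^sub>R F x) S"
proof -
  from assms obtain r' F' where *:
    "\<And>x. x \<in> S \<Longrightarrow> (r has_derivative blinfun_apply (r' x)) (at x)" "continuous_on S r'"
    "\<And>x. x \<in> S \<Longrightarrow> (F has_derivative blinfun_apply (F' x)) (at x)" "continuous_on S F'"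
    by (metis C1_onE)
  show ?thesis
  proof (rule C1_onI)
    show "((\<lambda>x. r x *\<^sub>R F x) has_derivative
      blinfun_apply (r x *\<^sub>R F' x + (blinfun_scaleR_left (F x) o\<^sub>L r' x))) (at x)" if "x \<in> S" for x
      using has_derivative_scaleR[OF *(1)[OF that] *(3)[OF that]]
      by (simp add: plus_blinfun.rep_eq scaleR_blinfun.rep_eq)
    show "continuous_on S (\<lambda>x. r x *\<^sub>R F' x + (blinfun_scaleR_left (F x) o\<^sub>L r' x))"
      by (intro continuous_intros * C1_on_imp_continuous_on assms)
  qed
qed

lemma C1_on_mult: "C1_on r S \<Longrightarrow> C1_on s S \<Longrightarrow> C1_on (\<lambda>x. r x * s x :: real) S"
  using C1_on_scaleR[of r S s] by simp

lemma C1_on_minus: "C1_on F S \<Longrightarrow> C1_on (\<lambda>x. - F x) S"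
  using C1_on_scaleR[OF C1_on_const[of "-1"]] by fastforce

lemma C1_on_diff: "C1_on F S \<Longrightarrow> C1_on G S \<Longrightarrow> C1_on (\<lambda>x. F x - G x) S"
  using C1_on_add[of F S "\<lambda>x. - G x"] C1_on_minus by fastforce

lemma C1_on_sum: "(\<And>i. i \<in> I \<Longrightarrow> C1_on (F i) S) \<Longrightarrow> C1_on (\<lambda>x. \<Sum>i\<in>I. F i x) S"
  by (induction I rule: infinite_finite_induct) (auto intro: C1_on_const C1_on_add)

lemma C1_on_prod: "(\<And>i. i \<in> I \<Longrightarrow> C1_on (F i) S) \<Longrightarrow> C1_on (\<lambda>x. \<Prod>i\<in>I. F i x :: real) S"
  by (induction I rule: infinite_finite_induct) (auto intro: C1_on_const C1_on_mult)

lemma C1_on_compose: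
  assumes G: "C1_on G T" and F: "C1_on F S" and sub: "F ` S \<subseteq> T"
  shows "C1_on (\<lambda>x. G (F x)) S"
proof -
  from assms obtain F' G' where *:
    "\<And>x. x \<in> S \<Longrightarrow> (F has_derivative blinfun_apply (F' x)) (at x)" "continuous_on S F'"
    "\<And>x. x \<in> T \<Longrightarrow> (G has_derivative blinfun_apply (G' x)) (at x)" "continuous_on T G'"
    by (metis C1_onE)
  show ?thesis
  proof (rule C1_onI)
    show "((\<lambda>x. G (F x)) has_derivative blinfun_apply (G' (F x) o\<^sub>L F' x)) (at x)" if "x \<in> S" for x
      using has_derivative_compose[OF *(1)[OF that], of G "G' (F x)"] *(3) that sub
      by (auto simp: blinfun_compose.rep_eq o_def)
    have "continuous_on S (\<lambda>x. G' (F x))"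
      using continuous_on_compose2[OF *(4) C1_on_imp_continuous_on[OF F] sub] .
    then show "continuous_on S (\<lambda>x. G' (F x) o\<^sub>L F' x)"
      by (intro continuous_intros *)
  qed
qed

lemma C1_on_real:
  assumes "\<And>x. x \<in> S \<Longrightarrow> (f has_field_derivative f' x) (at x)" "continuous_on S f'"
  shows "C1_on (f :: real \<Rightarrow> real) S"
proof (rule C1_onI)
  show "(f has_derivative blinfun_apply (blinfun_mult_right (f' x))) (at x)" if "x \<in> S" for x
    using assms(1)[OF that] by (simp add: has_field_derivative_def blinfun_mult_right.rep_eq)
  show "continuous_on S (\<lambda>x. blinfun_mult_right (f' x))"
    by (intro continuous_intros assms)
qed

lemma C1_on_sqrt:
  assumes "C1_on r S" "\<And>x. x \<in> S \<Longrightarrow> r x > 0"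
  shows "C1_on (\<lambda>x. sqrt (r x)) S"
proof (rule C1_on_compose[OF _ assms(1)])
  show "C1_on sqrt {0<..}"
    by (rule C1_on_real[where f' = "\<lambda>x. inverse (sqrt x) / 2"])
      (auto intro!: derivative_eq_intros continuous_intros)
qed (use assms in auto)

lemma C1_on_divide:
  assumes "C1_on r S" "C1_on s S" "\<And>x. x \<in> S \<Longrightarrow> s x \<noteq> 0"
  shows "C1_on (\<lambda>x. r x / s x :: real) S"
proof -
  have "C1_on inverse (- {0 :: real})"
    by (rule C1_on_real[where f' = "\<lambda>x. - (inverse x * inverse x)"])
      (auto intro!: derivative_eq_intros continuous_intros)
  from C1_on_compose[OF this assms(2)] have "C1_on (\<lambda>x. inverse (s x)) S"
    using assms(3) by force
  from C1_on_mult[OF assms(1) this] show ?thesis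
    by (simp add: divide_inverse)
qed

lemma C1_on_component: "C1_on F S \<Longrightarrow> C1_on (\<lambda>x. F x $ i) S"
  by (rule C1_on_bounded_linear[OF bounded_linear_vec_nth])

lemma C1_on_vec:
  fixes F :: "'a::real_normed_vector \<Rightarrow> real^'n"
  assumes "\<And>i. C1_on (\<lambda>x. F x $ i) S"
  shows "C1_on F S"
proof -
  have "(\<Sum>i\<in>UNIV. (F x $ i) *\<^sub>R axis i 1) = F x" for x
    using basis_expansion[of "F x"] by (simp add: scalar_mult_eq_scaleR)
  moreover have "C1_on (\<lambda>x. \<Sum>i\<in>UNIV. (F x $ i) *\<^sub>R axis i (1 :: real)) S"
    by (intro C1_on_sum C1_on_scaleR C1_on_const assms)
  ultimately show ?thesis
    by simp
qed

lemma C1_on_det: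
  fixes M :: "'a::real_normed_vector \<Rightarrow> real^'n^'n"
  assumes "\<And>i j. C1_on (\<lambda>x. M x $ i $ j) S"
  shows "C1_on (\<lambda>x. det (M x)) S"
  unfolding det_def by (intro C1_on_sum C1_on_mult C1_on_const C1_on_prod assms)

lemma C1_on_cof:
  fixes M :: "'a::real_normed_vector \<Rightarrow> real^'n^'n"
  assumes "\<And>i j. C1_on (\<lambda>x. M x $ i $ j) S"
  shows "C1_on (\<lambda>x. cof (M x) $ i $ j) S"
  unfolding cof_eq_det_diff
  by (intro C1_on_diff C1_on_det) (auto intro!: C1_on_add C1_on_const assms)

section \<open>Partial derivatives\<close>

lemma partial_eqI: "(F has_derivative F') (at x) \<Longrightarrow> partial i F x = F' (axis i 1)"
  unfolding partial_def by (metis frechet_derivative_at)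

lemma partial_cong:
  assumes "open S" "x \<in> S" "\<And>z. z \<in> S \<Longrightarrow> F z = G z"
  shows "partial i F x = partial i G x"
proof -
  have "(F has_derivative F') (at x) = (G has_derivative F') (at x)" for F'
    using assms has_derivative_transform_within_open[of F F' x UNIV S G]
      has_derivative_transform_within_open[of G F' x UNIV S F] by auto
  then show ?thesis by (simp add: partial_def frechet_derivative_def)
qed

lemma has_derivative_partial:
  fixes F :: "real^'n \<Rightarrow> 'b::real_normed_vector"
  assumes "F differentiable (at x)"
  shows "(F has_derivative (\<lambda>h. \<Sum>i\<in>UNIV. (h $ i) *\<^sub>R partial i F x)) (at x)"
proof -
  interpret D: linear "frechet_derivative F (at x)"
    by (rule linear_frechet_derivative[OF assms])
  have "frechet_derivative F (at x) h = (\<Sum>i\<in>UNIV. (h $ i) *\<^sub>R partial i F x)" for h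
  proof -
    have "h = (\<Sum>i\<in>UNIV. (h $ i) *\<^sub>R axis i 1)"
      using basis_expansion[of h] by (simp add: scalar_mult_eq_scaleR)
    then have "frechet_derivative F (at x) h = frechet_derivative F (at x) (\<Sum>i\<in>UNIV. (h $ i) *\<^sub>R axis i 1)"
      by simp
    then show ?thesis
      by (simp add: D.sum D.scale partial_def)
  qed
  with assms show ?thesis
    by (metis (no_types, lifting) ext frechet_derivative_works)
qed

lemma C1_on_iff_Ck_on:
  fixes F :: "real^'n \<Rightarrow> 'b::real_normed_vector"
  assumes "open S"
  shows "C1_on F S \<longleftrightarrow> Ck_on 1 F S"
proof
  assume F: "C1_on F S"
  then obtain F' where F': "\<And>x. x \<in> S \<Longrightarrow> (F has_derivative blinfun_apply (F' x)) (at x)" "continuous_on S F'"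
    by (metis C1_onE)
  have "continuous_on S (partial i F)" for i
  proof -
    have "continuous_on S (\<lambda>x. blinfun_apply (F' x) (axis i 1))"
      by (intro continuous_intros F')
    moreover have "partial i F x = blinfun_apply (F' x) (axis i 1)" if "x \<in> S" for x
      by (rule partial_eqI[OF F'(1)[OF that]])
    ultimately show ?thesis
      by (metis (no_types, lifting) continuous_on_cong)
  qed
  moreover have "F differentiable_on S"
    by (meson C1_on_imp_differentiable F differentiable_at_imp_differentiable_on)
  ultimately show "Ck_on 1 F S" by simp
next
  assume F: "Ck_on 1 F S"
  define F' where "F' x = (\<Sum>i\<in>UNIV. blinfun_scaleR_left (partial i F x) o\<^sub>L blinfun_inner_left (axis i (1::real)))" for x
  have F'_apply: "blinfun_apply (F' x) h = (\<Sum>i\<in>UNIV. (h $ i) *\<^sub>R partial i F x)" for x h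
    by (simp add: F'_def blinfun.sum_left blinfun_inner_left.rep_eq inner_axis)
  show "C1_on F S"
  proof (rule C1_onI)
    show "(F has_derivative blinfun_apply (F' x)) (at x)" if "x \<in> S" for x
    proof -
      have "F differentiable (at x)"
        using F that assms by (simp add: differentiable_on_eq_differentiable_at)
      from has_derivative_partial[OF this] show ?thesis
        by (simp add: F'_apply[abs_def])
    qed
    show "continuous_on S F'"
      unfolding F'_def using F by (intro continuous_intros) auto
  qed
qed

lemma C1_on_partial_continuous:
  fixes F :: "real^'n \<Rightarrow> 'b::real_normed_vector"
  shows "open S \<Longrightarrow> C1_on F S \<Longrightarrow> continuous_on S (partial i F)"
  by (simp add: C1_on_iff_Ck_on)

lemma Ck_on_2D:
  fixes F :: "real^'n \<Rightarrow> 'b::real_normed_vector"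
  assumes "open S" "Ck_on 2 F S"
  shows "C1_on F S" "C1_on (partial i F) S"
proof -
  from assms(2) have F: "F differentiable_on S" "\<And>i. Ck_on 1 (partial i F) S"
    by (simp_all add: numeral_2_eq_2)
  from F(2) show 2: "C1_on (partial i F) S" for i
    using assms(1) by (simp only: C1_on_iff_Ck_on)
  show "C1_on F S"
    using F(1) C1_on_imp_continuous_on[OF 2] assms(1) by (simp add: C1_on_iff_Ck_on)
qed

lemma partial_component:
  fixes F :: "real^'n \<Rightarrow> 'b::real_normed_vector^'k"
  assumes "F differentiable (at x)"
  shows "partial i (\<lambda>z. F z $ a) x = partial i F x $ a"
proof -
  have "((\<lambda>z. F z $ a) has_derivative (\<lambda>h. frechet_derivative F (at x) h $ a)) (at x)"
    using assms by (intro bounded_linear.has_derivative[OF bounded_linear_vec_nth])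
      (simp add: frechet_derivative_works)
  from partial_eqI[OF this] show ?thesis by (simp add: partial_def)
qed

lemma jacobian_component:
  "jacobian F (at x) $ a $ i = partial i F x $ a"
  by (simp add: jacobian_def matrix_def partial_def)

section \<open>Symmetry of second derivatives\<close>

lemma has_real_derivative_along_axis:
  fixes u :: "real^'n \<Rightarrow> real"
  assumes "u differentiable (at (x + t *\<^sub>R axis i 1))"
  shows "((\<lambda>s. u (x + s *\<^sub>R axis i 1)) has_real_derivative partial i u (x + t *\<^sub>R axis i 1)) (at t)"
proof -
  have "((\<lambda>s. x + s *\<^sub>R axis i 1) has_derivative (\<lambda>s. s *\<^sub>R axis i 1)) (at t)"
    by (auto intro!: derivative_eq_intros)
  from has_derivative_compose[OF this] assms
  have "((\<lambda>s. u (x + s *\<^sub>R axis i 1)) has_derivative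
    (\<lambda>s. frechet_derivative u (at (x + t *\<^sub>R axis i 1)) (s *\<^sub>R axis i 1))) (at t)"
    by (simp add: frechet_derivative_works)
  moreover have "frechet_derivative u (at (x + t *\<^sub>R axis i 1)) (s *\<^sub>R axis i 1) =
    partial i u (x + t *\<^sub>R axis i 1) * s" for s
    using linear_scale[OF linear_frechet_derivative[OF assms]] by (simp add: partial_def)
  ultimately show ?thesis
    by (simp add: has_field_derivative_def)
qed

text \<open>
  The mean value theorem is applied twice: first along axis \<open>i\<close> to the difference of two parallel
  segments, then along axis \<open>j\<close> to \<open>\<partial>\<^sub>iu\<close>. The second difference itself is symmetric in \<open>i\<close> and
  \<open>j\<close>.
\<close>

lemma second_difference:
  fixes u :: "real^'n \<Rightarrow> real"
  assumes u: "\<And>z. dist x z \<le> 2 * t \<Longrightarrow> u differentiable (at z)"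
    "\<And>z. dist x z \<le> 2 * t \<Longrightarrow> partial i u differentiable (at z)" and t: "0 < t"
  shows "\<exists>z. dist x z \<le> 2 * t \<and>
    u (x + t *\<^sub>R axis i 1 + t *\<^sub>R axis j 1) - u (x + t *\<^sub>R axis i 1) - u (x + t *\<^sub>R axis j 1) + u x =
      t * t * partial j (partial i u) z"
proof -
  have dist: "dist x (x + s *\<^sub>R axis i 1 + r *\<^sub>R axis j 1) \<le> 2 * t"
    if "0 \<le> s" "s \<le> t" "0 \<le> r" "r \<le> t" for s r
  proof -
    have "x - (x + s *\<^sub>R axis i 1 + r *\<^sub>R axis j 1) = - (s *\<^sub>R axis i 1 + r *\<^sub>R axis j 1)"
      by simp
    then have "dist x (x + s *\<^sub>R axis i 1 + r *\<^sub>R axis j 1) = norm (s *\<^sub>R axis i (1::real) + r *\<^sub>R axis j 1)"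
      by (simp only: dist_norm norm_minus_cancel)
    also have "\<dots> \<le> s + r"
      using that norm_triangle_ineq[of "s *\<^sub>R axis i (1::real)" "r *\<^sub>R axis j 1"] by simp
    finally show ?thesis using that by simp
  qed
  have dist0: "dist x (x + s *\<^sub>R axis i 1) \<le> 2 * t" if "0 \<le> s" "s \<le> t" for s
    using dist[of s 0] that t by simp
  have swap: "x + s *\<^sub>R axis i 1 + t *\<^sub>R axis j 1 = (x + t *\<^sub>R axis j 1) + s *\<^sub>R axis i 1" for s
    by (simp add: add_ac)
  define p where "p s = u (x + s *\<^sub>R axis i 1 + t *\<^sub>R axis j 1) - u (x + s *\<^sub>R axis i 1)" for s
  define p' where "p' s = partial i u (x + s *\<^sub>R axis i 1 + t *\<^sub>R axis j 1) - partial i u (x + s *\<^sub>R axis i 1)" for s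
  have "(p has_real_derivative p' s) (at s)" if "0 \<le> s" "s \<le> t" for s
    unfolding p_def p'_def swap
    by (intro DERIV_diff has_real_derivative_along_axis u dist[unfolded swap] dist0)
      (use that t dist[of s t] in \<open>simp_all add: swap\<close>)
  from MVT2[OF t this] obtain s where s: "0 < s" "s < t" "p t - p 0 = t * p' s"
    by auto
  define y where "y = x + s *\<^sub>R axis i 1"
  have "((\<lambda>r. partial i u (y + r *\<^sub>R axis j 1)) has_real_derivative
      partial j (partial i u) (y + r *\<^sub>R axis j 1)) (at r)" if "0 \<le> r" "r \<le> t" for r
    by (intro has_real_derivative_along_axis u) (use s that dist[of s r] in \<open>simp add: y_def\<close>)
  from MVT2[OF t this] obtain r where r: "0 < r" "r < t"
    "partial i u (y + t *\<^sub>R axis j 1) - partial i u (y + 0 *\<^sub>R axis j 1) = t * partial j (partial i u) (y + r *\<^sub>R axis j 1)"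
    by auto
  have "p t - p 0 = t * t * partial j (partial i u) (y + r *\<^sub>R axis j 1)"
    using s(3) r(3) by (simp add: p'_def y_def)
  moreover have "dist x (y + r *\<^sub>R axis j 1) \<le> 2 * t"
    using dist[of s r] s r by (simp add: y_def)
  ultimately show ?thesis
    by (intro exI[of _ "y + r *\<^sub>R axis j 1"]) (simp add: p_def)
qed

lemma partial_partial_commute:
  fixes u :: "real^'n \<Rightarrow> real"
  assumes S: "open S" "x \<in> S" and u: "C1_on u S" "\<And>i. C1_on (partial i u) S"
  shows "partial j (partial i u) x = partial i (partial j u) x"
proof -
  obtain e where e: "e > 0" "cball x e \<subseteq> S"
    using S open_contains_cball by blast
  define t where "t n = e / 2 / real (Suc n)" for n
  have t: "0 < t n" "2 * t n \<le> e" for n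
    using e(1) by (simp_all add: t_def field_simps)
  have t_lim: "t \<longlonglongrightarrow> 0"
    unfolding t_def by (rule LIMSEQ_Suc[OF lim_const_over_n])
  have ex: "\<exists>z. dist x z \<le> 2 * t n \<and>
    u (x + t n *\<^sub>R axis i 1 + t n *\<^sub>R axis j 1) - u (x + t n *\<^sub>R axis i 1) - u (x + t n *\<^sub>R axis j 1) + u x =
      t n * t n * partial j (partial i u) z" for n i j
    using u e(2) t[of n] by (intro second_difference) (auto intro!: C1_on_imp_differentiable[of _ S])
  obtain p where p: "\<And>n. dist x (p n) \<le> 2 * t n" "\<And>n.
    u (x + t n *\<^sub>R axis i 1 + t n *\<^sub>R axis j 1) - u (x + t n *\<^sub>R axis i 1) - u (x + t n *\<^sub>R axis j 1) + u x =
      t n * t n * partial j (partial i u) (p n)"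
    using ex[of _ i j] by metis
  obtain q where q: "\<And>n. dist x (q n) \<le> 2 * t n" "\<And>n.
    u (x + t n *\<^sub>R axis j 1 + t n *\<^sub>R axis i 1) - u (x + t n *\<^sub>R axis j 1) - u (x + t n *\<^sub>R axis i 1) + u x =
      t n * t n * partial i (partial j u) (q n)"
    using ex[of _ j i] by metis
  have eq: "partial j (partial i u) (p n) = partial i (partial j u) (q n)" for n
  proof -
    have "t n * t n * partial j (partial i u) (p n) = t n * t n * partial i (partial j u) (q n)"
      using p(2)[of n] q(2)[of n] by (simp add: algebra_simps)
    then show ?thesis using t(1)[of n] by simp
  qed
  have lim: "(\<lambda>n. partial l (partial k u) (r n)) \<longlonglongrightarrow> partial l (partial k u) x"
    if "\<And>n. dist x (r n) \<le> 2 * t n" for r k l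
  proof -
    have "(\<lambda>n. dist (r n) x) \<longlonglongrightarrow> 0"
    proof (rule tendsto_sandwich[of "\<lambda>_. 0"])
      show "(\<lambda>n. 2 * t n) \<longlonglongrightarrow> 0"
        using tendsto_mult_right_zero[OF t_lim] .
    qed (use that in \<open>auto simp: dist_commute\<close>)
    then have "r \<longlonglongrightarrow> x"
      by (rule iffD2[OF tendsto_dist_iff])
    moreover have "isCont (partial l (partial k u)) x"
      using C1_on_partial_continuous[OF S(1) u(2)] S continuous_on_eq_continuous_at by blast
    ultimately show ?thesis
      by (simp add: isCont_tendsto_compose)
  qed
  show ?thesis
  proof (rule LIMSEQ_unique)
    show "(\<lambda>n. partial j (partial i u) (p n)) \<longlonglongrightarrow> partial j (partial i u) x"
      by (rule lim[OF p(1)])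
    show "(\<lambda>n. partial j (partial i u) (p n)) \<longlonglongrightarrow> partial i (partial j u) x"
      unfolding eq by (rule lim[OF q(1)])
  qed
qed

section \<open>The metric-independent identity\<close>

text \<open>
  Jacobi's formula: the product rule in the Leibniz formula leaves, for each entry, the terms of
  the determinant in which this entry is replaced by \<open>1\<close>, and they add up to its cofactor.
\<close>

lemma has_derivative_det:
  fixes M :: "'a::real_normed_vector \<Rightarrow> real^'n^'n"
  assumes "\<And>k l. ((\<lambda>z. M z $ k $ l) has_derivative M' k l) (at x)"
  shows "((\<lambda>z. det (M z)) has_derivative (\<lambda>h. \<Sum>k\<in>UNIV. \<Sum>l\<in>UNIV. M' k l h * cof (M x) $ k $ l)) (at x)"
proof -
  have cof: "cof (M x) $ k $ l =
    (\<Sum>p | p permutes UNIV. of_int (sign p) * ((if p k = l then 1 else 0) * (\<Prod>i\<in>UNIV - {k}. M x $ i $ p i)))" for k l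
    unfolding cof_def det_def
    by (simp add: prod.remove[of UNIV k] axis_def cong: if_cong)
  have "(\<Sum>k\<in>UNIV. \<Sum>l\<in>UNIV. M' k l h * cof (M x) $ k $ l) =
    (\<Sum>p | p permutes UNIV. of_int (sign p) * (\<Sum>k\<in>UNIV. M' k (p k) h * (\<Prod>i\<in>UNIV - {k}. M x $ i $ p i)))" for h
  proof -
    have "(\<Sum>k\<in>UNIV. \<Sum>l\<in>UNIV. M' k l h * cof (M x) $ k $ l) =
      (\<Sum>k\<in>UNIV. \<Sum>p | p permutes UNIV. \<Sum>l\<in>UNIV. of_int (sign p) *
        ((if p k = l then M' k l h else 0) * (\<Prod>i\<in>UNIV - {k}. M x $ i $ p i)))"
    proof (rule sum.cong[OF refl])
      fix k
      have "(\<Sum>l\<in>UNIV. M' k l h * cof (M x) $ k $ l) = (\<Sum>l\<in>UNIV. \<Sum>p | p permutes UNIV. of_int (sign p) *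
        ((if p k = l then M' k l h else 0) * (\<Prod>i\<in>UNIV - {k}. M x $ i $ p i)))"
        unfolding cof sum_distrib_left by (intro sum.cong refl) auto
      also have "\<dots> = (\<Sum>p | p permutes UNIV. \<Sum>l\<in>UNIV. of_int (sign p) *
        ((if p k = l then M' k l h else 0) * (\<Prod>i\<in>UNIV - {k}. M x $ i $ p i)))"
        by (rule sum.swap)
      finally show "(\<Sum>l\<in>UNIV. M' k l h * cof (M x) $ k $ l) = (\<Sum>p | p permutes UNIV. \<Sum>l\<in>UNIV. of_int (sign p) *
        ((if p k = l then M' k l h else 0) * (\<Prod>i\<in>UNIV - {k}. M x $ i $ p i)))" .
    qed
    also have "\<dots> = (\<Sum>k\<in>UNIV. \<Sum>p | p permutes UNIV. of_int (sign p) *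
        (M' k (p k) h * (\<Prod>i\<in>UNIV - {k}. M x $ i $ p i)))"
      by (simp add: sum_distrib_left[symmetric] sum_distrib_right[symmetric])
    also have "\<dots> = (\<Sum>p | p permutes UNIV. \<Sum>k\<in>UNIV. of_int (sign p) *
        (M' k (p k) h * (\<Prod>i\<in>UNIV - {k}. M x $ i $ p i)))"
      by (rule sum.swap)
    finally show ?thesis by (simp only: sum_distrib_left)
  qed
  moreover have "((\<lambda>z. det (M z)) has_derivative (\<lambda>h.
    \<Sum>p | p permutes UNIV. of_int (sign p) * (\<Sum>k\<in>UNIV. M' k (p k) h * (\<Prod>i\<in>UNIV - {k}. M x $ i $ p i)))) (at x)"
    unfolding det_def
    by (intro has_derivative_sum has_derivative_mult_right has_derivative_prod assms)
  ultimately show ?thesis by simp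
qed

text \<open>
  The divergence is the sum over \<open>j \<noteq> k\<close> of the determinants \<open>T j k\<close>, which change sign when \<open>j\<close>
  and \<open>k\<close> are exchanged.
\<close>

lemma piola_div_eq_0:
  fixes F :: "real^'n \<Rightarrow> real^'n"
  assumes S: "open S" "x \<in> S" and F: "Ck_on 2 F S"
  shows "piola_div F \<gamma> x = 0"
proof -
  note C1 = Ck_on_2D[OF S(1) F]
  define D where "D j k = partial j (partial k F) x" for j k
  \<comment> \<open>The case \<open>j = k\<close> does not occur: row \<open>j\<close> is the constant unit vector.\<close>
  define T where "T j k = (if j = k then 0 else
    det (\<chi> r. if r = k then D j k else if r = j then axis \<gamma> 1 else partial r F x))" for j k
  have comm: "D j k = D k j" for j k
  proof -
    have comp: "partial k (\<lambda>z. F z $ a) z = partial k F z $ a" if "z \<in> S" for z k a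
      by (intro partial_component C1_on_imp_differentiable[OF C1(1)] that)
    have comp2: "partial j (partial k (\<lambda>z. F z $ a)) x = D j k $ a" for j k a
    proof -
      have "partial j (partial k (\<lambda>z. F z $ a)) x = partial j (\<lambda>z. partial k F z $ a) x"
        by (rule partial_cong[OF S]) (rule comp)
      then show ?thesis
        by (simp add: D_def partial_component C1_on_imp_differentiable[OF C1(2) S(2)])
    qed
    have "C1_on (partial k (\<lambda>z. F z $ a)) S" for k a
      by (rule C1_on_cong[OF S(1) _ C1_on_component[OF C1(2)]]) (rule comp[symmetric])
    then have "partial j (partial k (\<lambda>z. F z $ a)) x = partial k (partial j (\<lambda>z. F z $ a)) x" for a
      by (intro partial_partial_commute[OF S] C1_on_component C1)
    then show ?thesis by (simp add: comp2 vec_eq_iff)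
  qed
  have anti: "T j k = - T k j" for j k
  proof (cases "j = k")
    case False
    let ?A = "\<chi> r. if r = k then D j k else if r = j then axis \<gamma> 1 else partial r F x"
    let ?p = "Transposition.transpose j k"
    have "det (\<chi> r. ?A $ ?p r) = of_int (sign ?p) * det ?A"
      by (rule det_permute_rows) (simp add: permutes_swap_id)
    moreover have "(\<chi> r. ?A $ ?p r) = (\<chi> r. if r = j then D k j else if r = k then axis \<gamma> 1 else partial r F x)"
      using False comm[of j k] by (auto simp: vec_eq_iff Transposition.transpose_def)
    ultimately show ?thesis
      using False by (simp add: T_def sign_swap_id)
  qed (simp add: T_def)
  have deriv: "partial j (\<lambda>z. cof (transpose (jacobian F (at z))) $ j $ \<gamma>) x = (\<Sum>k\<in>UNIV. T j k)" for j
  proof -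
    define M where "M z = (\<chi> r. if r = j then axis \<gamma> 1 else partial r F z)" for z
    have M: "cof (transpose (jacobian F (at z))) $ j $ \<gamma> = det (M z)" for z
    proof -
      have "(\<chi> k. if k = j then axis \<gamma> 1 else transpose (jacobian F (at z)) $ k) = M z"
        by (auto simp add: vec_eq_iff M_def transpose_def jacobian_component)
      then show ?thesis by (simp add: cof_def)
    qed
    define M' where "M' k l h = (if k = j then 0 else frechet_derivative (partial k F) (at x) h $ l)" for k l h
    have "((\<lambda>z. M z $ k $ l) has_derivative M' k l) (at x)" for k l
    proof (cases "k = j")
      case False
      have "(partial k F has_derivative frechet_derivative (partial k F) (at x)) (at x)"
        using C1_on_imp_differentiable[OF C1(2) S(2)] by (simp add: frechet_derivative_works)
      from bounded_linear.has_derivative[OF bounded_linear_vec_nth this, of l] show ?thesis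
        using False by (simp add: M_def M'_def[abs_def])
    qed (simp add: M_def M'_def[abs_def])
    from partial_eqI[OF has_derivative_det[OF this]]
    have "partial j (\<lambda>z. det (M z)) x = (\<Sum>k\<in>UNIV. \<Sum>l\<in>UNIV. M' k l (axis j 1) * cof (M x) $ k $ l)" .
    also have "\<dots> = (\<Sum>k\<in>UNIV. T j k)"
    proof (rule sum.cong[OF refl])
      fix k
      show "(\<Sum>l\<in>UNIV. M' k l (axis j 1) * cof (M x) $ k $ l) = T j k"
      proof (cases "k = j")
        case False
        have "T j k = det (\<chi> r. if r = k then D j k else M x $ r)"
          using False by (simp add: T_def M_def cong: if_cong)
        also have "\<dots> = (\<Sum>l\<in>UNIV. D j k $ l * cof (M x) $ k $ l)"
          by (rule det_replace_row)
        finally show ?thesis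
          using False by (simp add: M'_def D_def partial_def)
      qed (simp add: T_def M'_def)
    qed
    finally show ?thesis by (simp add: M)
  qed
  have "piola_div F \<gamma> x = (\<Sum>j\<in>UNIV. \<Sum>k\<in>UNIV. T j k)"
    by (simp add: piola_div_def deriv)
  also have "\<dots> = (\<Sum>j\<in>UNIV. \<Sum>k\<in>UNIV. T k j)"
    by (rule sum.swap)
  also have "\<dots> = - (\<Sum>j\<in>UNIV. \<Sum>k\<in>UNIV. T j k)"
    by (subst anti) (simp add: sum_negf)
  finally show ?thesis
    by (simp add: \<open>piola_div F \<gamma> x = (\<Sum>j\<in>UNIV. \<Sum>k\<in>UNIV. T j k)\<close>)
qed

section \<open>Fluxes and the metric-dependent identity\<close>

definition divergence :: "(real^'n::finite \<Rightarrow> real^'n) \<Rightarrow> real^'n \<Rightarrow> real"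
  where "divergence W x = (\<Sum>j\<in>UNIV. partial j (\<lambda>z. W z $ j) x)"

text \<open>
  The field \<open>|H \<circ> F|\<^sup>1\<^sup>/\<^sup>2 (cof [dF]\<^sup>T) \<xi>\<close> whose divergence is the integrand of the Piola
  identity, multiplied by the volume density of the source.
\<close>

definition flux :: "(real^'n::finite \<Rightarrow> real^'n^'n) \<Rightarrow> (real^'n \<Rightarrow> real^'n) \<Rightarrow> (real^'n \<Rightarrow> real^'n) \<Rightarrow> real^'n \<Rightarrow> real^'n"
  where "flux H F \<xi> x = sqrt (det (H (F x))) *\<^sub>R (transpose (cof (jacobian F (at x))) *v \<xi> x)"

lemma partial_mult:
  fixes r s :: "real^'n \<Rightarrow> real"
  assumes "r differentiable (at x)" "s differentiable (at x)"
  shows "partial i (\<lambda>z. r z * s z) x = partial i r x * s x + r x * partial i s x"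
proof -
  have "((\<lambda>z. r z * s z) has_derivative (\<lambda>h. r x * frechet_derivative s (at x) h + frechet_derivative r (at x) h * s x)) (at x)"
    using assms by (intro has_derivative_mult) (simp_all add: frechet_derivative_works)
  from partial_eqI[OF this] show ?thesis by (simp add: partial_def)
qed

lemma partial_sum:
  fixes s :: "'i \<Rightarrow> real^'n \<Rightarrow> real"
  assumes "\<And>k. k \<in> I \<Longrightarrow> s k differentiable (at x)"
  shows "partial i (\<lambda>z. \<Sum>k\<in>I. s k z) x = (\<Sum>k\<in>I. partial i (s k) x)"
proof -
  have "((\<lambda>z. \<Sum>k\<in>I. s k z) has_derivative (\<lambda>h. \<Sum>k\<in>I. frechet_derivative (s k) (at x) h)) (at x)"
    using assms by (intro has_derivative_sum) (simp_all add: frechet_derivative_works)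
  from partial_eqI[OF this] show ?thesis by (simp add: partial_def)
qed

lemma partial_compose:
  fixes F :: "real^'n \<Rightarrow> real^'k" and u :: "real^'k \<Rightarrow> real"
  assumes "F differentiable (at x)" "u differentiable (at (F x))"
  shows "partial i (\<lambda>z. u (F z)) x = (\<Sum>a\<in>UNIV. partial a u (F x) * partial i F x $ a)"
proof -
  have "((\<lambda>z. u (F z)) has_derivative (\<lambda>h. \<Sum>a\<in>UNIV. (frechet_derivative F (at x) h $ a) *\<^sub>R partial a u (F x))) (at x)"
    using has_derivative_compose[of F _ x UNIV u, OF _ has_derivative_partial[OF assms(2)]] assms(1)
    by (simp add: frechet_derivative_works)
  from partial_eqI[OF this] show ?thesis by (simp add: partial_def mult.commute)
qed

lemma partial_det:
  fixes M :: "real^'n \<Rightarrow> real^'k^'k"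
  assumes "\<And>k l. (\<lambda>z. M z $ k $ l) differentiable (at x)"
  shows "partial i (\<lambda>z. det (M z)) x = (\<Sum>k\<in>UNIV. \<Sum>l\<in>UNIV. partial i (\<lambda>z. M z $ k $ l) x * cof (M x) $ k $ l)"
proof -
  have "((\<lambda>z. det (M z)) has_derivative (\<lambda>h. \<Sum>k\<in>UNIV. \<Sum>l\<in>UNIV.
    frechet_derivative (\<lambda>z. M z $ k $ l) (at x) h * cof (M x) $ k $ l)) (at x)"
    using assms by (intro has_derivative_det) (simp add: frechet_derivative_works)
  from partial_eqI[OF this] show ?thesis by (simp add: partial_def)
qed

text \<open>
  In the trace two of the three derivatives of the metric cancel by symmetry, and Jacobi's formula
  identifies the third as half of the logarithmic derivative of the determinant.
\<close>

lemma sum_christoffel: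
  fixes H :: "real^'n \<Rightarrow> real^'n^'n"
  assumes diff: "\<And>k l. (\<lambda>z. H z $ k $ l) differentiable (at y)"
    and sym: "transpose (H y) = H y" and pos: "det (H y) > 0"
  shows "partial \<gamma> (\<lambda>z. sqrt (det (H z))) y = sqrt (det (H y)) * (\<Sum>\<beta>\<in>UNIV. christoffel H \<beta> \<beta> \<gamma> y)"
proof -
  define K where "K \<beta> \<delta> = matrix_inv (H y) $ \<beta> $ \<delta>" for \<beta> \<delta>
  define dH where "dH i k l = partial i (\<lambda>z. H z $ k $ l) y" for i k l
  have K: "K \<beta> \<delta> = cof (H y) $ \<beta> $ \<delta> / det (H y)" "K \<beta> \<delta> = K \<delta> \<beta>" for \<beta> \<delta>
  proof -
    have "cof (H y) $ \<delta> $ \<beta> = cof (H y) $ \<beta> $ \<delta>" for \<beta> \<delta>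
      using arg_cong[OF cof_transpose[of "H y"], of "\<lambda>A. A $ \<delta> $ \<beta>"] sym by (simp add: transpose_def)
    then show "K \<beta> \<delta> = cof (H y) $ \<beta> $ \<delta> / det (H y)" "K \<beta> \<delta> = K \<delta> \<beta>"
      using pos by (simp_all add: K_def matrix_inv_eq_cof)
  qed
  have "(\<Sum>\<beta>\<in>UNIV. christoffel H \<beta> \<beta> \<gamma> y) =
    ((\<Sum>\<beta>\<in>UNIV. \<Sum>\<delta>\<in>UNIV. K \<beta> \<delta> * dH \<beta> \<delta> \<gamma>) + (\<Sum>\<beta>\<in>UNIV. \<Sum>\<delta>\<in>UNIV. K \<beta> \<delta> * dH \<gamma> \<delta> \<beta>) -
      (\<Sum>\<beta>\<in>UNIV. \<Sum>\<delta>\<in>UNIV. K \<beta> \<delta> * dH \<delta> \<beta> \<gamma>)) / 2"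
    by (simp add: christoffel_def K_def dH_def sum_divide_distrib[symmetric] sum.distrib[symmetric]
        sum_subtractf[symmetric] distrib_left right_diff_distrib)
  also have "(\<Sum>\<beta>\<in>UNIV. \<Sum>\<delta>\<in>UNIV. K \<beta> \<delta> * dH \<beta> \<delta> \<gamma>) = (\<Sum>\<beta>\<in>UNIV. \<Sum>\<delta>\<in>UNIV. K \<beta> \<delta> * dH \<delta> \<beta> \<gamma>)"
    by (subst sum.swap, intro sum.cong refl, subst K(2), rule refl)
  also have "(\<Sum>\<beta>\<in>UNIV. \<Sum>\<delta>\<in>UNIV. K \<beta> \<delta> * dH \<gamma> \<delta> \<beta>) = partial \<gamma> (\<lambda>z. det (H z)) y / det (H y)"
    unfolding partial_det[OF diff] sum_divide_distrib
    by (subst sum.swap, intro sum.cong refl, subst K(2)) (simp add: K(1) dH_def mult.commute)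
  finally have trace: "(\<Sum>\<beta>\<in>UNIV. christoffel H \<beta> \<beta> \<gamma> y) = partial \<gamma> (\<lambda>z. det (H z)) y / (2 * det (H y))"
    by simp
  have "(\<lambda>z. det (H z)) differentiable (at y)"
    using has_derivative_det[of H, OF diff[unfolded frechet_derivative_works]]
    unfolding differentiable_def by blast
  then have "((\<lambda>z. det (H z)) has_derivative frechet_derivative (\<lambda>z. det (H z)) (at y)) (at y)"
    by (simp add: frechet_derivative_works)
  from partial_eqI[OF has_derivative_real_sqrt[OF pos this]]
  have "partial \<gamma> (\<lambda>z. sqrt (det (H z))) y = partial \<gamma> (\<lambda>z. det (H z)) y * (inverse (sqrt (det (H y))) / 2)"
    by (simp add: partial_def)
  also have "\<dots> = sqrt (det (H y)) * (partial \<gamma> (\<lambda>z. det (H z)) y / (2 * det (H y)))"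
    using pos real_sqrt_mult_self[of "det (H y)"] by (simp add: field_simps)
  finally show ?thesis
    by (simp add: trace)
qed

text \<open>
  The derivatives of the cofactor drop out by the metric-independent identity. The derivatives of the
  volume density and the Christoffel symbols on the right-hand side both become
  \<open>det [dF] \<Gamma>\<^sup>\<beta>\<^sub>\<beta>\<^sub>c \<xi>\<^sup>c\<close> (facts 1 and 2 in the proof), because contracting the cofactor with the
  Jacobian gives the determinant.
\<close>

lemma divergence_flux:
  fixes F :: "real^'n \<Rightarrow> real^'n"
  assumes S: "open S" "x \<in> S" and F: "Ck_on 2 F S"
    and diff: "\<And>k l. (\<lambda>z. H z $ k $ l) differentiable (at (F x))"
    and sym: "transpose (H (F x)) = H (F x)" and pos: "det (H (F x)) > 0"
    and \<xi>: "\<xi> differentiable (at x)"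
  shows "divergence (flux H F \<xi>) x = sqrt (det (H (F x))) *
    (\<Sum>\<beta>\<in>UNIV. \<Sum>j\<in>UNIV. cof (jacobian F (at x)) $ \<beta> $ j *
      (partial j (\<lambda>z. \<xi> z $ \<beta>) x + (\<Sum>a\<in>UNIV. \<Sum>c\<in>UNIV. christoffel H \<beta> a c (F x) *
        partial j (\<lambda>z. F z $ a) x * \<xi> x $ c)))"
proof -
  note C1 = Ck_on_2D[OF S(1) F]
  define r where "r z = sqrt (det (H (F z)))" for z
  define C where "C z = cof (jacobian F (at z))" for z
  define \<Gamma> where "\<Gamma> c = (\<Sum>\<beta>\<in>UNIV. christoffel H \<beta> \<beta> c (F x))" for c
  let ?d = "det (jacobian F (at x))"
  have Fd: "F differentiable (at x)"
    by (rule C1_on_imp_differentiable[OF C1(1) S(2)])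
  have dF: "partial j (\<lambda>z. F z $ a) x = jacobian F (at x) $ a $ j" for a j
    by (simp add: jacobian_component partial_component[OF Fd])
  have sqrt_diff: "(\<lambda>y. sqrt (det (H y))) differentiable (at (F x))"
    using has_derivative_real_sqrt[OF pos has_derivative_det[of H, OF diff[unfolded frechet_derivative_works]]]
    unfolding differentiable_def by blast
  have r_diff: "r differentiable (at x)"
    unfolding r_def using differentiable_chain_at[OF Fd sqrt_diff] by (simp add: o_def)
  have dr: "partial j r x = r x * (\<Sum>a\<in>UNIV. \<Gamma> a * jacobian F (at x) $ a $ j)" for j
    unfolding r_def partial_compose[OF Fd sqrt_diff] sum_christoffel[OF diff sym pos]
    by (simp add: \<Gamma>_def jacobian_component sum_distrib_left mult_ac)
  have C_diff: "(\<lambda>z. C z $ a $ j) differentiable (at x)" for a j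
    unfolding C_def
    by (rule C1_on_imp_differentiable[OF C1_on_cof S(2)]) (simp add: jacobian_component C1_on_component C1)
  have piola: "(\<Sum>j\<in>UNIV. partial j (\<lambda>z. C z $ a $ j) x) = 0" for a
    using piola_div_eq_0[OF S F, of a] unfolding piola_div_def C_def cof_transpose by (simp add: transpose_def)
  have \<xi>_diff: "(\<lambda>z. \<xi> z $ a) differentiable (at x)" for a
    using differentiable_chain_at[OF \<xi> bounded_linear_imp_differentiable[OF bounded_linear_vec_nth]]
    by (simp add: o_def)
  have lap: "(\<Sum>j\<in>UNIV. jacobian F (at x) $ b $ j * C x $ a $ j) = (if b = a then ?d else 0)" for a b
    unfolding C_def by (rule laplace_row)
  have flux: "flux H F \<xi> z $ j = r z * (\<Sum>a\<in>UNIV. C z $ a $ j * \<xi> z $ a)" for z j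
    by (simp add: flux_def r_def C_def matrix_vector_mult_def transpose_def)
  have "partial j (\<lambda>z. flux H F \<xi> z $ j) x =
      r x * (\<Sum>a\<in>UNIV. \<Sum>b\<in>UNIV. \<Gamma> b * \<xi> x $ a * (jacobian F (at x) $ b $ j * C x $ a $ j)) +
      r x * (\<Sum>a\<in>UNIV. partial j (\<lambda>z. C z $ a $ j) x * \<xi> x $ a) +
      r x * (\<Sum>a\<in>UNIV. C x $ a $ j * partial j (\<lambda>z. \<xi> z $ a) x)" for j
  proof -
    have "partial j (\<lambda>z. flux H F \<xi> z $ j) x =
      partial j r x * (\<Sum>a\<in>UNIV. C x $ a $ j * \<xi> x $ a) +
      r x * (\<Sum>a\<in>UNIV. partial j (\<lambda>z. C z $ a $ j) x * \<xi> x $ a + C x $ a $ j * partial j (\<lambda>z. \<xi> z $ a) x)"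
      unfolding flux
      by (subst partial_mult[OF r_diff])
        (simp_all add: partial_sum partial_mult C_diff \<xi>_diff)
    also have "partial j r x * (\<Sum>a\<in>UNIV. C x $ a $ j * \<xi> x $ a) =
      r x * (\<Sum>a\<in>UNIV. \<Sum>b\<in>UNIV. \<Gamma> b * \<xi> x $ a * (jacobian F (at x) $ b $ j * C x $ a $ j))"
      unfolding dr by (simp add: sum_distrib_left sum_distrib_right mult_ac) (rule sum.swap)
    finally show ?thesis by (simp add: sum.distrib distrib_left)
  qed
  then have "divergence (flux H F \<xi>) x =
      r x * (\<Sum>j\<in>UNIV. \<Sum>a\<in>UNIV. \<Sum>b\<in>UNIV. \<Gamma> b * \<xi> x $ a * (jacobian F (at x) $ b $ j * C x $ a $ j)) +
      r x * (\<Sum>j\<in>UNIV. \<Sum>a\<in>UNIV. partial j (\<lambda>z. C z $ a $ j) x * \<xi> x $ a) +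
      r x * (\<Sum>j\<in>UNIV. \<Sum>a\<in>UNIV. C x $ a $ j * partial j (\<lambda>z. \<xi> z $ a) x)"
    by (simp add: divergence_def sum.distrib sum_distrib_left)
  also have "(\<Sum>j\<in>UNIV. \<Sum>a\<in>UNIV. partial j (\<lambda>z. C z $ a $ j) x * \<xi> x $ a) = 0"
    by (subst sum.swap) (simp add: sum_distrib_right[symmetric] piola)
  also have "(\<Sum>j\<in>UNIV. \<Sum>a\<in>UNIV. \<Sum>b\<in>UNIV. \<Gamma> b * \<xi> x $ a * (jacobian F (at x) $ b $ j * C x $ a $ j)) =
    ?d * (\<Sum>a\<in>UNIV. \<Gamma> a * \<xi> x $ a)"
  proof -
    have "(\<Sum>j\<in>UNIV. \<Sum>a\<in>UNIV. \<Sum>b\<in>UNIV. \<Gamma> b * \<xi> x $ a * (jacobian F (at x) $ b $ j * C x $ a $ j)) =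
      (\<Sum>a\<in>UNIV. \<Sum>j\<in>UNIV. \<Sum>b\<in>UNIV. \<Gamma> b * \<xi> x $ a * (jacobian F (at x) $ b $ j * C x $ a $ j))"
      by (rule sum.swap)
    also have "\<dots> = (\<Sum>a\<in>UNIV. \<Sum>b\<in>UNIV. \<Sum>j\<in>UNIV. \<Gamma> b * \<xi> x $ a * (jacobian F (at x) $ b $ j * C x $ a $ j))"
      by (intro sum.cong refl sum.swap)
    also have "\<dots> = ?d * (\<Sum>a\<in>UNIV. \<Gamma> a * \<xi> x $ a)"
      unfolding sum_distrib_left[symmetric] lap
      by (simp add: if_distrib[of "\<lambda>x. _ * x"] cong: if_cong) (simp add: sum_distrib_left mult_ac)
    finally show ?thesis .
  qed
  finally have 1: "divergence (flux H F \<xi>) x = r x * (?d * (\<Sum>a\<in>UNIV. \<Gamma> a * \<xi> x $ a)) +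
      r x * (\<Sum>j\<in>UNIV. \<Sum>a\<in>UNIV. C x $ a $ j * partial j (\<lambda>z. \<xi> z $ a) x)"
    by simp
  have "(\<Sum>\<beta>\<in>UNIV. \<Sum>j\<in>UNIV. C x $ \<beta> $ j *
      (\<Sum>a\<in>UNIV. \<Sum>c\<in>UNIV. christoffel H \<beta> a c (F x) * jacobian F (at x) $ a $ j * \<xi> x $ c)) =
    (\<Sum>\<beta>\<in>UNIV. ?d * (\<Sum>c\<in>UNIV. christoffel H \<beta> \<beta> c (F x) * \<xi> x $ c))"
  proof (rule sum.cong[OF refl])
    fix \<beta>
    have "(\<Sum>j\<in>UNIV. C x $ \<beta> $ j *
      (\<Sum>a\<in>UNIV. \<Sum>c\<in>UNIV. christoffel H \<beta> a c (F x) * jacobian F (at x) $ a $ j * \<xi> x $ c)) =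
      (\<Sum>j\<in>UNIV. \<Sum>a\<in>UNIV. (\<Sum>c\<in>UNIV. christoffel H \<beta> a c (F x) * \<xi> x $ c) *
        (jacobian F (at x) $ a $ j * C x $ \<beta> $ j))"
      by (simp add: sum_distrib_left sum_distrib_right mult_ac)
    also have "\<dots> = (\<Sum>a\<in>UNIV. \<Sum>j\<in>UNIV. (\<Sum>c\<in>UNIV. christoffel H \<beta> a c (F x) * \<xi> x $ c) *
        (jacobian F (at x) $ a $ j * C x $ \<beta> $ j))"
      by (rule sum.swap)
    also have "\<dots> = ?d * (\<Sum>c\<in>UNIV. christoffel H \<beta> \<beta> c (F x) * \<xi> x $ c)"
      unfolding sum_distrib_left[symmetric] lap
      by (simp add: if_distrib[of "\<lambda>x. _ * x"] cong: if_cong)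
    finally show "(\<Sum>j\<in>UNIV. C x $ \<beta> $ j *
      (\<Sum>a\<in>UNIV. \<Sum>c\<in>UNIV. christoffel H \<beta> a c (F x) * jacobian F (at x) $ a $ j * \<xi> x $ c)) =
      ?d * (\<Sum>c\<in>UNIV. christoffel H \<beta> \<beta> c (F x) * \<xi> x $ c)" .
  qed
  also have "\<dots> = ?d * (\<Sum>\<beta>\<in>UNIV. \<Sum>c\<in>UNIV. christoffel H \<beta> \<beta> c (F x) * \<xi> x $ c)"
    by (simp only: sum_distrib_left)
  also have "\<dots> = ?d * (\<Sum>c\<in>UNIV. \<Gamma> c * \<xi> x $ c)"
    by (subst sum.swap) (simp only: \<Gamma>_def sum_distrib_right)
  finally have 2: "(\<Sum>\<beta>\<in>UNIV. \<Sum>j\<in>UNIV. C x $ \<beta> $ j *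
      (\<Sum>a\<in>UNIV. \<Sum>c\<in>UNIV. christoffel H \<beta> a c (F x) * jacobian F (at x) $ a $ j * \<xi> x $ c)) =
    ?d * (\<Sum>c\<in>UNIV. \<Gamma> c * \<xi> x $ c)" .
  have 3: "(\<Sum>\<beta>\<in>UNIV. \<Sum>j\<in>UNIV. C x $ \<beta> $ j * partial j (\<lambda>z. \<xi> z $ \<beta>) x) =
    (\<Sum>j\<in>UNIV. \<Sum>\<beta>\<in>UNIV. C x $ \<beta> $ j * partial j (\<lambda>z. \<xi> z $ \<beta>) x)"
    by (rule sum.swap)
  show ?thesis
    unfolding 1 r_def[symmetric] C_def[symmetric] dF distrib_left sum.distrib 2 3
    by (simp only: add.commute)
qed

text \<open>
  This is the formula for the divergence of the flux with \<open>\<xi>\<close> the constant unit vector \<open>e\<^sub>\<gamma>\<close>.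
\<close>

lemma piola_coord_eq_0:
  fixes F :: "real^'n \<Rightarrow> real^'n"
  assumes S: "open S" "x \<in> S" and F: "Ck_on 2 F S"
    and diff: "\<And>k l. (\<lambda>z. H z $ k $ l) differentiable (at (F x))"
    and sym: "transpose (H (F x)) = H (F x)" and pos: "det (H (F x)) > 0"
  shows "piola_coord H F \<gamma> x = 0"
proof -
  let ?\<xi> = "\<lambda>z :: real^'n. axis \<gamma> (1 :: real) :: real^'n"
  let ?J = "jacobian F (at x)"
  have Fd: "F differentiable (at x)"
    by (rule C1_on_imp_differentiable[OF Ck_on_2D(1)[OF S(1) F] S(2)])
  have const: "partial j (\<lambda>z :: real^'n. c :: real) x = 0" for j c
    by (rule partial_eqI[OF has_derivative_const])
  have flux: "flux H F ?\<xi> z $ j = cof (transpose (jacobian F (at z))) $ j $ \<gamma> * sqrt (det (H (F z)))" for z j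
    by (simp add: flux_def matrix_vector_mult_basis column_def cof_transpose mult.commute)
  have "(\<Sum>j\<in>UNIV. partial j (\<lambda>z. cof (transpose (jacobian F (at z))) $ j $ \<gamma> * sqrt (det (H (F z)))) x) =
    divergence (flux H F ?\<xi>) x"
    by (simp add: divergence_def flux)
  also have "\<dots> = sqrt (det (H (F x))) * (\<Sum>\<beta>\<in>UNIV. \<Sum>j\<in>UNIV. cof ?J $ \<beta> $ j *
      (\<Sum>a\<in>UNIV. \<Sum>c\<in>UNIV. christoffel H \<beta> a c (F x) * ?J $ a $ j * ?\<xi> x $ c))"
    by (simp add: divergence_flux[OF assms] const partial_component[OF Fd] jacobian_component)
  also have "(\<Sum>\<beta>\<in>UNIV. \<Sum>j\<in>UNIV. cof ?J $ \<beta> $ j *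
      (\<Sum>a\<in>UNIV. \<Sum>c\<in>UNIV. christoffel H \<beta> a c (F x) * ?J $ a $ j * ?\<xi> x $ c)) =
    (\<Sum>\<beta>\<in>UNIV. \<Sum>j\<in>UNIV. \<Sum>a\<in>UNIV. christoffel H \<beta> a \<gamma> (F x) * (?J $ a $ j * cof ?J $ \<beta> $ j))"
    by (simp add: axis_def if_distrib[of "\<lambda>x. _ * x"] cong: if_cong) (simp add: sum_distrib_left mult_ac)
  also have "\<dots> = (\<Sum>\<beta>\<in>UNIV. \<Sum>a\<in>UNIV. \<Sum>j\<in>UNIV. christoffel H \<beta> a \<gamma> (F x) * (?J $ a $ j * cof ?J $ \<beta> $ j))"
    by (intro sum.cong refl sum.swap)
  also have "\<dots> = (\<Sum>\<beta>\<in>UNIV. christoffel H \<beta> \<beta> \<gamma> (F x)) * det ?J"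
    unfolding sum_distrib_left[symmetric] laplace_row
    by (simp add: if_distrib[of "\<lambda>x. _ * x"] sum_distrib_right cong: if_cong)
  finally show ?thesis
    using pos by (simp add: piola_coord_def)
qed

lemma divergence_cong:
  assumes "open S" "x \<in> S" "\<And>z. z \<in> S \<Longrightarrow> W z = V z"
  shows "divergence W x = divergence V x"
  unfolding divergence_def using assms by (auto intro!: sum.cong partial_cong[of S])

lemma divergence_add:
  assumes "W differentiable (at x)" "V differentiable (at x)"
  shows "divergence (\<lambda>z. W z + V z) x = divergence W x + divergence V x"
proof -
  have "partial j (\<lambda>z. (W z + V z) $ j) x = partial j (\<lambda>z. W z $ j) x + partial j (\<lambda>z. V z $ j) x" for j
  proof -
    have "(\<lambda>z. W z + V z) differentiable (at x)"
      using assms by simp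
    moreover have "partial j (\<lambda>z. W z + V z) x = partial j W x + partial j V x"
      using partial_eqI[OF has_derivative_add[of W _ "at x" V]] assms
      unfolding frechet_derivative_works partial_def by blast
    ultimately show ?thesis
      by (simp only: partial_component assms vector_add_component[symmetric])
  qed
  then show ?thesis by (simp add: divergence_def sum.distrib)
qed

text \<open>
  The transposed cofactor is how vector densities are pulled back; that this commutes with the
  divergence is the metric-independent identity for \<open>T\<close>.
\<close>

lemma divergence_piola_transform:
  fixes T :: "real^'n \<Rightarrow> real^'n"
  assumes S: "open S" "x \<in> S" and T: "Ck_on 2 T S" and W: "W differentiable (at (T x))"
  shows "divergence (\<lambda>z. transpose (cof (jacobian T (at z))) *v W (T z)) x = det (jacobian T (at x)) * divergence W (T x)"
proof -
  note C1 = Ck_on_2D[OF S(1) T]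
  define C where "C z = cof (jacobian T (at z))" for z
  have Td: "T differentiable (at x)"
    by (rule C1_on_imp_differentiable[OF C1(1) S(2)])
  have C_diff: "(\<lambda>z. C z $ a $ j) differentiable (at x)" for a j
    unfolding C_def
    by (rule C1_on_imp_differentiable[OF C1_on_cof S(2)]) (simp add: jacobian_component C1_on_component C1)
  have piola: "(\<Sum>j\<in>UNIV. partial j (\<lambda>z. C z $ a $ j) x) = 0" for a
    using piola_div_eq_0[OF S T, of a] unfolding piola_div_def C_def cof_transpose by (simp add: transpose_def)
  have W_diff: "(\<lambda>y. W y $ a) differentiable (at (T x))" for a
    using differentiable_chain_at[OF W bounded_linear_imp_differentiable[OF bounded_linear_vec_nth]]
    by (simp add: o_def)
  have WT_diff: "(\<lambda>z. W (T z) $ a) differentiable (at x)" for a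
    using differentiable_chain_at[OF Td W_diff] by (simp add: o_def)
  have "divergence (\<lambda>z. transpose (C z) *v W (T z)) x =
    (\<Sum>j\<in>UNIV. \<Sum>a\<in>UNIV. partial j (\<lambda>z. C z $ a $ j) x * W (T x) $ a +
      C x $ a $ j * (\<Sum>b\<in>UNIV. partial b (\<lambda>y. W y $ a) (T x) * jacobian T (at x) $ b $ j))"
    by (simp add: divergence_def matrix_vector_mult_def transpose_def partial_sum partial_mult
        partial_compose[OF Td W_diff] C_diff WT_diff jacobian_component)
  also have "\<dots> = (\<Sum>j\<in>UNIV. \<Sum>a\<in>UNIV. partial j (\<lambda>z. C z $ a $ j) x * W (T x) $ a) +
    (\<Sum>j\<in>UNIV. \<Sum>a\<in>UNIV. \<Sum>b\<in>UNIV. partial b (\<lambda>y. W y $ a) (T x) * (jacobian T (at x) $ b $ j * C x $ a $ j))"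
    by (simp add: sum.distrib sum_distrib_left mult_ac)
  also have "(\<Sum>j\<in>UNIV. \<Sum>a\<in>UNIV. partial j (\<lambda>z. C z $ a $ j) x * W (T x) $ a) = 0"
    by (subst sum.swap) (simp add: sum_distrib_right[symmetric] piola)
  also have "(\<Sum>j\<in>UNIV. \<Sum>a\<in>UNIV. \<Sum>b\<in>UNIV. partial b (\<lambda>y. W y $ a) (T x) * (jacobian T (at x) $ b $ j * C x $ a $ j)) =
    (\<Sum>a\<in>UNIV. \<Sum>j\<in>UNIV. \<Sum>b\<in>UNIV. partial b (\<lambda>y. W y $ a) (T x) * (jacobian T (at x) $ b $ j * C x $ a $ j))"
    by (rule sum.swap)
  also have "\<dots> = (\<Sum>a\<in>UNIV. \<Sum>b\<in>UNIV. \<Sum>j\<in>UNIV. partial b (\<lambda>y. W y $ a) (T x) * (jacobian T (at x) $ b $ j * C x $ a $ j))"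
    by (intro sum.cong refl sum.swap)
  also have "\<dots> = det (jacobian T (at x)) * divergence W (T x)"
    unfolding sum_distrib_left[symmetric] C_def laplace_row divergence_def
    by (simp add: if_distrib[of "\<lambda>x. _ * x"] sum_distrib_left mult_ac cong: if_cong)
  finally show ?thesis by (simp add: C_def)
qed

section \<open>Integration in coordinate space\<close>

text \<open>
  By translation invariance every difference quotient of \<open>w\<close> along an axis has integral zero. The
  quotients are supported in a fixed ball and bounded by the maximum of the partial derivative, so
  dominated convergence gives the claim.
\<close>

lemma integral_partial_compact_support:
  fixes w :: "real^'n \<Rightarrow> real"
  assumes w: "C1_on w UNIV" and K: "compact K" and zero: "\<And>x. x \<notin> K \<Longrightarrow> w x = 0"
  shows "integrable lborel (partial i w)" "(LINT x|lborel. partial i w x) = 0"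
proof -
  let ?e = "axis i 1 :: real^'n"
  have diff: "w differentiable (at x)" for x
    using C1_on_imp_differentiable[OF w] by simp
  have cont: "continuous_on UNIV (partial i w)"
    by (rule C1_on_partial_continuous[OF open_UNIV w])
  have contw: "continuous_on UNIV w"
    by (rule C1_on_imp_continuous_on[OF w])
  have zero': "partial i w x = 0" if "x \<notin> K" for x
  proof -
    have "partial i w x = partial i (\<lambda>_. 0) x"
      using K that zero by (intro partial_cong[of "- K"]) (auto intro: compact_imp_closed)
    then show ?thesis
      using partial_eqI[OF has_derivative_const, of i "0::real" x] by simp
  qed
  have integrable: "integrable lborel u" if "continuous_on UNIV u" "\<And>x. x \<notin> K \<Longrightarrow> u x = 0" for u :: "real^'n \<Rightarrow> real"
  proof -
    have "integrable lborel (\<lambda>x. indicator K x *\<^sub>R u x)"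
      using K that by (intro borel_integrable_compact) (auto intro: continuous_on_subset)
    moreover have "(\<lambda>x. indicator K x *\<^sub>R u x) = u"
      using that(2) by (auto simp: indicator_def fun_eq_iff)
    ultimately show ?thesis by simp
  qed
  show int: "integrable lborel (partial i w)"
    by (rule integrable[OF cont zero'])
  have intw: "integrable lborel w"
    by (rule integrable[OF contw zero])
  have "bounded (partial i w ` K)"
    using K cont by (intro compact_imp_bounded compact_continuous_image) (auto intro: continuous_on_subset)
  then obtain L where L: "L > 0" "\<And>x. x \<in> K \<Longrightarrow> \<bar>partial i w x\<bar> \<le> L"
    by (auto simp: bounded_pos)
  then have L': "\<bar>partial i w x\<bar> \<le> L" for x
    using zero'[of x] by (cases "x \<in> K") auto
  have lipschitz: "\<bar>w (x + t *\<^sub>R ?e) - w x\<bar> \<le> t * L" if "t > 0" for t x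
  proof -
    have "((\<lambda>s. w (x + s *\<^sub>R ?e)) has_real_derivative partial i w (x + s *\<^sub>R ?e)) (at s)" for s
      by (rule has_real_derivative_along_axis[OF diff])
    from MVT2[OF that this] obtain s where "w (x + t *\<^sub>R ?e) - w (x + 0 *\<^sub>R ?e) = (t - 0) * partial i w (x + s *\<^sub>R ?e)"
      by blast
    then show ?thesis using L'[of "x + s *\<^sub>R ?e"] that by (simp add: abs_mult)
  qed
  obtain R where "\<And>x. x \<in> K \<Longrightarrow> norm x \<le> R"
    using compact_imp_bounded[OF K] unfolding bounded_iff by blast
  then have R: "K \<subseteq> cball 0 R"
    by auto
  define t where "t n = 1 / real (Suc n)" for n
  have t: "0 < t n" "t n \<le> 1" for n
    by (simp_all add: t_def)
  define q where "q n x = (w (t n *\<^sub>R ?e + x) - w x) / t n" for n x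
  have int_shift: "integrable lborel (\<lambda>x. w (c + x))" "(LINT x|lborel. w (c + x)) = (LINT x|lborel. w x)" for c
  proof -
    have *: "(+) c \<in> borel_measurable lborel" "w \<in> borel_measurable borel"
      using borel_measurable_continuous_onI[OF contw] by auto
    show "integrable lborel (\<lambda>x. w (c + x))"
      using intw by (subst integrable_distr_eq[OF *, symmetric]) (simp add: lborel_distr_plus)
    show "(LINT x|lborel. w (c + x)) = (LINT x|lborel. w x)"
      by (subst integral_distr[OF *, symmetric]) (simp add: lborel_distr_plus)
  qed
  have q_int: "(LINT x|lborel. q n x) = 0" "integrable lborel (q n)" for n
    unfolding q_def using int_shift[of "t n *\<^sub>R ?e"] intw by simp_all
  have "(\<lambda>n. LINT x|lborel. q n x) \<longlonglongrightarrow> (LINT x|lborel. partial i w x)"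
  proof (rule integral_dominated_convergence)
    show "integrable lborel (\<lambda>x. indicator (cball 0 (R + 1)) x *\<^sub>R L)"
      by (rule borel_integrable_compact) auto
    show "AE x in lborel. (\<lambda>n. q n x) \<longlonglongrightarrow> partial i w x"
    proof (rule AE_I2)
      fix x
      have "((\<lambda>s. w (x + s *\<^sub>R ?e)) has_real_derivative partial i w (x + 0 *\<^sub>R ?e)) (at 0)"
        by (rule has_real_derivative_along_axis[OF diff])
      then have "((\<lambda>h. (w (x + h *\<^sub>R ?e) - w x) / h) \<longlongrightarrow> partial i w x) (at 0)"
        by (simp add: DERIV_def)
      moreover have "filterlim t (at 0) sequentially"
      proof (rule filterlim_atI)
        show "t \<longlonglongrightarrow> 0"
          unfolding t_def by (rule LIMSEQ_Suc[OF lim_const_over_n])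
        show "\<forall>\<^sub>F n in sequentially. t n \<noteq> 0"
          using t(1) by (intro always_eventually allI) (metis less_irrefl)
      qed
      ultimately have "((\<lambda>n. (w (x + t n *\<^sub>R ?e) - w x) / t n) \<longlongrightarrow> partial i w x) sequentially"
        by (rule filterlim_compose)
      then show "(\<lambda>n. q n x) \<longlonglongrightarrow> partial i w x"
        by (simp add: q_def add.commute)
    qed
    show "AE x in lborel. norm (q n x) \<le> indicator (cball 0 (R + 1)) x *\<^sub>R L" for n
    proof (rule AE_I2)
      fix x
      \<comment> \<open>The steps \<open>t n\<close> are at most \<open>1\<close>, hence the radius \<open>R + 1\<close>.\<close>
      show "norm (q n x) \<le> indicator (cball 0 (R + 1)) x *\<^sub>R L"
      proof (cases "x \<in> cball 0 (R + 1)")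
        case True
        then show ?thesis
          using lipschitz[OF t(1)[of n], of x] t(1)[of n] by (simp add: q_def field_simps abs_divide add.commute)
      next
        case False
        have "norm x \<le> norm (t n *\<^sub>R ?e + x) + norm (t n *\<^sub>R ?e)"
          using norm_triangle_ineq4[of "t n *\<^sub>R ?e + x" "t n *\<^sub>R ?e"] by simp
        then have "norm (t n *\<^sub>R ?e + x) > R" "norm x > R"
          using False t[of n] by auto
        then have "t n *\<^sub>R ?e + x \<notin> K" "x \<notin> K"
          using R by (auto simp: subset_iff)
        then show ?thesis
          using False by (simp add: q_def zero)
      qed
    qed
  qed (use int q_int in \<open>auto dest: borel_measurable_integrable\<close>)
  then show "(LINT x|lborel. partial i w x) = 0"
    by (simp add: q_int LIMSEQ_const_iff)
qed

lemma integral_divergence_compact_support: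
  fixes W :: "real^'n \<Rightarrow> real^'n"
  assumes W: "C1_on W UNIV" and K: "compact K" and zero: "\<And>x. x \<notin> K \<Longrightarrow> W x = 0"
  shows "integrable lborel (divergence W)" "(LINT x|lborel. divergence W x) = 0"
proof -
  have *: "integrable lborel (partial j (\<lambda>z. W z $ j))" "(LINT x|lborel. partial j (\<lambda>z. W z $ j) x) = 0" for j
    using integral_partial_compact_support[OF C1_on_component[OF W] K] zero by simp_all
  then show "integrable lborel (divergence W)" "(LINT x|lborel. divergence W x) = 0"
    unfolding divergence_def[abs_def] by (auto simp: Bochner_Integration.integral_sum)
qed

text \<open>
  The square of the positive part is continuously differentiable. The two summands of the denominator
  are not both zero since \<open>r < s\<close>.
\<close>

lemma C1_bump_function:
  fixes a :: "real^'n"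
  assumes "0 < r" "r < s"
  obtains b :: "real^'n \<Rightarrow> real" where "C1_on b UNIV" "\<And>x. dist a x \<le> r \<Longrightarrow> b x = 1" "\<And>x. s \<le> dist a x \<Longrightarrow> b x = 0"
proof -
  define p where "p t = (max 0 t)\<^sup>2" for t :: real
  have "(p has_field_derivative 2 * max 0 t) (at t)" for t
  proof (cases "t = 0")
    case True
    have "((\<lambda>h. (p (0 + h) - p 0) / h) \<longlongrightarrow> 0) (at 0)"
    proof (rule tendsto_0_le[where K = 1])
      show "((\<lambda>h. h :: real) \<longlongrightarrow> 0) (at 0)" by (rule tendsto_ident_at)
      show "\<forall>\<^sub>F h in at 0. norm ((p (0 + h) - p 0) / h) \<le> norm h * 1"
        by (auto simp: p_def max_def power2_eq_square)
    qed
    with True show ?thesis by (simp add: DERIV_def)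
  next
    case False
    show ?thesis
    proof (cases "t > 0")
      case True
      have "((\<lambda>t. t\<^sup>2) has_field_derivative 2 * t) (at t)"
        by (auto intro!: derivative_eq_intros)
      then have "(p has_field_derivative 2 * t) (at t)"
        by (rule has_field_derivative_transform_within_open[where S = "{0<..}"]) (use True in \<open>auto simp: p_def\<close>)
      with True show ?thesis by simp
    next
      case neg: False
      have "((\<lambda>t. 0) has_field_derivative 0) (at t)"
        by (auto intro!: derivative_eq_intros)
      then have "(p has_field_derivative 0) (at t)"
        by (rule has_field_derivative_transform_within_open[where S = "{..<0}"]) (use neg False in \<open>auto simp: p_def\<close>)
      with neg show ?thesis by simp
    qed
  qed
  then have p: "C1_on p UNIV"
    by (rule C1_on_real) (intro continuous_intros)
  define d where "d x = (\<Sum>i\<in>UNIV. (a $ i - x $ i) * (a $ i - x $ i))" for x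
  have d: "d x = (dist a x)\<^sup>2" for x
    by (simp add: d_def dist_norm power2_norm_eq_inner inner_vec_def)
  have dC1: "C1_on d UNIV"
    unfolding d_def by (intro C1_on_sum C1_on_mult C1_on_diff C1_on_component C1_on_ident C1_on_const)
  define b where "b x = p (s\<^sup>2 - d x) / (p (s\<^sup>2 - d x) + p (d x - r\<^sup>2))" for x
  have rs: "r\<^sup>2 < s\<^sup>2"
    using assms by (simp add: power_strict_mono)
  have pos: "p (s\<^sup>2 - u) + p (u - r\<^sup>2) > 0" for u
  proof -
    have "s\<^sup>2 - u > 0 \<or> u - r\<^sup>2 > 0" using rs by linarith
    then show ?thesis by (auto simp: p_def intro: add_pos_nonneg add_nonneg_pos)
  qed
  show thesis
  proof
    show "C1_on b UNIV"
      unfolding b_def using less_imp_neq[OF pos, symmetric]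
      by (intro C1_on_divide C1_on_add C1_on_compose[OF p] C1_on_diff C1_on_const dC1) auto
    show "b x = 1" if "dist a x \<le> r" for x
    proof -
      have "d x \<le> r\<^sup>2" using that assms by (simp add: d power_mono)
      then have "p (d x - r\<^sup>2) = 0" by (simp add: p_def)
      then show ?thesis using pos[of "d x"] by (simp add: b_def)
    qed
    show "b x = 0" if "s \<le> dist a x" for x
    proof -
      have "s\<^sup>2 \<le> d x" using that assms by (simp add: d power_mono)
      then have "p (s\<^sup>2 - d x) = 0" by (simp add: p_def)
      then show ?thesis by (simp add: b_def)
    qed
  qed
qed

text \<open>
  The change of variables for the Henstock-Kurzweil integral concerns functions with finite integral.
  As either side being finite forces the other one to be finite, the identity holds in the extended
  non-negative reals.
\<close>

lemma nn_integral_change_of_variables: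
  fixes f :: "real^'n::{finite,wellorder} \<Rightarrow> real" and T :: "real^'n::_ \<Rightarrow> real^'n::_"
  assumes T: "\<And>x. x \<in> S \<Longrightarrow> (T has_derivative T' x) (at x)"
    and R: "\<And>y. y \<in> S' \<Longrightarrow> (R has_derivative R' y) (at y)"
    and S: "S \<in> sets borel" "S' \<in> sets borel"
    and inv: "\<And>x. x \<in> S \<Longrightarrow> T x \<in> S' \<and> R (T x) = x" "\<And>y. y \<in> S' \<Longrightarrow> R y \<in> S \<and> T (R y) = y"
    and inv': "\<And>y. y \<in> S' \<Longrightarrow> R' y \<circ> T' (R y) = id"
    and f: "(\<lambda>y. indicator S' y * f y) \<in> borel_measurable borel" "\<And>y. y \<in> S' \<Longrightarrow> 0 \<le> f y"
    and fT: "(\<lambda>x. indicator S x * (\<bar>det (matrix (T' x))\<bar> * f (T x))) \<in> borel_measurable borel"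
  shows "(\<integral>\<^sup>+y\<in>S'. f y \<partial>lborel) = (\<integral>\<^sup>+x\<in>S. \<bar>det (matrix (T' x))\<bar> * f (T x) \<partial>lborel)"
proof -
  define g where "g x = \<bar>det (matrix (T' x))\<bar> * f (T x)" for x
  have g: "0 \<le> g x" if "x \<in> S" for x
    using f(2) inv(1) that by (simp add: g_def)
  have iff: "(g has_integral b) S \<longleftrightarrow> (f has_integral b) S'" for b
    unfolding g_def
    by (rule cov_invertible_nonneg_eq[where h = R and h' = R'])
      (use T R f(2) inv inv' in \<open>auto intro: has_derivative_at_withinI\<close>)
  have nn: "(\<integral>\<^sup>+x\<in>X. u x \<partial>lborel) = integral\<^sup>N lborel (\<lambda>x. indicator X x * u x)"
    for X and u :: "real^'n::_ \<Rightarrow> real"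
    by (intro nn_integral_cong) (auto simp: indicator_def)
  have to_HK: "\<exists>r\<ge>0. (u has_integral r) X \<and> (\<integral>\<^sup>+x\<in>X. u x \<partial>lborel) = ennreal r"
    if meas: "(\<lambda>x. indicator X x * u x) \<in> borel_measurable borel" "\<And>x. x \<in> X \<Longrightarrow> 0 \<le> u x"
      and fin: "(\<integral>\<^sup>+x\<in>X. u x \<partial>lborel) < \<infinity>"
    for X and u :: "real^'n::_ \<Rightarrow> real"
  proof -
    obtain r where r: "0 \<le> r" "(\<integral>\<^sup>+x\<in>X. u x \<partial>lborel) = ennreal r"
      using fin by (cases "\<integral>\<^sup>+x\<in>X. u x \<partial>lborel") auto
    have "((\<lambda>x. indicator X x * u x) has_integral r) UNIV"
      using meas r(1) r(2)[unfolded nn] by (intro nn_integral_has_integral) (auto simp: indicator_def)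
    moreover have "(\<lambda>x. indicator X x * u x) = (\<lambda>x. if x \<in> X then u x else 0)"
      by (auto simp: fun_eq_iff indicator_def)
    ultimately have "(u has_integral r) X"
      by (simp add: has_integral_restrict_UNIV)
    with r show ?thesis by blast
  qed
  have from_HK: "(\<integral>\<^sup>+x\<in>X. u x \<partial>lborel) = ennreal r"
    if "(u has_integral r) X" "\<And>x. x \<in> X \<Longrightarrow> 0 \<le> u x" for X r and u :: "real^'n::_ \<Rightarrow> real"
    unfolding nn using nn_integral_has_integral_lebesgue[OF that(2,1)] by simp
  have "(\<integral>\<^sup>+y\<in>S'. f y \<partial>lborel) = (\<integral>\<^sup>+x\<in>S. g x \<partial>lborel)"
  proof (cases "(\<integral>\<^sup>+y\<in>S'. f y \<partial>lborel) < \<infinity>")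
    case True
    from to_HK[OF f(1,2) True] obtain r where "(f has_integral r) S'" "(\<integral>\<^sup>+y\<in>S'. f y \<partial>lborel) = ennreal r"
      by blast
    with iff from_HK[of g r S] g show ?thesis by simp
  next
    case False
    have "\<not> (\<integral>\<^sup>+x\<in>S. g x \<partial>lborel) < \<infinity>"
    proof
      assume fin: "(\<integral>\<^sup>+x\<in>S. g x \<partial>lborel) < \<infinity>"
      from to_HK[OF fT[folded g_def] g fin] obtain r where "(g has_integral r) S" by blast
      with iff from_HK[of f r S'] f(2) False show False by simp
    qed
    with False show ?thesis by (simp add: not_less top_unique)
  qed
  then show ?thesis by (simp add: g_def)
qed

section \<open>Charts\<close>

abbreviation ran :: "('m, 'n) chart \<Rightarrow> (real^'n) set"
  where "ran c \<equiv> snd c ` dom c"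

lemma chart_inv_chart: "is_chart c \<Longrightarrow> p \<in> dom c \<Longrightarrow> chart_inv c (snd c p) = p"
  unfolding is_chart_def by (blast intro: homeomorphism_apply1)

lemma chart_chart_inv: "x \<in> ran c \<Longrightarrow> snd c (chart_inv c x) = x"
  by (rule f_inv_into_f)

lemma chart_inv_in_dom: "x \<in> ran c \<Longrightarrow> chart_inv c x \<in> dom c"
  by (rule inv_into_into)

lemma chart_continuous:
  assumes "is_chart c"
  shows "continuous_on (dom c) (snd c)" "continuous_on (ran c) (chart_inv c)" "open (dom c)" "open (ran c)"
  using assms unfolding is_chart_def homeomorphism_def by auto

lemma chart_image_eq:
  assumes "is_chart c" "B \<subseteq> dom c"
  shows "snd c ` B = ran c \<inter> chart_inv c -` B"
  using assms chart_inv_chart[OF assms(1)] by (auto simp: image_iff)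

lemma open_chart_image:
  assumes "is_chart c" "open U" "U \<subseteq> dom c"
  shows "open (snd c ` U)"
  unfolding chart_image_eq[OF assms(1,3)]
  by (rule continuous_open_preimage[OF chart_continuous(2,4)[OF assms(1)] assms(2)])

lemma in_coord_dom_iff:
  assumes "is_chart c1"
  shows "x \<in> coord_dom c1 c2 f \<longleftrightarrow> x \<in> ran c1 \<and> f (chart_inv c1 x) \<in> dom c2"
  using chart_image_eq[OF assms, of "dom c1 \<inter> f -` dom c2"] chart_inv_in_dom[of x c1]
  unfolding coord_dom_def by auto

lemma open_coord_dom:
  assumes "is_chart c1" "is_chart c2" "continuous_on UNIV f"
  shows "open (coord_dom c1 c2 f)"
proof -
  have "open (f -` dom c2)"
    using assms by (intro open_vimage) (auto simp: is_chart_def)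
  then show ?thesis
    unfolding coord_dom_def using assms by (intro open_chart_image) (auto simp: is_chart_def)
qed

lemma jacobian_compose:
  fixes F :: "real^'n \<Rightarrow> real^'k" and G :: "real^'k \<Rightarrow> real^'l"
  assumes "F differentiable (at x)" "G differentiable (at (F x))"
  shows "jacobian (\<lambda>z. G (F z)) (at x) = jacobian G (at (F x)) ** jacobian F (at x)"
proof -
  have "((\<lambda>z. G (F z)) has_derivative (\<lambda>h. frechet_derivative G (at (F x)) (frechet_derivative F (at x) h))) (at x)"
    using has_derivative_compose[of F _ x UNIV G] assms by (simp add: frechet_derivative_works)
  then have "frechet_derivative (\<lambda>z. G (F z)) (at x) = frechet_derivative G (at (F x)) \<circ> frechet_derivative F (at x)"
    using frechet_derivative_at by (fastforce simp: o_def)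
  then show ?thesis
    unfolding jacobian_def
    using matrix_compose[OF linear_frechet_derivative[OF assms(1)] linear_frechet_derivative[OF assms(2)]] by simp
qed

lemma jacobian_cong:
  fixes F G :: "real^'n \<Rightarrow> real^'k"
  assumes "open S" "x \<in> S" "\<And>z. z \<in> S \<Longrightarrow> F z = G z"
  shows "jacobian F (at x) = jacobian G (at x)"
  using partial_cong[OF assms] by (simp add: vec_eq_iff jacobian_component)

lemma jacobian_ident: "jacobian (\<lambda>z. z) (at x) = (mat 1 :: real^'n^'n)"
  by (simp add: vec_eq_iff jacobian_component partial_eqI[OF has_derivative_ident] mat_def axis_def)

section \<open>Measures in a chart\<close>

lemma measurable_chart_inv:
  assumes "is_chart c"
  shows "(\<lambda>x. if x \<in> ran c then chart_inv c x else q) \<in> borel_measurable borel"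
  using chart_continuous[OF assms]
  by (intro borel_measurable_continuous_on_if continuous_on_const) auto

lemma borel_chart_image:
  assumes "is_chart c" "B \<in> sets borel" "B \<subseteq> dom c"
  shows "snd c ` B \<in> sets borel"
proof -
  have "(\<lambda>x. if x \<in> ran c then chart_inv c x else undefined) -` B \<in> sets borel"
    using measurable_sets[OF measurable_chart_inv[OF assms(1)] assms(2)] by simp
  then have "ran c \<inter> (\<lambda>x. if x \<in> ran c then chart_inv c x else undefined) -` B \<in> sets borel"
    using chart_continuous(4)[OF assms(1)] by auto
  also have "ran c \<inter> (\<lambda>x. if x \<in> ran c then chart_inv c x else undefined) -` B = snd c ` B"
    unfolding chart_image_eq[OF assms(1,3)] by auto
  finally show ?thesis .
qed

text \<open>
  The measure with density \<open>\<rho>\<close> in the coordinates of \<open>c\<close>, moved to the manifold and extended by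
  zero outside the domain of \<open>c\<close>.
\<close>

definition chart_measure :: "('m::topological_space, 'n::finite) chart \<Rightarrow> (real^'n \<Rightarrow> real) \<Rightarrow> 'm measure"
  where "chart_measure c \<rho> = distr (density lborel (\<lambda>x. ennreal (indicator (ran c) x * \<rho> x))) borel
    (\<lambda>x. if x \<in> ran c then chart_inv c x else undefined)"

lemma sets_chart_measure [simp]: "sets (chart_measure c \<rho>) = sets borel"
  by (simp add: chart_measure_def)

lemma emeasure_chart_measure:
  assumes c: "is_chart c" and \<rho>: "continuous_on (ran c) \<rho>" and B: "B \<in> sets borel"
  shows "emeasure (chart_measure c \<rho>) B = (\<integral>\<^sup>+x\<in>snd c ` (B \<inter> dom c). \<rho> x \<partial>lborel)"
proof -
  let ?i = "\<lambda>x. if x \<in> ran c then chart_inv c x else undefined"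
  have meas: "?i \<in> borel_measurable (density lborel (\<lambda>x. ennreal (indicator (ran c) x * \<rho> x)))"
    using measurable_chart_inv[OF c] by simp
  have "(\<lambda>x. indicator (ran c) x *\<^sub>R \<rho> x) \<in> borel_measurable borel"
    using chart_continuous(4)[OF c] \<rho> by (intro borel_measurable_continuous_on_indicator) auto
  then have dens: "(\<lambda>x. ennreal (indicator (ran c) x * \<rho> x)) \<in> borel_measurable lborel"
    by simp
  have pre: "?i -` B \<in> sets borel"
    using measurable_sets[OF measurable_chart_inv[OF c] B] by simp
  have "emeasure (chart_measure c \<rho>) B = emeasure (density lborel (\<lambda>x. ennreal (indicator (ran c) x * \<rho> x))) (?i -` B)"
    unfolding chart_measure_def using emeasure_distr[OF meas B] by simp
  also have "\<dots> = (\<integral>\<^sup>+x\<in>?i -` B. ennreal (indicator (ran c) x * \<rho> x) \<partial>lborel)"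
    using emeasure_density[OF dens, of "?i -` B"] pre by simp
  also have "\<dots> = (\<integral>\<^sup>+x\<in>snd c ` (B \<inter> dom c). \<rho> x \<partial>lborel)"
  proof (rule nn_integral_cong)
    fix x
    have "x \<in> snd c ` (B \<inter> dom c) \<longleftrightarrow> x \<in> ran c \<and> chart_inv c x \<in> B"
      using chart_image_eq[OF c, of "B \<inter> dom c"] chart_inv_in_dom[of x c] by auto
    then show "ennreal (indicator (ran c) x * \<rho> x) * indicator (?i -` B) x =
      ennreal (\<rho> x) * indicator (snd c ` (B \<inter> dom c)) x"
      by (auto simp: indicator_def)
  qed
  finally show ?thesis .
qed

lemma integral_chart_measure:
  fixes P :: "'m::topological_space \<Rightarrow> real"
  assumes c: "is_chart c" and \<rho>: "continuous_on (ran c) \<rho>" "\<And>x. x \<in> ran c \<Longrightarrow> \<rho> x \<ge> 0" and P: "P \<in> borel_measurable borel"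
  shows "integrable (chart_measure c \<rho>) P \<longleftrightarrow> integrable lborel (\<lambda>x. indicator (ran c) x * (\<rho> x * P (chart_inv c x)))" (is ?A)
    and "integral\<^sup>L (chart_measure c \<rho>) P = (LINT x|lborel. indicator (ran c) x * (\<rho> x * P (chart_inv c x)))" (is ?B)
proof -
  let ?i = "\<lambda>x. if x \<in> ran c then chart_inv c x else undefined"
  let ?d = "\<lambda>x. indicator (ran c) x * \<rho> x"
  have meas: "?i \<in> borel_measurable (density lborel ?d)"
    using measurable_chart_inv[OF c] by simp
  have "(\<lambda>x. indicator (ran c) x *\<^sub>R \<rho> x) \<in> borel_measurable borel"
    using chart_continuous(4)[OF c] \<rho> by (intro borel_measurable_continuous_on_indicator) auto
  then have dens: "?d \<in> borel_measurable lborel"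
    by simp
  have nonneg: "AE x in lborel. 0 \<le> ?d x"
    using \<rho>(2) by (intro AE_I2) (simp add: indicator_def)
  have Pi: "(\<lambda>x. P (?i x)) \<in> borel_measurable lborel"
    using measurable_compose[OF measurable_chart_inv[OF c] P] by simp
  have eq: "(\<lambda>x. ?d x *\<^sub>R P (?i x)) = (\<lambda>x. indicator (ran c) x * (\<rho> x * P (chart_inv c x)))"
    by (auto simp: fun_eq_iff indicator_def)
  show ?A
    unfolding chart_measure_def integrable_distr_eq[OF meas P]
    using integrable_density[OF Pi dens nonneg] eq by simp
  show ?B
    unfolding chart_measure_def integral_distr[OF meas P]
    using integral_density[OF Pi dens nonneg] eq by simp
qed

section \<open>Transition maps and the volume density\<close>

context
  fixes A :: "('m::{t2_space, second_countable_topology}, 'n::finite) chart set"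
  assumes atlas: "oriented_atlas A"
begin

lemma atlas_chart: "c \<in> A \<Longrightarrow> is_chart c"
  using atlas unfolding oriented_atlas_def by blast

lemma atlas_cover: obtains c where "c \<in> A" "p \<in> dom c"
  using atlas unfolding oriented_atlas_def by blast

lemma in_transition_dom_iff:
  assumes "c \<in> A"
  shows "x \<in> transition_dom c c' \<longleftrightarrow> x \<in> ran c \<and> chart_inv c x \<in> dom c'"
  using in_coord_dom_iff[OF atlas_chart[OF assms], of x c' "\<lambda>p. p"] .

lemma open_transition_dom:
  assumes "c \<in> A" "c' \<in> A"
  shows "open (transition_dom c c')"
  by (intro open_coord_dom atlas_chart assms continuous_on_id)

lemma transition_inverse:
  assumes "c \<in> A" "c' \<in> A" "x \<in> transition_dom c c'"
  shows "transition c c' x \<in> transition_dom c' c" "transition c' c (transition c c' x) = x"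
  using assms chart_inv_chart[OF atlas_chart[OF assms(2)]] chart_chart_inv[of x c] chart_inv_in_dom[of x c]
  by (auto simp: in_transition_dom_iff coord_rep_def)

lemma transition_chart:
  assumes "c \<in> A" "p \<in> dom c" "p \<in> dom c'"
  shows "snd c p \<in> transition_dom c c'" "transition c c' (snd c p) = snd c' p"
  using assms chart_inv_chart[OF atlas_chart[OF assms(1)] assms(2)]
  by (auto simp: coord_dom_def coord_rep_def)

lemma transition_C2:
  assumes "c \<in> A" "c' \<in> A"
  shows "Ck_on 2 (transition c c') (transition_dom c c')"
  using atlas assms unfolding oriented_atlas_def smooth_on_def by blast

lemma transition_differentiable:
  assumes "c \<in> A" "c' \<in> A" "x \<in> transition_dom c c'"
  shows "transition c c' differentiable (at x)"
  using C1_on_imp_differentiable[OF Ck_on_2D(1)[OF open_transition_dom transition_C2]] assms by blast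

lemma transition_det_pos:
  assumes "c \<in> A" "c' \<in> A" "x \<in> transition_dom c c'"
  shows "det (jacobian (transition c c') (at x)) > 0"
  using atlas assms unfolding oriented_atlas_def by blast

lemma transition_jacobian_inverse:
  assumes "c \<in> A" "c' \<in> A" "x \<in> transition_dom c c'"
  shows "jacobian (transition c' c) (at (transition c c' x)) ** jacobian (transition c c') (at x) = mat 1"
proof -
  have "jacobian (transition c' c) (at (transition c c' x)) ** jacobian (transition c c') (at x) =
    jacobian (\<lambda>z. transition c' c (transition c c' z)) (at x)"
    using assms transition_inverse[OF assms]
    by (intro jacobian_compose[symmetric] transition_differentiable) auto
  also have "\<dots> = jacobian (\<lambda>z. z) (at x)"
    using assms transition_inverse by (intro jacobian_cong[OF open_transition_dom[OF assms(1,2)]]) auto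
  finally show ?thesis by (simp add: jacobian_ident)
qed

context
  fixes g :: "('m, 'n) metric"
  assumes metric: "riemannian_metric A g"
begin

lemma metric_C1:
  assumes "c \<in> A"
  shows "C1_on (\<lambda>x. g c x $ i $ j) (ran c)"
proof -
  have "Ck_on 1 (g c) (ran c)"
    using metric assms unfolding riemannian_metric_def smooth_on_def by blast
  then have "C1_on (g c) (ran c)"
    using C1_on_iff_Ck_on[OF chart_continuous(4)[OF atlas_chart[OF assms]]] by blast
  then show ?thesis by (intro C1_on_component)
qed

lemma metric_sym: "c \<in> A \<Longrightarrow> x \<in> ran c \<Longrightarrow> transpose (g c x) = g c x"
  using metric unfolding riemannian_metric_def by blast

lemma metric_det_pos: "c \<in> A \<Longrightarrow> x \<in> ran c \<Longrightarrow> det (g c x) > 0"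
  using metric unfolding riemannian_metric_def by (intro pos_def_det_pos) blast

text \<open>
  The metric changes by the Jacobian on both sides, and the Jacobian determinant equals its absolute
  value because the atlas is oriented.
\<close>

lemma volume_density_transition:
  assumes "c \<in> A" "c' \<in> A" "x \<in> transition_dom c c'"
  shows "sqrt (det (g c x)) = det (jacobian (transition c c') (at x)) * sqrt (det (g c' (transition c c' x)))"
proof -
  let ?J = "jacobian (transition c c') (at x)"
  have "g c x = transpose ?J ** g c' (transition c c' x) ** ?J"
    using metric assms unfolding riemannian_metric_def Let_def by blast
  then have "det (g c x) = (det ?J)\<^sup>2 * det (g c' (transition c c' x))"
    by (simp add: det_mul power2_eq_square)
  then show ?thesis
    using transition_det_pos[OF assms] by (simp add: real_sqrt_mult)
qed

end

end

section \<open>The Riemannian volume measure\<close>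

lemma volume_transition:
  fixes A :: "('m::{t2_space, second_countable_topology}, 'n::{finite,wellorder}) chart set"
  assumes atlas: "oriented_atlas A" and metric: "riemannian_metric A g"
    and c: "c \<in> A" "c' \<in> A" and B: "B \<in> sets borel" "B \<subseteq> dom c" "B \<subseteq> dom c'"
  shows "(\<integral>\<^sup>+x\<in>snd c ` B. ennreal (sqrt (det (g c x))) \<partial>lborel) = (\<integral>\<^sup>+x\<in>snd c' ` B. ennreal (sqrt (det (g c' x))) \<partial>lborel)"
proof -
  note charts = atlas_chart[OF atlas c(1)] atlas_chart[OF atlas c(2)]
  let ?S = "snd c ` B" and ?S' = "snd c' ` B"
  let ?T = "transition c c'" and ?R = "transition c' c"
  let ?T' = "\<lambda>x. (*v) (jacobian ?T (at x))" and ?R' = "\<lambda>x. (*v) (jacobian ?R (at x))"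
  have S: "?S \<subseteq> transition_dom c c'" "?S' \<subseteq> transition_dom c' c"
    using transition_chart(1)[OF atlas c(1)] transition_chart(1)[OF atlas c(2)] B by blast+
  have T: "?T x \<in> ?S' \<and> ?R (?T x) = x" if "x \<in> ?S" for x
  proof -
    from that obtain p where p: "p \<in> B" "x = snd c p" by blast
    then have "p \<in> dom c" "p \<in> dom c'" using B by auto
    with p show ?thesis
      by (simp add: transition_chart(2)[OF atlas c(1)] transition_chart(2)[OF atlas c(2)])
  qed
  have R: "?R y \<in> ?S \<and> ?T (?R y) = y" if "y \<in> ?S'" for y
  proof -
    from that obtain p where p: "p \<in> B" "y = snd c' p" by blast
    then have "p \<in> dom c" "p \<in> dom c'" using B by auto
    with p show ?thesis
      by (simp add: transition_chart(2)[OF atlas c(1)] transition_chart(2)[OF atlas c(2)])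
  qed
  have borel: "?S \<in> sets borel" "?S' \<in> sets borel"
    using borel_chart_image[OF charts(1) B(1,2)] borel_chart_image[OF charts(2) B(1,3)] by blast+
  have meas: "(\<lambda>y. indicator (snd b ` B) y * sqrt (det (g b y))) \<in> borel_measurable borel"
    if "b \<in> A" "B \<subseteq> dom b" for b
  proof -
    have "continuous_on (ran b) (\<lambda>y. sqrt (det (g b y)))"
      using C1_on_imp_continuous_on[OF C1_on_sqrt[OF C1_on_det[OF metric_C1[OF atlas metric that(1)]]]]
        metric_det_pos[OF atlas metric that(1)] by blast
    then have "continuous_on (snd b ` B) (\<lambda>y. sqrt (det (g b y)))"
      using that(2) by (auto intro: continuous_on_subset)
    from borel_measurable_continuous_on_indicator[OF borel_chart_image[OF atlas_chart[OF atlas that(1)] B(1) that(2)] this]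
    show ?thesis by simp
  qed
  have pull: "\<bar>det (matrix (?T' x))\<bar> * sqrt (det (g c' (?T x))) = sqrt (det (g c x))" if "x \<in> ?S" for x
  proof -
    have "x \<in> transition_dom c c'" using S that by blast
    from volume_density_transition[OF atlas metric c this] transition_det_pos[OF atlas c this]
    show ?thesis by simp
  qed
  have "(\<integral>\<^sup>+y\<in>?S'. ennreal (sqrt (det (g c' y))) \<partial>lborel) =
    (\<integral>\<^sup>+x\<in>?S. ennreal (\<bar>det (matrix (?T' x))\<bar> * sqrt (det (g c' (?T x)))) \<partial>lborel)"
  proof (rule nn_integral_change_of_variables[where R = ?R and R' = ?R'])
    show "(?T has_derivative ?T' x) (at x)" if "x \<in> ?S" for x
      using transition_differentiable[OF atlas c] S that jacobian_works by blast
    show "(?R has_derivative ?R' y) (at y)" if "y \<in> ?S'" for y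
      using transition_differentiable[OF atlas c(2) c(1)] S that jacobian_works by blast
    show "?R' y \<circ> ?T' (?R y) = id" if "y \<in> ?S'" for y
    proof -
      have "?R y \<in> transition_dom c c'" using R[OF that] S by blast
      from transition_jacobian_inverse[OF atlas c this] R[OF that]
      show ?thesis by (simp add: fun_eq_iff matrix_vector_mul_assoc)
    qed
    show "(\<lambda>x. indicator ?S x * (\<bar>det (matrix (?T' x))\<bar> * sqrt (det (g c' (?T x))))) \<in> borel_measurable borel"
    proof -
      have "(\<lambda>x. indicator ?S x * (\<bar>det (matrix (?T' x))\<bar> * sqrt (det (g c' (?T x))))) =
        (\<lambda>x. indicator ?S x * sqrt (det (g c x)))"
        using pull by (auto simp: fun_eq_iff indicator_def)
      then show ?thesis using meas[OF c(1) B(2)] by simp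
    qed
    show "0 \<le> sqrt (det (g c' y))" if "y \<in> ?S'" for y
    proof -
      have "y \<in> ran c'" using that B(3) by auto
      then show ?thesis using metric_det_pos[OF atlas metric c(2)] by (simp add: less_imp_le)
    qed
  qed (use borel T R meas c B in auto)
  also have "\<dots> = (\<integral>\<^sup>+x\<in>?S. ennreal (sqrt (det (g c x))) \<partial>lborel)"
  proof (rule nn_integral_cong)
    fix x
    show "ennreal (\<bar>det (matrix (?T' x))\<bar> * sqrt (det (g c' (?T x)))) * indicator ?S x =
      ennreal (sqrt (det (g c x))) * indicator ?S x"
    proof (cases "x \<in> ?S")
      case True
      show ?thesis unfolding pull[OF True] ..
    qed (simp add: indicator_def)
  qed
  finally show ?thesis by simp
qed

lemma suminf_swap_ennreal: "(\<Sum>i. \<Sum>j. f i j) = (\<Sum>j. \<Sum>i. (f i j :: ennreal))"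
proof -
  have "(\<Sum>i. \<Sum>j. f i j) = (\<Sum>i. \<integral>\<^sup>+j. f i j \<partial>count_space UNIV)"
    by (simp add: nn_integral_count_space_nat)
  also have "\<dots> = (\<integral>\<^sup>+j. (\<Sum>i. f i j) \<partial>count_space UNIV)"
    by (rule nn_integral_suminf[symmetric]) simp
  finally show ?thesis
    by (simp add: nn_integral_count_space_nat)
qed

text \<open>
  The volume is defined by description, so its properties rest on existence and uniqueness. By
  second countability the manifold is a disjoint union of countably many Borel sets \<open>D n\<close>, each
  contained in the domain of a chart \<open>c n\<close>. The required values on subsets of the \<open>D n\<close> determine the
  measure, and summing the chart measures over the \<open>D n\<close> defines one. It has the required value on
  the domain of any chart by \<open>volume_transition\<close>.
\<close>

lemma riemannian_volume:
  fixes A :: "('m::{t2_space, second_countable_topology}, 'n::{finite,wellorder}) chart set"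
  assumes atlas: "oriented_atlas A" and metric: "riemannian_metric A g"
  shows "sets (riemannian_volume A g) = sets borel"
    and "\<And>c B. c \<in> A \<Longrightarrow> B \<in> sets borel \<Longrightarrow> B \<subseteq> dom c \<Longrightarrow>
      emeasure (riemannian_volume A g) B = (\<integral>\<^sup>+x\<in>snd c ` B. ennreal (sqrt (det (g c x))) \<partial>lborel)"
proof -
  define is_volume where "is_volume \<mu> \<longleftrightarrow> sets \<mu> = sets borel \<and>
    (\<forall>c\<in>A. \<forall>B\<in>sets borel. B \<subseteq> dom c \<longrightarrow>
      emeasure \<mu> B = (\<integral>\<^sup>+x\<in>snd c ` B. ennreal (sqrt (det (g c x))) \<partial>lborel))" for \<mu>
  have open_dom: "open (dom c)" if "c \<in> A" for c
    using chart_continuous(3)[OF atlas_chart[OF atlas that]] .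
  have "openin (top_of_set UNIV) U" if "U \<in> fst ` A" for U
    using that open_dom by auto
  then obtain F where F: "F \<subseteq> fst ` A" "countable F" "\<Union>F = \<Union>(fst ` A)"
    by (rule Lindelof_openin)
  have cover: "\<Union>(fst ` A) = UNIV"
    using atlas unfolding oriented_atlas_def by auto
  then have "F \<noteq> {}"
    using F(3) by auto
  have "\<exists>c\<in>A. dom c = from_nat_into F n" for n
    using from_nat_into[OF \<open>F \<noteq> {}\<close>, of n] F(1) by blast
  then obtain c where c: "\<And>n. c n \<in> A" "\<And>n. dom (c n) = from_nat_into F n"
    by metis
  define D where "D = disjointed (\<lambda>n. dom (c n))"
  have UN_D: "(\<Union>n. D n) = UNIV"
    unfolding D_def UN_disjointed_eq c(2) using F cover range_from_nat_into[OF \<open>F \<noteq> {}\<close> F(2)] by simp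
  have D_sub: "D n \<subseteq> dom (c n)" for n
    unfolding D_def by (rule disjointed_subset)
  have disj: "disjoint_family D"
    unfolding D_def by (rule disjoint_family_disjointed)
  have D_borel: "D n \<in> sets borel" for n
  proof -
    have "range (\<lambda>n. dom (c n)) \<subseteq> sets borel"
      using borel_open[OF open_dom[OF c(1)]] by blast
    from sets.range_disjointed_sets[OF this] show ?thesis
      by (auto simp: D_def)
  qed
  have pieces: "emeasure \<mu> B = (\<Sum>n. emeasure \<mu> (B \<inter> D n))" if "sets \<mu> = sets borel" "B \<in> sets borel" for \<mu> :: "'m measure" and B
  proof -
    have "disjoint_family (\<lambda>n. B \<inter> D n)"
      using disj unfolding disjoint_family_on_def by blast
    then have "(\<Sum>n. emeasure \<mu> (B \<inter> D n)) = emeasure \<mu> (\<Union>n. B \<inter> D n)"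
      using that D_borel by (intro suminf_emeasure) auto
    also have "(\<Union>n. B \<inter> D n) = B"
      using UN_D by auto
    finally show ?thesis by simp
  qed
  define \<rho> where "\<rho> b x = sqrt (det (g b x))" for b x
  have \<rho>_cont: "continuous_on (ran b) (\<rho> b)" if "b \<in> A" for b
    unfolding \<rho>_def using C1_on_imp_continuous_on[OF C1_on_sqrt[OF C1_on_det[OF metric_C1[OF atlas metric that]]]]
        metric_det_pos[OF atlas metric that] by blast
  have chart_em: "emeasure (chart_measure b (\<rho> b)) B = (\<integral>\<^sup>+x\<in>snd b ` B. ennreal (\<rho> b x) \<partial>lborel)"
    if "b \<in> A" "B \<in> sets borel" "B \<subseteq> dom b" for b B
    using emeasure_chart_measure[OF atlas_chart[OF atlas that(1)] \<rho>_cont[OF that(1)] that(2)] that(3)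
    by (simp add: Int_absorb2)
  define \<mu>0 where "\<mu>0 B = (\<Sum>n. emeasure (chart_measure (c n) (\<rho> (c n))) (B \<inter> D n))" for B
  define \<mu> where "\<mu> = measure_of UNIV (sets borel) \<mu>0"
  have sets_\<mu>: "sets \<mu> = sets borel"
    unfolding \<mu>_def by (simp add: sigma_algebra.sigma_sets_eq sets.sigma_algebra_axioms[of "borel :: 'm measure", simplified])
  have em_\<mu>: "emeasure \<mu> B = \<mu>0 B" if "B \<in> sets borel" for B
    unfolding \<mu>_def
  proof (rule emeasure_measure_of_sigma)
    show "sigma_algebra UNIV (sets (borel :: 'm measure))"
      using sets.sigma_algebra_axioms[of "borel :: 'm measure"] by (simp only: space_borel)
    show "positive (sets borel) \<mu>0"
      by (simp add: positive_def \<mu>0_def)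
    show "countably_additive (sets borel) \<mu>0"
    proof (rule countably_additiveI)
      fix E :: "nat \<Rightarrow> 'm set" assume E: "range E \<subseteq> sets borel" "disjoint_family E" "(\<Union>i. E i) \<in> sets borel"
      have "(\<Sum>i. \<mu>0 (E i)) = (\<Sum>n. \<Sum>i. emeasure (chart_measure (c n) (\<rho> (c n))) (E i \<inter> D n))"
        unfolding \<mu>0_def by (rule suminf_swap_ennreal)
      also have "\<dots> = (\<Sum>n. emeasure (chart_measure (c n) (\<rho> (c n))) (\<Union>i. E i \<inter> D n))"
      proof (intro suminf_cong suminf_emeasure)
        show "disjoint_family (\<lambda>i. E i \<inter> D n)" for n
          using E(2) unfolding disjoint_family_on_def by blast
      qed (use E D_borel in auto)
      also have "\<dots> = \<mu>0 (\<Union>i. E i)"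
        by (simp add: \<mu>0_def)
      finally show "(\<Sum>i. \<mu>0 (E i)) = \<mu>0 (\<Union>i. E i)" .
    qed
  qed (use that in auto)
  have "is_volume \<mu>"
    unfolding is_volume_def
  proof (intro conjI ballI impI sets_\<mu>)
    fix b B assume b: "b \<in> A" and B: "B \<in> sets borel" "B \<subseteq> dom b"
    have "emeasure (chart_measure (c n) (\<rho> (c n))) (B \<inter> D n) = emeasure (chart_measure b (\<rho> b)) (B \<inter> D n)" for n
    proof -
      have BD: "B \<inter> D n \<in> sets borel" "B \<inter> D n \<subseteq> dom (c n)" "B \<inter> D n \<subseteq> dom b"
        using B D_borel D_sub by auto
      show ?thesis
        unfolding chart_em[OF c(1) BD(1,2)] chart_em[OF b BD(1,3)] \<rho>_def
        by (rule volume_transition[OF atlas metric c(1) b BD])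
    qed
    then have "emeasure \<mu> B = emeasure (chart_measure b (\<rho> b)) B"
      using em_\<mu>[OF B(1)] pieces[OF sets_chart_measure[of b "\<rho> b"] B(1)] by (simp add: \<mu>0_def)
    then show "emeasure \<mu> B = (\<integral>\<^sup>+x\<in>snd b ` B. ennreal (sqrt (det (g b x))) \<partial>lborel)"
      using chart_em[OF b B] by (simp add: \<rho>_def)
  qed
  moreover have "\<nu> = \<mu>" if "is_volume \<nu>" for \<nu>
  proof (rule measure_eqI)
    have \<nu>: "sets \<nu> = sets borel" using that by (simp add: is_volume_def)
    then show "sets \<nu> = sets \<mu>" by (simp add: sets_\<mu>)
    fix B assume "B \<in> sets \<nu>"
    then have B: "B \<in> sets borel" by (simp add: \<nu>)
    have "emeasure \<nu> (B \<inter> D n) = emeasure \<mu> (B \<inter> D n)" for n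
    proof -
      have "B \<inter> D n \<in> sets borel" "B \<inter> D n \<subseteq> dom (c n)"
        using B D_borel[of n] D_sub[of n] by auto
      then show ?thesis
        using that \<open>is_volume \<mu>\<close> c(1)[of n] unfolding is_volume_def by simp
    qed
    then show "emeasure \<nu> B = emeasure \<mu> B"
      unfolding pieces[OF \<nu> B] pieces[OF sets_\<mu> B] by simp
  qed
  ultimately have "is_volume (THE \<mu>. is_volume \<mu>)"
    by (rule theI)
  then have "is_volume (riemannian_volume A g)"
    unfolding riemannian_volume_def is_volume_def .
  then show "sets (riemannian_volume A g) = sets borel"
    "\<And>c B. c \<in> A \<Longrightarrow> B \<in> sets borel \<Longrightarrow> B \<subseteq> dom c \<Longrightarrow>
      emeasure (riemannian_volume A g) B = (\<integral>\<^sup>+x\<in>snd c ` B. ennreal (sqrt (det (g c x))) \<partial>lborel)"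
    unfolding is_volume_def by blast+
qed

text \<open>
  Restricted to the domain of a chart, the volume is a chart measure.
\<close>

lemma integral_riemannian_volume_chart:
  fixes A :: "('m::{t2_space, second_countable_topology}, 'n::{finite,wellorder}) chart set"
    and P :: "'m \<Rightarrow> real"
  assumes atlas: "oriented_atlas A" and metric: "riemannian_metric A g" and c: "c \<in> A"
    and P: "P \<in> borel_measurable borel" "\<And>p. p \<notin> dom c \<Longrightarrow> P p = 0"
  shows "integrable (riemannian_volume A g) P \<longleftrightarrow>
      integrable lborel (\<lambda>x. indicator (ran c) x * (sqrt (det (g c x)) * P (chart_inv c x)))" (is ?I)
    and "integral\<^sup>L (riemannian_volume A g) P =
      (LINT x|lborel. indicator (ran c) x * (sqrt (det (g c x)) * P (chart_inv c x)))" (is ?E)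
proof -
  let ?V = "riemannian_volume A g" and ?\<rho> = "\<lambda>x. sqrt (det (g c x))"
  note V = riemannian_volume[OF atlas metric]
  have chart: "is_chart c" by (rule atlas_chart[OF atlas c])
  have dom: "dom c \<in> sets borel"
    using chart_continuous(3)[OF chart] by simp
  have \<rho>: "continuous_on (ran c) ?\<rho>"
    using C1_on_imp_continuous_on[OF C1_on_sqrt[OF C1_on_det[OF metric_C1[OF atlas metric c]]]]
        metric_det_pos[OF atlas metric c] by blast
  have \<rho>_nonneg: "?\<rho> x \<ge> 0" if "x \<in> ran c" for x
    using metric_det_pos[OF atlas metric c that] by simp
  have ind: "(indicator (dom c) :: 'm \<Rightarrow> real) \<in> borel_measurable ?V"
    using dom V(1) by (intro borel_measurable_indicator) simp
  have "density ?V (\<lambda>p. ennreal (indicator (dom c) p)) = chart_measure c ?\<rho>"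
  proof (rule measure_eqI)
    show "sets (density ?V (\<lambda>p. ennreal (indicator (dom c) p))) = sets (chart_measure c ?\<rho>)"
      using V(1) by simp
    fix B assume "B \<in> sets (density ?V (\<lambda>p. ennreal (indicator (dom c) p)))"
    then have B: "B \<in> sets ?V" "B \<in> sets borel" using V(1) by simp_all
    have "emeasure (density ?V (\<lambda>p. ennreal (indicator (dom c) p))) B = emeasure ?V (dom c \<inter> B)"
      using dom V(1) B by (simp add: ennreal_indicator emeasure_restricted)
    also have "dom c \<inter> B = B \<inter> dom c"
      by blast
    also have "emeasure ?V (B \<inter> dom c) = emeasure (chart_measure c ?\<rho>) B"
      unfolding emeasure_chart_measure[OF chart \<rho> B(2)]
      using B dom by (intro V(2)[OF c]) auto
    finally show "emeasure (density ?V (\<lambda>p. ennreal (indicator (dom c) p))) B = emeasure (chart_measure c ?\<rho>) B" .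
  qed
  moreover have "(\<lambda>p. indicator (dom c) p *\<^sub>R P p) = P"
    using P(2) by (auto simp: fun_eq_iff indicator_def)
  moreover have "P \<in> borel_measurable ?V"
    using P(1) measurable_cong_sets[OF V(1) refl] by blast
  ultimately have "integrable ?V P = integrable (chart_measure c ?\<rho>) P" "integral\<^sup>L ?V P = integral\<^sup>L (chart_measure c ?\<rho>) P"
    using integrable_density[of P ?V "indicator (dom c)"] integral_density[of P ?V "indicator (dom c)"] ind by auto
  then show ?I ?E
    using integral_chart_measure[OF chart \<rho> \<rho>_nonneg P(1)] by simp_all
qed

section \<open>Divergence theorem for vector densities\<close>

text \<open>
  A \<open>C\<^sup>1\<close> vector field multiplied by the volume density, given by its components in each chart. Under
  a change of chart \<open>T\<close> vectors are pulled back by the inverse of \<open>dT\<close> and densities by \<open>det dT\<close>;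
  together this is the transposed cofactor.
\<close>

definition vector_density :: "('m, 'n::finite) chart set \<Rightarrow> (('m, 'n) chart \<Rightarrow> real^'n \<Rightarrow> real^'n) \<Rightarrow> bool"
  where "vector_density A W \<longleftrightarrow> (\<forall>c\<in>A. C1_on (W c) (ran c)) \<and>
    (\<forall>c\<in>A. \<forall>c'\<in>A. \<forall>x\<in>transition_dom c c'.
      W c x = transpose (cof (jacobian (transition c c') (at x))) *v W c' (transition c c' x))"

text \<open>
  The function whose product with the volume density is the coordinate divergence; it does not depend
  on the chart (see \<open>density_div_eq\<close>).
\<close>

definition density_div ::
  "('m, 'n::finite) chart set \<Rightarrow> ('m, 'n) metric \<Rightarrow> (('m, 'n) chart \<Rightarrow> real^'n \<Rightarrow> real^'n) \<Rightarrow> 'm \<Rightarrow> real"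
  where "density_div A g W p = (let c = (SOME c. c \<in> A \<and> p \<in> dom c)
    in divergence (W c) (snd c p) / sqrt (det (g c (snd c p))))"

context
  fixes A :: "('m::{t2_space, second_countable_topology}, 'n::{finite,wellorder}) chart set"
    and g :: "('m, 'n) metric"
  assumes atlas: "oriented_atlas A" and metric: "riemannian_metric A g"
begin

lemma density_div_eq:
  assumes W: "vector_density A W" and c: "c \<in> A" "p \<in> dom c"
  shows "density_div A g W p = divergence (W c) (snd c p) / sqrt (det (g c (snd c p)))"
proof -
  define b where "b = (SOME c. c \<in> A \<and> p \<in> dom c)"
  have b: "b \<in> A" "p \<in> dom b"
    using someI[of "\<lambda>c. c \<in> A \<and> p \<in> dom c" c] c unfolding b_def by blast+
  let ?T = "transition c b" and ?x = "snd c p"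
  have x: "?x \<in> transition_dom c b" and Tx: "?T ?x = snd b p"
    using transition_chart[OF atlas c b(2)] .
  note dom = open_transition_dom[OF atlas c(1) b(1)]
  have "W b differentiable (at (?T ?x))"
    unfolding Tx using W b by (intro C1_on_imp_differentiable[of _ "ran b"]) (auto simp: vector_density_def)
  then have "divergence (\<lambda>z. transpose (cof (jacobian ?T (at z))) *v W b (?T z)) ?x =
    det (jacobian ?T (at ?x)) * divergence (W b) (?T ?x)"
    by (rule divergence_piola_transform[OF dom x transition_C2[OF atlas c(1) b(1)]])
  moreover have "divergence (W c) ?x = divergence (\<lambda>z. transpose (cof (jacobian ?T (at z))) *v W b (?T z)) ?x"
    using W c b unfolding vector_density_def by (intro divergence_cong[OF dom x]) blast
  ultimately have "divergence (W c) ?x = det (jacobian ?T (at ?x)) * divergence (W b) (snd b p)"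
    by (simp only: Tx)
  then show ?thesis
    unfolding density_div_def b_def[symmetric] Let_def
    using volume_density_transition[OF atlas metric c(1) b(1) x] transition_det_pos[OF atlas c(1) b(1) x]
    by (simp add: Tx)
qed

lemma density_div_eq_0:
  assumes W: "vector_density A W" and K: "closed K" "p \<notin> K"
    and zero: "\<And>c p. c \<in> A \<Longrightarrow> p \<in> dom c \<Longrightarrow> p \<notin> K \<Longrightarrow> W c (snd c p) = 0"
  shows "density_div A g W p = 0"
proof -
  obtain c where c: "c \<in> A" "p \<in> dom c" using atlas_cover[OF atlas] .
  note chart = atlas_chart[OF atlas c(1)]
  let ?U = "snd c ` (dom c - K)"
  have "open ?U"
    using chart_continuous(3)[OF chart] K(1) by (intro open_chart_image[OF chart]) auto
  then have "divergence (W c) (snd c p) = divergence (\<lambda>_. 0) (snd c p)"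
    using c K(2) zero[OF c(1)] by (intro divergence_cong[of ?U]) auto
  also have "\<dots> = 0"
    by (simp add: divergence_def partial_eqI[OF has_derivative_const])
  finally show ?thesis
    by (simp add: density_div_eq[OF W c])
qed

text \<open>
  If the support lies in the domain of one chart, the components in this chart extend by zero to
  coordinate space.
\<close>

lemma divergence_theorem_chart:
  assumes W: "vector_density A W" and c: "c \<in> A" and K: "compact K" "K \<subseteq> dom c"
    and zero: "\<And>c p. c \<in> A \<Longrightarrow> p \<in> dom c \<Longrightarrow> p \<notin> K \<Longrightarrow> W c (snd c p) = 0"
  shows "integrable (riemannian_volume A g) (density_div A g W)"
    and "integral\<^sup>L (riemannian_volume A g) (density_div A g W) = 0"
proof -
  note chart = atlas_chart[OF atlas c]
  let ?P = "density_div A g W"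
  have P0: "?P p = 0" if "p \<notin> K" for p
    by (rule density_div_eq_0[OF W compact_imp_closed[OF K(1)] that zero])
  have Wc: "C1_on (W c) (ran c)"
    using W c by (simp add: vector_density_def)
  define W0 where "W0 x = (if x \<in> ran c then W c x else 0)" for x
  have K': "compact (snd c ` K)"
    using chart_continuous(1)[OF chart] K by (intro compact_continuous_image) (auto intro: continuous_on_subset)
  have W0_zero: "W0 x = 0" if "x \<notin> snd c ` K" for x
    using that zero[OF c] by (auto simp: W0_def)
  have "C1_on W0 UNIV"
  proof (rule C1_on_local)
    fix x
    show "\<exists>U. open U \<and> x \<in> U \<and> C1_on W0 U"
    proof (cases "x \<in> ran c")
      case True
      have "C1_on W0 (ran c)"
        by (rule C1_on_cong[OF chart_continuous(4)[OF chart] _ Wc]) (simp add: W0_def)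
      with True show ?thesis using chart_continuous(4)[OF chart] by blast
    next
      case False
      have U: "open (- (snd c ` K))"
        using compact_imp_closed[OF K'] by blast
      have "C1_on W0 (- (snd c ` K))"
        by (rule C1_on_cong[OF U _ C1_on_const[of 0]]) (simp add: W0_zero)
      with False U K(2) show ?thesis by blast
    qed
  qed
  note int = integral_divergence_compact_support[OF this K' W0_zero]
  have eq: "(\<lambda>x. indicator (ran c) x * (sqrt (det (g c x)) * ?P (chart_inv c x))) = divergence W0"
  proof
    fix x
    show "indicator (ran c) x * (sqrt (det (g c x)) * ?P (chart_inv c x)) = divergence W0 x"
    proof (cases "x \<in> ran c")
      case True
      have "?P (chart_inv c x) = divergence (W c) x / sqrt (det (g c x))"
        using density_div_eq[OF W c chart_inv_in_dom[OF True]] chart_chart_inv[OF True] by simp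
      moreover have "divergence W0 x = divergence (W c) x"
        by (rule divergence_cong[OF chart_continuous(4)[OF chart] True]) (simp add: W0_def)
      moreover have "indicator (ran c) x = (1 :: real)"
        using True by (rule indicator_simps)
      ultimately show ?thesis
        using metric_det_pos[OF atlas metric c True] by simp
    next
      case False
      have "divergence W0 x = divergence (\<lambda>_. 0) x"
        using compact_imp_closed[OF K'] False K(2) W0_zero
        by (intro divergence_cong[of "- (snd c ` K)"]) auto
      then have "divergence W0 x = 0"
        by (simp add: divergence_def partial_eqI[OF has_derivative_const])
      moreover have "indicator (ran c) x = (0 :: real)"
        using False by (rule indicator_simps)
      ultimately show ?thesis by simp
    qed
  qed
  have meas: "?P \<in> borel_measurable borel"
  proof -
    have "continuous_on (ran c) (divergence (W c))"
      unfolding divergence_def[abs_def]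
      by (intro continuous_on_sum C1_on_partial_continuous chart_continuous(4)[OF chart] C1_on_component Wc)
    moreover have "continuous_on (ran c) (\<lambda>x. sqrt (det (g c x)))"
      using C1_on_imp_continuous_on[OF C1_on_sqrt[OF C1_on_det[OF metric_C1[OF atlas metric c]]]]
        metric_det_pos[OF atlas metric c] by blast
    ultimately have "continuous_on (ran c) (\<lambda>x. divergence (W c) x / sqrt (det (g c x)))"
      using metric_det_pos[OF atlas metric c] by (intro continuous_on_divide ballI) (force simp: less_le)+
    from continuous_on_compose2[OF this chart_continuous(1)[OF chart] subset_refl]
    have "continuous_on (dom c) ?P"
      by (rule continuous_on_eq) (simp add: density_div_eq[OF W c])
    then have "(\<lambda>p. if p \<in> dom c then ?P p else 0) \<in> borel_measurable borel"
      using chart_continuous(3)[OF chart] by (intro borel_measurable_continuous_on_if continuous_on_const) auto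
    moreover have "(\<lambda>p. if p \<in> dom c then ?P p else 0) = ?P"
      using P0 K(2) by (auto simp: fun_eq_iff)
    ultimately show ?thesis by simp
  qed
  have off: "?P p = 0" if "p \<notin> dom c" for p
    using that P0 K(2) by blast
  show "integrable (riemannian_volume A g) ?P" "integral\<^sup>L (riemannian_volume A g) ?P = 0"
    using integral_riemannian_volume_chart[OF atlas metric c meas off] int unfolding eq by simp_all
qed

text \<open>
  A bump function transported from a chart and extended by zero. Near a point outside the domain of
  the chart it vanishes, because the compact set that carries it is closed in a Hausdorff space.
\<close>

lemma chart_ball_bump:
  assumes c: "c \<in> A" and r: "0 < r" "cball a (2 * r) \<subseteq> ran c"
  obtains \<beta> :: "'m \<Rightarrow> real" where "\<And>b. b \<in> A \<Longrightarrow> C1_on (\<lambda>x. \<beta> (chart_inv b x)) (ran b)"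
    "\<And>p. p \<in> dom c \<Longrightarrow> dist a (snd c p) < r \<Longrightarrow> \<beta> p = 1"
    "\<And>p. p \<notin> chart_inv c ` cball a (2 * r) \<Longrightarrow> \<beta> p = 0"
proof -
  note chart = atlas_chart[OF atlas c]
  obtain u :: "real^'n::_ \<Rightarrow> real" where u: "C1_on u UNIV" "\<And>x. dist a x \<le> r \<Longrightarrow> u x = 1"
    "\<And>x. 2 * r \<le> dist a x \<Longrightarrow> u x = 0"
    using C1_bump_function[of r "2 * r" a] r by auto
  define \<beta> where "\<beta> p = (if p \<in> dom c then u (snd c p) else 0)" for p
  let ?K = "chart_inv c ` cball a (2 * r)"
  have \<beta>0: "\<beta> p = 0" if "p \<notin> ?K" for p
  proof (cases "p \<in> dom c")
    case True
    have "snd c p \<notin> cball a (2 * r)"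
      using that chart_inv_chart[OF chart True] by (metis image_eqI)
    then show ?thesis using u(3) by (simp add: \<beta>_def)
  qed (simp add: \<beta>_def)
  have "compact ?K"
    using chart_continuous(2)[OF chart] r(2) by (intro compact_continuous_image) (auto intro: continuous_on_subset)
  then have K: "closed ?K" by (rule compact_imp_closed)
  have K_sub: "?K \<subseteq> dom c"
    using r(2) by (intro image_subsetI chart_inv_in_dom) (rule subsetD)
  show thesis
  proof
    fix b assume b: "b \<in> A"
    note chart_b = atlas_chart[OF atlas b]
    show "C1_on (\<lambda>x. \<beta> (chart_inv b x)) (ran b)"
    proof (rule C1_on_local)
      fix x assume x: "x \<in> ran b"
      show "\<exists>U. open U \<and> x \<in> U \<and> C1_on (\<lambda>x. \<beta> (chart_inv b x)) U"
      proof (cases "chart_inv b x \<in> dom c")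
        case True
        let ?U = "transition_dom b c"
        have U: "open ?U" by (rule open_transition_dom[OF atlas b c])
        have c1: "C1_on (\<lambda>z. u (transition b c z)) ?U"
          by (rule C1_on_compose[OF u(1) Ck_on_2D(1)[OF U transition_C2[OF atlas b c]]]) simp
        have eq: "u (transition b c z) = \<beta> (chart_inv b z)" if "z \<in> ?U" for z
          using that in_transition_dom_iff[OF atlas b] by (simp add: \<beta>_def coord_rep_def)
        have "C1_on (\<lambda>x. \<beta> (chart_inv b x)) ?U"
          by (rule C1_on_cong[OF U eq c1])
        moreover have "x \<in> ?U"
          using True x in_transition_dom_iff[OF atlas b] by blast
        ultimately show ?thesis using U by blast
      next
        case False
        let ?U = "snd b ` (dom b - ?K)"
        have U: "open ?U"
          using chart_continuous(3)[OF chart_b] K by (intro open_chart_image[OF chart_b]) auto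
        have "C1_on (\<lambda>x. \<beta> (chart_inv b x)) ?U"
        proof (rule C1_on_cong[OF U _ C1_on_const[of 0]])
          fix z assume "z \<in> ?U"
          then obtain p where "p \<in> dom b" "p \<notin> ?K" "z = snd b p" by blast
          then show "0 = \<beta> (chart_inv b z)"
            by (simp add: chart_inv_chart[OF chart_b] \<beta>0)
        qed
        moreover have "x \<in> ?U"
          using False K_sub chart_inv_in_dom[OF x] chart_chart_inv[OF x]
          by (intro image_eqI[of _ _ "chart_inv b x"]) auto
        ultimately show ?thesis using U by blast
      qed
    qed
  qed (use u \<beta>0 in \<open>auto simp: \<beta>_def\<close>)
qed

lemma vector_density_scale:
  assumes W: "vector_density A W" and \<beta>: "\<And>b. b \<in> A \<Longrightarrow> C1_on (\<lambda>x. \<beta> (chart_inv b x)) (ran b)"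
  shows "vector_density A (\<lambda>b x. \<beta> (chart_inv b x) *\<^sub>R W b x)"
  unfolding vector_density_def
proof (intro conjI ballI)
  fix c assume c: "c \<in> A"
  show "C1_on (\<lambda>x. \<beta> (chart_inv c x) *\<^sub>R W c x) (ran c)"
    using W c \<beta> by (intro C1_on_scaleR) (auto simp: vector_density_def)
  fix c' x assume c': "c' \<in> A" and x: "x \<in> transition_dom c c'"
  have "chart_inv c' (transition c c' x) = chart_inv c x"
    using x chart_inv_chart[OF atlas_chart[OF atlas c']] in_transition_dom_iff[OF atlas c]
    by (simp add: coord_rep_def)
  moreover have "W c x = transpose (cof (jacobian (transition c c') (at x))) *v W c' (transition c c' x)"
    using W c c' x unfolding vector_density_def by blast
  ultimately show "\<beta> (chart_inv c x) *\<^sub>R W c x = transpose (cof (jacobian (transition c c') (at x))) *v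
    (\<beta> (chart_inv c' (transition c c' x)) *\<^sub>R W c' (transition c c' x))"
    by (simp add: matrix_vector_mult_scaleR)
qed

text \<open>
  Induction on the number of coordinate balls that cover the support: if \<open>\<beta>\<close> is \<open>1\<close> on one of the
  balls, then \<open>\<beta> W\<close> is supported in a chart, and the other balls suffice to cover the support of
  \<open>(1 - \<beta>) W\<close>. This takes the place of a partition of unity. The balls of twice the radius leave room for
  \<open>\<beta>\<close> to decay.
\<close>

lemma divergence_theorem_cover:
  assumes "finite I" "\<And>c a r. (c, a, r) \<in> I \<Longrightarrow> c \<in> A \<and> 0 < r \<and> cball a (2 * r) \<subseteq> ran c"
    and "vector_density A W" "compact K" "K \<subseteq> (\<Union>(c, a, r)\<in>I. {p \<in> dom c. dist a (snd c p) < r})"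
    and "\<And>c p. c \<in> A \<Longrightarrow> p \<in> dom c \<Longrightarrow> p \<notin> K \<Longrightarrow> W c (snd c p) = 0"
  shows "integrable (riemannian_volume A g) (density_div A g W) \<and>
    integral\<^sup>L (riemannian_volume A g) (density_div A g W) = 0"
  using assms
proof (induction I arbitrary: W K rule: finite_induct)
  case empty
  have "density_div A g W = (\<lambda>_. 0)"
    using empty by (intro ext density_div_eq_0[where K = K]) auto
  then show ?case by simp
next
  case (insert i I)
  obtain c a r where i: "i = (c, a, r)" by (rule prod_cases3)
  have c: "c \<in> A" and r: "0 < r" "cball a (2 * r) \<subseteq> ran c"
    using insert.prems(1)[of c a r] i by auto
  note W = insert.prems(2)
  note chart = atlas_chart[OF atlas c]
  obtain \<beta> :: "'m \<Rightarrow> real" where \<beta>: "\<And>b. b \<in> A \<Longrightarrow> C1_on (\<lambda>x. \<beta> (chart_inv b x)) (ran b)"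
    "\<And>p. p \<in> dom c \<Longrightarrow> dist a (snd c p) < r \<Longrightarrow> \<beta> p = 1"
    "\<And>p. p \<notin> chart_inv c ` cball a (2 * r) \<Longrightarrow> \<beta> p = 0"
    using chart_ball_bump[OF c r] by blast
  define W1 where "W1 b x = \<beta> (chart_inv b x) *\<^sub>R W b x" for b x
  define W2 where "W2 b x = (1 - \<beta> (chart_inv b x)) *\<^sub>R W b x" for b x
  have W1: "vector_density A W1"
    unfolding W1_def using \<beta>(1) by (intro vector_density_scale[OF W])
  have W2: "vector_density A W2"
    unfolding W2_def using \<beta>(1) by (intro vector_density_scale[OF W, of "\<lambda>p. 1 - \<beta> p"] C1_on_diff C1_on_const)
  let ?N = "{p \<in> dom c. dist a (snd c p) < r}"
  have "open ?N"
  proof -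
    have "continuous_on (dom c) (\<lambda>p. dist a (snd c p))"
      using chart_continuous(1)[OF chart] by (intro continuous_intros)
    then have "open (dom c \<inter> (\<lambda>p. dist a (snd c p)) -` {..<r})"
      using chart_continuous(3)[OF chart] by (intro continuous_open_preimage) auto
    moreover have "dom c \<inter> (\<lambda>p. dist a (snd c p)) -` {..<r} = ?N"
      by auto
    ultimately show ?thesis by simp
  qed
  then have K2: "compact (K - ?N)"
    using insert.prems(3) by (intro compact_diff)
  have int2: "integrable (riemannian_volume A g) (density_div A g W2) \<and>
    integral\<^sup>L (riemannian_volume A g) (density_div A g W2) = 0"
  proof (rule insert.IH[OF _ W2 K2])
    show "K - ?N \<subseteq> (\<Union>(c, a, r)\<in>I. {p \<in> dom c. dist a (snd c p) < r})"
      using insert.prems(4) unfolding i by auto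
    show "c \<in> A \<and> 0 < r \<and> cball a (2 * r) \<subseteq> ran c" if "(c, a, r) \<in> I" for c a r
      using insert.prems(1) that by blast
    show "W2 b (snd b p) = 0" if "b \<in> A" "p \<in> dom b" "p \<notin> K - ?N" for b p
      using insert.prems(5)[OF that(1,2)] \<beta>(2)[of p] that(3) chart_inv_chart[OF atlas_chart[OF atlas that(1)] that(2)]
      by (auto simp: W2_def)
  qed
  have K1: "compact (chart_inv c ` cball a (2 * r))"
    using chart_continuous(2)[OF chart] r(2) by (intro compact_continuous_image) (auto intro: continuous_on_subset)
  have K1_sub: "chart_inv c ` cball a (2 * r) \<subseteq> dom c"
    using r(2) by (intro image_subsetI chart_inv_in_dom) (rule subsetD)
  have "W1 b (snd b p) = 0" if "b \<in> A" "p \<in> dom b" "p \<notin> chart_inv c ` cball a (2 * r)" for b p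
    using \<beta>(3)[OF that(3)] chart_inv_chart[OF atlas_chart[OF atlas that(1)] that(2)] by (simp add: W1_def)
  note int1 = divergence_theorem_chart[OF W1 c K1 K1_sub this]
  have "density_div A g W p = density_div A g W1 p + density_div A g W2 p" for p
  proof -
    obtain b where b: "b \<in> A" "p \<in> dom b" using atlas_cover[OF atlas] .
    have "W b = (\<lambda>z. W1 b z + W2 b z)"
      by (simp add: W1_def W2_def fun_eq_iff scaleR_left_diff_distrib)
    moreover have "W1 b differentiable (at (snd b p))" "W2 b differentiable (at (snd b p))"
      using W1 W2 b by (auto simp: vector_density_def intro!: C1_on_imp_differentiable[of _ "ran b"])
    ultimately have "divergence (W b) (snd b p) = divergence (W1 b) (snd b p) + divergence (W2 b) (snd b p)"
      using divergence_add by simp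
    then show ?thesis
      by (simp add: density_div_eq[OF _ b] W W1 W2 add_divide_distrib)
  qed
  then have "density_div A g W = (\<lambda>p. density_div A g W1 p + density_div A g W2 p)"
    by (rule ext)
  then show ?case
    using int1 int2 by simp
qed

lemma divergence_theorem:
  assumes W: "vector_density A W" and K: "compact K"
    and zero: "\<And>c p. c \<in> A \<Longrightarrow> p \<in> dom c \<Longrightarrow> p \<notin> K \<Longrightarrow> W c (snd c p) = 0"
  shows "integral\<^sup>L (riemannian_volume A g) (density_div A g W) = 0"
proof -
  define good where "good = {(c, a, r). c \<in> A \<and> 0 < r \<and> cball a (2 * r) \<subseteq> ran c}"
  define N where "N i = (case i of (c, a, r) \<Rightarrow> {p \<in> dom c. dist a (snd c p) < r})"
    for i :: "('m, 'n) chart \<times> (real^'n::_) \<times> real"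
  have "open (N i)" if "i \<in> good" for i
  proof -
    obtain c a r where i: "i = (c, a, r)" by (rule prod_cases3)
    have c: "is_chart c" using that i atlas_chart[OF atlas] by (auto simp: good_def)
    have "continuous_on (dom c) (\<lambda>p. dist a (snd c p))"
      using chart_continuous(1)[OF c] by (intro continuous_intros)
    then have "open (dom c \<inter> (\<lambda>p. dist a (snd c p)) -` {..<r})"
      using chart_continuous(3)[OF c] by (intro continuous_open_preimage) auto
    moreover have "dom c \<inter> (\<lambda>p. dist a (snd c p)) -` {..<r} = N i"
      by (auto simp: N_def i)
    ultimately show ?thesis by simp
  qed
  moreover have "K \<subseteq> (\<Union>i\<in>good. N i)"
  proof
    fix p assume "p \<in> K"
    obtain c where c: "c \<in> A" "p \<in> dom c" using atlas_cover[OF atlas] .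
    obtain e where e: "0 < e" "cball (snd c p) e \<subseteq> ran c"
      using chart_continuous(4)[OF atlas_chart[OF atlas c(1)]] c(2) open_contains_cball by (metis imageI)
    then have "(c, snd c p, e / 2) \<in> good" "p \<in> N (c, snd c p, e / 2)"
      using c by (auto simp: good_def N_def)
    then show "p \<in> (\<Union>i\<in>good. N i)" by blast
  qed
  ultimately obtain I where I: "I \<subseteq> good" "finite I" "K \<subseteq> (\<Union>i\<in>I. N i)"
    by (rule compactE_image[OF K])
  show ?thesis
    using divergence_theorem_cover[OF I(2) _ W K _ zero] I(1,3) unfolding good_def N_def by blast
qed

end

section \<open>The Riemannian Piola identity\<close>

definition flux_in ::
  "('m2, 'n::finite) metric \<Rightarrow> ('m1 \<Rightarrow> 'm2) \<Rightarrow> ('m1, 'm2, 'n) pullback_field \<Rightarrow>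
   ('m1, 'n) chart \<Rightarrow> ('m2, 'n) chart \<Rightarrow> real^'n \<Rightarrow> real^'n"
  where "flux_in h f \<xi> c1 c2 = flux (h c2) (coord_rep c1 c2 f) (\<lambda>x. \<xi> c2 (chart_inv c1 x))"

text \<open>
  Any chart around the image point will do (see \<open>flux_density_eq\<close>).
\<close>

definition flux_density ::
  "('m2, 'n::finite) chart set \<Rightarrow> ('m2, 'n) metric \<Rightarrow> ('m1 \<Rightarrow> 'm2) \<Rightarrow> ('m1, 'm2, 'n) pullback_field \<Rightarrow>
   ('m1, 'n) chart \<Rightarrow> real^'n \<Rightarrow> real^'n"
  where "flux_density A2 h f \<xi> c x =
    flux_in h f \<xi> c (SOME c2. c2 \<in> A2 \<and> f (chart_inv c x) \<in> dom c2) x"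

context
  fixes A1 :: "('m1::{t2_space, second_countable_topology}, 'n::{finite,wellorder}) chart set"
    and g :: "('m1, 'n) metric"
    and A2 :: "('m2::{t2_space, second_countable_topology}, 'n) chart set"
    and h :: "('m2, 'n) metric"
    and f :: "'m1 \<Rightarrow> 'm2"
  assumes M1: "oriented_riemannian_manifold A1 g"
    and M2: "oriented_riemannian_manifold A2 h"
    and f: "Ck_map 2 A1 A2 f"
begin

lemma atlas1: "oriented_atlas A1" and metric1: "riemannian_metric A1 g"
  using M1 by (simp_all add: oriented_riemannian_manifold_def)

lemma atlas2: "oriented_atlas A2" and metric2: "riemannian_metric A2 h"
  using M2 by (simp_all add: oriented_riemannian_manifold_def)

lemma coord_dom_open: "c1 \<in> A1 \<Longrightarrow> c2 \<in> A2 \<Longrightarrow> open (coord_dom c1 c2 f)"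
  using f by (intro open_coord_dom atlas_chart[OF atlas1] atlas_chart[OF atlas2]) (auto simp: Ck_map_def)

lemma coord_rep_C2: "c1 \<in> A1 \<Longrightarrow> c2 \<in> A2 \<Longrightarrow> Ck_on 2 (coord_rep c1 c2 f) (coord_dom c1 c2 f)"
  using f by (simp add: Ck_map_def)

lemma coord_rep_C1: "c1 \<in> A1 \<Longrightarrow> c2 \<in> A2 \<Longrightarrow> C1_on (coord_rep c1 c2 f) (coord_dom c1 c2 f)"
  by (rule Ck_on_2D(1)[OF coord_dom_open coord_rep_C2])

lemma in_coord_dom:
  fixes c2 :: "('m2, 'n) chart"
  shows "c1 \<in> A1 \<Longrightarrow> x \<in> coord_dom c1 c2 f \<longleftrightarrow> x \<in> ran c1 \<and> f (chart_inv c1 x) \<in> dom c2"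
  by (rule in_coord_dom_iff[OF atlas_chart[OF atlas1]])

lemma coord_rep_in_ran:
  fixes c2 :: "('m2, 'n) chart"
  shows "c1 \<in> A1 \<Longrightarrow> x \<in> coord_dom c1 c2 f \<Longrightarrow> coord_rep c1 c2 f x \<in> ran c2"
  by (simp add: in_coord_dom coord_rep_def)

lemma metric_along_map:
  assumes "c1 \<in> A1" "c2 \<in> A2" "x \<in> coord_dom c1 c2 f"
  shows "(\<lambda>z. h c2 z $ k $ l) differentiable (at (coord_rep c1 c2 f x))"
    and "transpose (h c2 (coord_rep c1 c2 f x)) = h c2 (coord_rep c1 c2 f x)"
    and "det (h c2 (coord_rep c1 c2 f x)) > 0"
  using coord_rep_in_ran[OF assms(1,3)] metric_sym[OF atlas2 metric2 assms(2)]
    metric_det_pos[OF atlas2 metric2 assms(2)] C1_on_imp_differentiable[OF metric_C1[OF atlas2 metric2 assms(2)]]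
  by blast+

lemma coordinate_identities:
  assumes "c1 \<in> A1" "c2 \<in> A2" "x \<in> coord_dom c1 c2 f"
  shows "piola_coord (h c2) (coord_rep c1 c2 f) \<gamma> x = 0" "piola_div (coord_rep c1 c2 f) \<gamma> x = 0"
  using piola_coord_eq_0[OF coord_dom_open[OF assms(1,2)] assms(3) coord_rep_C2[OF assms(1,2)] metric_along_map[OF assms]]
    piola_div_eq_0[OF coord_dom_open[OF assms(1,2)] assms(3) coord_rep_C2[OF assms(1,2)]]
  by blast+

context
  fixes \<xi> :: "('m1, 'm2, 'n) pullback_field"
  assumes \<xi>: "pullback_section 1 A1 A2 f \<xi>"
begin

lemma section_C1:
  assumes "c1 \<in> A1" "c2 \<in> A2"
  shows "C1_on (\<lambda>x. \<xi> c2 (chart_inv c1 x)) (coord_dom c1 c2 f)"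
proof -
  have "Ck_on 1 (\<lambda>x. \<xi> c2 (chart_inv c1 x)) (coord_dom c1 c2 f)"
    using \<xi> assms unfolding pullback_section_def by blast
  then show ?thesis
    using C1_on_iff_Ck_on[OF coord_dom_open[OF assms]] by blast
qed

lemma flux_in_C1:
  assumes c: "c1 \<in> A1" "c2 \<in> A2"
  shows "C1_on (flux_in h f \<xi> c1 c2) (coord_dom c1 c2 f)"
proof (rule C1_on_vec)
  fix j
  note F = coord_rep_C1[OF c] Ck_on_2D(2)[OF coord_dom_open[OF c] coord_rep_C2[OF c]]
  have sub: "coord_rep c1 c2 f ` coord_dom c1 c2 f \<subseteq> ran c2"
    using coord_rep_in_ran[OF c(1)] by blast
  have h: "C1_on (\<lambda>x. h c2 (coord_rep c1 c2 f x) $ k $ l) (coord_dom c1 c2 f)" for k l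
    by (rule C1_on_compose[OF metric_C1[OF atlas2 metric2 c(2)] F(1) sub])
  have "C1_on (\<lambda>x. sqrt (det (h c2 (coord_rep c1 c2 f x))) *
    (\<Sum>a\<in>UNIV. cof (jacobian (coord_rep c1 c2 f) (at x)) $ a $ j * \<xi> c2 (chart_inv c1 x) $ a)) (coord_dom c1 c2 f)"
  proof (intro C1_on_mult C1_on_sum C1_on_sqrt C1_on_det h C1_on_cof)
    show "C1_on (\<lambda>x. jacobian (coord_rep c1 c2 f) (at x) $ i $ l) (coord_dom c1 c2 f)" for i l
      unfolding jacobian_component by (rule C1_on_component[OF F(2)])
    show "C1_on (\<lambda>x. \<xi> c2 (chart_inv c1 x) $ a) (coord_dom c1 c2 f)" for a
      by (rule C1_on_component[OF section_C1[OF c]])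
    show "det (h c2 (coord_rep c1 c2 f x)) > 0" if "x \<in> coord_dom c1 c2 f" for x
      by (rule metric_along_map(3)[OF c that])
  qed
  then show "C1_on (\<lambda>x. flux_in h f \<xi> c1 c2 x $ j) (coord_dom c1 c2 f)"
    by (simp add: flux_in_def flux_def matrix_vector_mult_def transpose_def)
qed

text \<open>
  A change \<open>T\<close> of the chart of the target multiplies the components of \<open>\<xi>\<close> by \<open>dT\<close>, the cofactor
  by that of \<open>dT\<close>, and the volume density by \<open>1 / det dT\<close>. These factors cancel.
\<close>

lemma flux_in_target_chart:
  assumes c: "c1 \<in> A1" "c2 \<in> A2" "c2' \<in> A2" and x: "x \<in> coord_dom c1 c2 f" "x \<in> coord_dom c1 c2' f"
  shows "flux_in h f \<xi> c1 c2 x = flux_in h f \<xi> c1 c2' x"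
proof -
  let ?F = "coord_rep c1 c2 f" and ?F' = "coord_rep c1 c2' f" and ?T = "transition c2 c2'"
  let ?U = "coord_dom c1 c2 f \<inter> coord_dom c1 c2' f"
  let ?J = "jacobian ?F (at x)" and ?JT = "jacobian ?T (at (?F x))"
  have Fx: "?F z = snd c2 (f (chart_inv c1 z))" "?F' z = snd c2' (f (chart_inv c1 z))" for z
    by (simp_all add: coord_rep_def)
  have fx: "f (chart_inv c1 z) \<in> dom c2" "f (chart_inv c1 z) \<in> dom c2'" if "z \<in> ?U" for z
    using that in_coord_dom[OF c(1), of z c2] in_coord_dom[OF c(1), of z c2'] by auto
  have T: "?F z \<in> transition_dom c2 c2'" "?F' z = ?T (?F z)" if "z \<in> ?U" for z
    unfolding Fx using transition_chart[OF atlas2 c(2) fx[OF that]] by auto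
  have xU: "x \<in> ?U" using x by simp
  have U: "open ?U"
    by (intro open_Int coord_dom_open c)
  note dT = transition_det_pos[OF atlas2 c(2,3) T(1)[OF xU]]
  have "jacobian ?F' (at x) = jacobian (\<lambda>z. ?T (?F z)) (at x)"
    by (rule jacobian_cong[OF U xU T(2)])
  also have "\<dots> = ?JT ** ?J"
    by (intro jacobian_compose C1_on_imp_differentiable[OF coord_rep_C1 x(1)] c
      transition_differentiable[OF atlas2 c(2,3) T(1)[OF xU]])
  finally have J: "jacobian ?F' (at x) = ?JT ** ?J" .
  have "\<xi> c2' (chart_inv c1 x) = ?JT *v \<xi> c2 (chart_inv c1 x)"
    using \<xi> c(2,3) fx[OF xU] unfolding pullback_section_def Fx by blast
  moreover have "transpose (cof ?JT) *v (?JT *v v) = det ?JT *\<^sub>R v" for v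
  proof -
    have "transpose (cof ?JT) ** ?JT = det ?JT *\<^sub>R mat 1"
      using laplace_column[of ?JT]
      by (simp add: vec_eq_iff matrix_matrix_mult_def transpose_def mat_def mult.commute)
    then show ?thesis
      by (simp add: matrix_vector_mul_assoc scaleR_matrix_vector_assoc[symmetric])
  qed
  moreover have "sqrt (det (h c2 (?F x))) = det ?JT * sqrt (det (h c2' (?F' x)))"
    using volume_density_transition[OF atlas2 metric2 c(2,3) T(1)[OF xU]] T(2)[OF xU] by simp
  ultimately show ?thesis
    unfolding flux_in_def flux_def J cof_mult_left[OF less_imp_neq[OF dT, symmetric]] matrix_transpose_mul
    by (simp add: matrix_vector_mul_assoc[symmetric] matrix_vector_mult_scaleR mult.commute del: transpose_matrix_vector)
qed

text \<open>
  Only the Jacobian of the coordinate representation sees the chart of the source, and the cofactor is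
  multiplicative.
\<close>

lemma flux_in_source_chart:
  assumes c: "c1 \<in> A1" "c1' \<in> A1" "c2 \<in> A2" and x: "x \<in> coord_dom c1 c2 f" "x \<in> transition_dom c1 c1'"
  shows "flux_in h f \<xi> c1 c2 x =
    transpose (cof (jacobian (transition c1 c1') (at x))) *v flux_in h f \<xi> c1' c2 (transition c1 c1' x)"
proof -
  let ?F = "coord_rep c1 c2 f" and ?F' = "coord_rep c1' c2 f" and ?T = "transition c1 c1'"
  let ?U = "coord_dom c1 c2 f \<inter> transition_dom c1 c1'"
  let ?J' = "jacobian ?F' (at (?T x))" and ?JT = "jacobian ?T (at x)"
  have inv: "chart_inv c1' (?T z) = chart_inv c1 z" if "z \<in> ?U" for z
    using that in_transition_dom_iff[OF atlas1 c(1)] chart_inv_chart[OF atlas_chart[OF atlas1 c(2)]]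
    by (simp add: coord_rep_def)
  have F: "?F z = ?F' (?T z)" if "z \<in> ?U" for z
    using inv[OF that] by (simp add: coord_rep_def)
  have xU: "x \<in> ?U" using x by simp
  have U: "open ?U"
    by (intro open_Int coord_dom_open open_transition_dom[OF atlas1] c)
  have Tx: "?T x \<in> coord_dom c1' c2 f"
    using transition_inverse(1)[OF atlas1 c(1,2) x(2)] inv[OF xU] x(1)
    by (simp add: in_coord_dom c in_transition_dom_iff[OF atlas1])
  note dT = transition_det_pos[OF atlas1 c(1,2) x(2)]
  have "jacobian ?F (at x) = jacobian (\<lambda>z. ?F' (?T z)) (at x)"
    by (rule jacobian_cong[OF U xU F])
  also have "\<dots> = ?J' ** ?JT"
    by (intro jacobian_compose C1_on_imp_differentiable[OF coord_rep_C1 Tx] c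
      transition_differentiable[OF atlas1 c(1,2) x(2)])
  finally have J: "jacobian ?F (at x) = ?J' ** ?JT" .
  show ?thesis
    unfolding flux_in_def flux_def J cof_mult_right[OF less_imp_neq[OF dT, symmetric]] matrix_transpose_mul
    using F[OF xU] inv[OF xU]
    by (simp add: matrix_vector_mul_assoc matrix_vector_mult_scaleR del: transpose_matrix_vector)
qed

lemma flux_density_eq:
  assumes "c1 \<in> A1" "c2 \<in> A2" "x \<in> coord_dom c1 c2 f"
  shows "flux_density A2 h f \<xi> c1 x = flux_in h f \<xi> c1 c2 x"
proof -
  let ?b = "SOME c2. c2 \<in> A2 \<and> f (chart_inv c1 x) \<in> dom c2"
  have x: "x \<in> ran c1" "f (chart_inv c1 x) \<in> dom c2"
    using assms in_coord_dom by blast+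
  then have b: "?b \<in> A2 \<and> f (chart_inv c1 x) \<in> dom ?b"
    using someI[of "\<lambda>c2. c2 \<in> A2 \<and> f (chart_inv c1 x) \<in> dom c2" c2] assms(2) by blast
  then have "x \<in> coord_dom c1 ?b f"
    using x(1) in_coord_dom[OF assms(1)] by blast
  then show ?thesis
    unfolding flux_density_def using b assms by (intro flux_in_target_chart) auto
qed

lemma in_some_coord_dom:
  assumes "c1 \<in> A1" "x \<in> ran c1"
  obtains c2 where "c2 \<in> A2" "x \<in> coord_dom c1 c2 f"
proof -
  obtain c2 where "c2 \<in> A2" "f (chart_inv c1 x) \<in> dom c2"
    using atlas_cover[OF atlas2] .
  with that assms in_coord_dom show thesis by blast
qed

lemma flux_density_vector_density: "vector_density A1 (flux_density A2 h f \<xi>)"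
  unfolding vector_density_def
proof (intro conjI ballI)
  fix c assume c: "c \<in> A1"
  show "C1_on (flux_density A2 h f \<xi> c) (ran c)"
  proof (rule C1_on_local)
    fix x assume "x \<in> ran c"
    then obtain c2 where c2: "c2 \<in> A2" "x \<in> coord_dom c c2 f"
      using in_some_coord_dom[OF c] by blast
    have "C1_on (flux_density A2 h f \<xi> c) (coord_dom c c2 f)"
      by (rule C1_on_cong[OF coord_dom_open[OF c c2(1)] _ flux_in_C1[OF c c2(1)]])
        (rule flux_density_eq[OF c c2(1), symmetric])
    then show "\<exists>U. open U \<and> x \<in> U \<and> C1_on (flux_density A2 h f \<xi> c) U"
      using coord_dom_open[OF c c2(1)] c2(2) by blast
  qed
  fix c' x assume c': "c' \<in> A1" and x: "x \<in> transition_dom c c'"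
  have "x \<in> ran c" "chart_inv c x \<in> dom c'"
    using x in_transition_dom_iff[OF atlas1 c] by blast+
  then obtain c2 where c2: "c2 \<in> A2" "x \<in> coord_dom c c2 f"
    using in_some_coord_dom[OF c] by blast
  have "chart_inv c' (transition c c' x) = chart_inv c x"
    using \<open>chart_inv c x \<in> dom c'\<close> chart_inv_chart[OF atlas_chart[OF atlas1 c']] by (simp add: coord_rep_def)
  then have "transition c c' x \<in> coord_dom c' c2 f"
    using c2(2) transition_inverse(1)[OF atlas1 c c' x]
    by (simp add: in_coord_dom c c' in_transition_dom_iff[OF atlas1])
  then show "flux_density A2 h f \<xi> c x =
    transpose (cof (jacobian (transition c c') (at x))) *v flux_density A2 h f \<xi> c' (transition c c' x)"
    using flux_in_source_chart[OF c c' c2(1) c2(2) x] flux_density_eq[OF c c2] flux_density_eq[OF c' c2(1)] by simp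
qed

text \<open>
  The pairing is computed in a pair of charts that is chosen anew at each point, whereas
  \<open>density_div\<close> may be evaluated in any chart, hence also in the one chosen.
\<close>

lemma cof_pairing_eq_divergence: "cof_pairing A1 g A2 h f \<xi> p = density_div A1 g (flux_density A2 h f \<xi>) p"
proof -
  define c1 where "c1 = (SOME c. c \<in> A1 \<and> p \<in> dom c)"
  define c2 where "c2 = (SOME c. c \<in> A2 \<and> f p \<in> dom c)"
  obtain b1 b2 where "b1 \<in> A1" "p \<in> dom b1" "b2 \<in> A2" "f p \<in> dom b2"
    using atlas_cover[OF atlas1] atlas_cover[OF atlas2] by metis
  then have c1: "c1 \<in> A1" "p \<in> dom c1" and c2: "c2 \<in> A2" "f p \<in> dom c2"
    using someI[of "\<lambda>c. c \<in> A1 \<and> p \<in> dom c" b1] someI[of "\<lambda>c. c \<in> A2 \<and> f p \<in> dom c" b2]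
    unfolding c1_def c2_def by blast+
  let ?x = "snd c1 p" and ?F = "coord_rep c1 c2 f" and ?\<xi> = "\<lambda>x. \<xi> c2 (chart_inv c1 x)"
  let ?J = "jacobian ?F (at ?x)"
  have ran: "?x \<in> ran c1" using c1(2) by blast
  have x: "?x \<in> coord_dom c1 c2 f"
    using c1 c2 in_coord_dom[OF c1(1)] chart_inv_chart[OF atlas_chart[OF atlas1 c1(1)] c1(2)] by simp
  note dom = coord_dom_open[OF c1(1) c2(1)]
  note H = metric_along_map[OF c1(1) c2(1) x]
  have \<xi>_diff: "?\<xi> differentiable (at ?x)"
    by (rule C1_on_imp_differentiable[OF section_C1[OF c1(1) c2(1)] x])
  have "cof_pairing A1 g A2 h f \<xi> p = cof_pairing_in g h f c1 c2 \<xi> ?x"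
    by (simp add: cof_pairing_def c1_def c2_def Let_def)
  also have "\<dots> = sqrt (det (h c2 (?F ?x))) / sqrt (det (g c1 ?x)) *
    (\<Sum>\<beta>\<in>UNIV. \<Sum>j\<in>UNIV. cof ?J $ \<beta> $ j * pullback_nabla h f c1 c2 \<xi> ?x $ \<beta> $ j)"
    unfolding cof_pairing_in_def Let_def
    by (rule Cof_pairing[OF metric_det_pos[OF atlas1 metric1 c1(1) ran] H(3)])
  also have "\<dots> = divergence (flux_in h f \<xi> c1 c2) ?x / sqrt (det (g c1 ?x))"
    unfolding flux_in_def divergence_flux[OF dom x coord_rep_C2[OF c1(1) c2(1)] H \<xi>_diff]
    by (simp add: pullback_nabla_def)
  also have "divergence (flux_in h f \<xi> c1 c2) ?x = divergence (flux_density A2 h f \<xi> c1) ?x"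
    by (rule divergence_cong[OF dom x]) (rule flux_density_eq[OF c1(1) c2(1), symmetric])
  finally show ?thesis
    by (simp add: density_div_eq[OF atlas1 metric1 flux_density_vector_density c1])
qed

lemma integral_cof_pairing_eq_0:
  assumes "compact (section_support A2 f \<xi>)"
  shows "(LINT p|riemannian_volume A1 g. cof_pairing A1 g A2 h f \<xi> p) = 0"
proof -
  have zero: "flux_density A2 h f \<xi> c (snd c p) = 0"
    if c: "c \<in> A1" "p \<in> dom c" and p: "p \<notin> section_support A2 f \<xi>" for c p
  proof -
    obtain c2 where c2: "c2 \<in> A2" "snd c p \<in> coord_dom c c2 f"
      using in_some_coord_dom[OF c(1)] c(2) by blast
    have inv: "chart_inv c (snd c p) = p"
      by (rule chart_inv_chart[OF atlas_chart[OF atlas1 c(1)] c(2)])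
    then have "f p \<in> dom c2"
      using c2(2) in_coord_dom[OF c(1)] by simp
    have "\<xi> c2 p = 0"
    proof (rule ccontr)
      assume "\<xi> c2 p \<noteq> 0"
      with c2(1) \<open>f p \<in> dom c2\<close> have "p \<in> {p. \<exists>c\<in>A2. f p \<in> dom c \<and> \<xi> c p \<noteq> 0}"
        by blast
      then have "p \<in> section_support A2 f \<xi>"
        unfolding section_support_def by (rule subsetD[OF closure_subset])
      with p show False ..
    qed
    then show ?thesis
      by (simp add: flux_density_eq[OF c(1) c2] flux_in_def flux_def inv)
  qed
  show ?thesis
    unfolding cof_pairing_eq_divergence
    by (rule divergence_theorem[OF atlas1 metric1 flux_density_vector_density assms zero])
qed

end

end

theorem mainTheorem6:
  fixes A1 :: "('m1::{t2_space, second_countable_topology}, 'n::{finite, wellorder}) chart set"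
    and g :: "('m1, 'n) metric"
    and A2 :: "('m2::{t2_space, second_countable_topology}, 'n) chart set"
    and h :: "('m2, 'n) metric"
    and f :: "'m1 \<Rightarrow> 'm2"
  assumes "oriented_riemannian_manifold A1 g"
    and "oriented_riemannian_manifold A2 h"
    and "Ck_map 2 A1 A2 f"
  shows "(riemannian_piola A1 g A2 h f \<longleftrightarrow>
      (\<forall>c1\<in>A1. \<forall>c2\<in>A2. \<forall>\<gamma>. \<forall>x\<in>coord_dom c1 c2 f.
        piola_coord (h c2) (coord_rep c1 c2 f) \<gamma> x = 0)) \<and>
    (\<forall>c1\<in>A1. \<forall>c2\<in>A2. \<forall>\<gamma>. \<forall>x\<in>coord_dom c1 c2 f.
      piola_coord (h c2) (coord_rep c1 c2 f) \<gamma> x = 0 \<longleftrightarrow>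
      piola_div (coord_rep c1 c2 f) \<gamma> x = 0) \<and>
    (\<forall>c1\<in>A1. \<forall>c2\<in>A2. \<forall>\<gamma>. \<forall>x\<in>coord_dom c1 c2 f.
      piola_coord (h c2) (coord_rep c1 c2 f) \<gamma> x = 0 \<and>
      piola_div (coord_rep c1 c2 f) \<gamma> x = 0)"
proof -
  have "riemannian_piola A1 g A2 h f"
    unfolding riemannian_piola_def using integral_cof_pairing_eq_0[OF assms] by blast
  then show ?thesis
    using coordinate_identities[OF assms] by simp
qed

end
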